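(* Let $l\ge 1$, let $b_1=[\alpha_1,\alpha_2,\dots,\alpha_j]=\alpha_j\otimes\alpha_{j-1}\otimes\cdots\otimes\alpha_1\in\mathcal B_l$ be a one-row tableau with $0\le j\le l$ entries (with $b_1=\varnothing$ if $j=0$), and let $b_2\in\mathcal B_1$, so that either $b_2=\beta\in\mathcal B(1)$ or $b_2=\varnothing$. Then the unique $U_q'(G_2^{(1)})$-crystal isomorphism $\mathcal R:\mathcal B_l\otimes\mathcal B_1\to\mathcal B_1\otimes\mathcal B_l$ is given as follows (for $j=0$ and $b_2=\beta$ the condition $\alpha_1\otimes\beta\in\mathcal B(1\;1)$ is regarded as satisfied): 1. If $b_2=\beta$, $\alpha_1\otimes\beta\in\mathcal B(1\;1)$ and $j=l$: $\mathcal R(b_1\otimes b_2)=\alpha_l\otimes[\beta,\alpha_1,\dots,\alpha_{l-1}]$. 2. If $b_2=\beta$, $\alpha_1\otimes\beta\in\mathcal B(1\;1)$ and $j=l-1$: $\mathcal R(b_1\otimes b_2)=\varnothing\otimes[\beta,\alpha_1,\dots,\alpha_{l-1}]$. 3. If $b_2=\beta$, $\alpha_1\otimes\beta\in\mathcal B(1\;1)$ and $j<l-1$: $\mathcal R(b_1\otimes b_2)=1\otimes[\beta,\alpha_1,\dots,\alpha_j,\overline 1]$. 4. If $b_2=\varnothing$ and $j=l$: $\mathcal R(b_1\otimes b_2)=\alpha_l\otimes[\alpha_1,\dots,\alpha_{l-1}]$. 5. If $b_2=\varnothing$ and $j<l$: $\mathcal R(b_1\otimes b_2)=\varnothing\otimes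 b_1$. 6. If $b_2=\beta$, $\alpha_1\otimes\beta\in\mathcal B(1\;2)$ and $j=l$: $\mathcal R(b_1\otimes b_2)=q_{l+1}\otimes[q_1,\dots,q_l]$, where $q_{l+1}\otimes q_l\otimes\cdots\otimes q_1=\eta_1\eta_2\cdots\eta_{l-1}(b_1\otimes b_2)$. 7. If $b_2=\beta$, $\alpha_1\otimes\beta\in\mathcal B(1\;2)$ and $1\le j<l$: $\mathcal R(b_1\otimes b_2)=p\otimes[q_1,\dots,q_j,r]$, where $p\otimes r\otimes q_j\otimes\cdots\otimes q_1=\xi_1^{-1}\eta_1\eta_2\cdots\eta_{j-1}(b_1\otimes b_2)$. 8. If $b_2=\beta$, $\alpha_1\otimes\beta\in\mathcal B(1\;2_3)$ and $j>1$: $\mathcal R(b_1\otimes b_2)=q_{j+1}\otimes[q_1,\dots,q_j]$, where $q_{j+1}\otimes q_j\otimes\cdots\otimes q_1=\theta_1\theta_2\cdots\theta_{j-1}(b_1\otimes b_2)$. 9. If $b_2=\beta$, $j>1$, $\alpha_1\otimes\beta\in\mathcal B(1\;0)$ and $\alpha_2\otimes\xi(\alpha_1\otimes\beta)\in\mathcal B(1\;1)$: $\mathcal R(b_1\otimes b_2)=p\otimes[r,\alpha_2,\alpha_3,\dots,\alpha_{j-1},q]$, where $p\otimes q=\xi^{-1}(\alpha_j)$ and $r=\xi(\alpha_1\otimes\beta)$. 10. If $b_2=\beta$, $j>1$, $\alpha_1\otimes\beta\in\mathcal B(1\;0)$ and $\alpha_2\otimes\xi(\alpha_1\otimes\beta)\in\mathcal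 B(1\;2)$: $\mathcal R(b_1\otimes b_2)=p\otimes[q_1,\dots,q_{j-1}]$, where $p\otimes q_{j-1}\otimes\cdots\otimes q_1=\eta_1\eta_2\cdots\eta_{j-2}\,\xi_j(b_1\otimes b_2)$. 11. If $b_2=\beta$, $j>1$ and $\alpha_1\otimes\beta=1\otimes\overline 1$: $\mathcal R(b_1\otimes b_2)=\alpha_j\otimes[\alpha_2,\alpha_3,\dots,\alpha_{j-1}]$. 12. In all other cases $\mathcal R(b_1\otimes b_2)=b_1\otimes b_2$ (in these cases $b_1$ is a one-entry tableau, regarded as an element of $\mathcal B_1$, and $b_2$ is regarded as an element of $\mathcal B_l$). An empty composition of maps is the identity, and $[\,]$ with no entries means $\varnothing$.
   Context: Crystals. Let $I=\{0,1,2\}$. A crystal is a set $\mathcal B$ with maps $\tilde e_i,\tilde f_i:\mathcal B\to\mathcal B\sqcup\{0\}$ and $\varepsilon_i,\varphi_i:\mathcal B\to\mathbb Z_{\ge0}$ $(i\in I)$ with $\tilde f_ib=b'\iff b=\tilde e_ib'$ for $b,b'\in\mathcal B$; its weight is $\mathrm{wt}(b)=\sum_i(\varphi_i(b)-\varepsilon_i(b))\Lambda_i$. The tensor product $\mathcal B\otimes\mathcal B'$ is the set of $b_1\otimes b_2$ with: $\tilde e_i(b_1\otimes b_2)=\tilde e_ib_1\otimes b_2$ if $\varphi_i(b_1)\ge\varepsilon_i(b_2)$ and $b_1\otimes\tilde e_ib_2$ otherwise; $\tilde f_i(b_1\otimes b_2)=\tilde f_ib_1\otimes b_2$ if $\varphi_i(b_1)>\varepsilon_i(b_2)$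 and $b_1\otimes\tilde f_ib_2$ otherwise; $\varepsilon_i(b_1\otimes b_2)=\max(\varepsilon_i(b_1),\varepsilon_i(b_2)-\varphi_i(b_1)+\varepsilon_i(b_1))$, $\varphi_i(b_1\otimes b_2)=\max(\varphi_i(b_2),\varphi_i(b_1)+\varphi_i(b_2)-\varepsilon_i(b_2))$; here $b\otimes0=0\otimes b=0$. An isomorphism of crystals is a bijection preserving all $\varepsilon_i,\varphi_i$ (hence weights) and commuting with all $\tilde e_i,\tilde f_i$ (with $0\mapsto0$). A $G_2$-crystal is the same with only $i\in\{1,2\}$; an element is highest weight if $\tilde e_1,\tilde e_2$ send it to $0$. The crystal $\mathcal B_l$ for $U_q'(G_2^{(1)})$, $l\ge1$: the set of $b=(x_1,x_2,x_3,\overline x_3,\overline x_2,\overline x_1)\in(\frac13\mathbb Z_{\ge0})^6$ with $3x_3\equiv3\overline x_3\pmod 2$, $x_1,\overline x_1,x_2-x_3,\overline x_3-\overline x_2\in\mathbb Z$ and $s(b):=x_1+x_2+\frac{x_3+\overline x_3}2+\overline x_2+\overline x_1\le l$. Put $z_1=\overline x_1-x_1$, $z_2=\overline x_2-\overline x_3$, $z_3=x_3-x_2$, $z_4=\frac12(\overline x_3-x_3)$, $(a)_+=\max(a,0)$, and $a_1=0$, $a_2=z_1$, $a_3=z_1+z_2$, $a_4=z_1+z_2+3z_4$, $a_5=z_1+z_2+z_3+3z_4$, $a_6=2z_1+z_2+z_3+3z_4$, $M=\max_ia_i$. The operators $\tilde e_i$ change only the listed coordinates: $\tilde e_0$: let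 $i$ be the largest index with $a_i=M$. If $i=1$: $x_1-1$. If $i=2$: $x_3-1,\overline x_3-1,\overline x_1+1$. If $i=3$ and $z_4=-\frac13$: $x_2-\frac23,x_3-\frac23,\overline x_3+\frac43,\overline x_2+\frac13$. If $i=3$ and $z_4=-\frac23$: $x_2-\frac13,x_3-\frac43,\overline x_3+\frac23,\overline x_2+\frac23$. If $i=3$ and $z_4\ne-\frac13,-\frac23$: $x_3-2,\overline x_2+1$. If $i=4$: $x_2-1,\overline x_3+2$. If $i=5$: $x_1-1,x_3+1,\overline x_3+1$. If $i=6$: $\overline x_1+1$. $\tilde e_1$: $\overline x_2+1,\overline x_1-1$ if $z_2\ge(-z_3)_+$; $x_3+1,\overline x_3-1$ if $z_2<0\le z_3$; $x_1+1,x_2-1$ if $(z_2)_+<-z_3$. $\tilde e_2$: $\overline x_3+\frac23,\overline x_2-\frac13$ if $z_4\ge0$; $x_2+\frac13,x_3-\frac23$ if $z_4<0$. If the result is not in $\mathcal B_l$ it is $0$; $\tilde f_i$ is the inverse partial map ($0$ where undefined). Further $\varepsilon_1=\overline x_1+(\overline x_3-\overline x_2+(x_2-x_3)_+)_+$, $\varphi_1=x_1+(x_3-x_2+(\overline x_2-\overline x_3)_+)_+$, $\varepsilon_2=3\overline x_2+\frac32(x_3-\overline x_3)_+$, $\varphi_2=3x_2+\frac32(\overline x_3-x_3)_+$, $\varphi_0=l-s(b)+M$, $\varepsilon_0=l-s(b)+M-a_6$. It is known that there is a unique crystal isomorphism $\mathcal R:\mathcal B_l\otimes\mathcal B_1\to\mathcal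 B_1\otimes\mathcal B_l$. Names of the elements of $\mathcal B_1$ (15 elements): $\varnothing=(0,0,0,0,0,0)$, $1=(1,0,0,0,0,0)$, $2=(0,1,0,0,0,0)$, $2_1=(0,\frac23,\frac23,0,0,0)$, $2_2=(0,\frac13,\frac43,0,0,0)$, $2_3=(0,\frac13,\frac13,1,0,0)$, $3=(0,0,2,0,0,0)$, $0=(0,0,1,1,0,0)$, $\hat0=(0,\frac13,\frac13,\frac13,\frac13,0)$, $\overline3=(0,0,0,2,0,0)$, $\overline2_3=(0,0,1,\frac13,\frac13,0)$, $\overline2_2=(0,0,0,\frac43,\frac13,0)$, $\overline2_1=(0,0,0,\frac23,\frac23,0)$, $\overline2=(0,0,0,0,1,0)$, $\overline1=(0,0,0,0,0,1)$. (The element named $0$ is not the zero symbol of the crystal operators.) The 14 elements other than $\varnothing$ form the connected $G_2$-crystal $\mathcal B(1)=\mathcal B(\Lambda_1)$. Tableaux. For a highest weight element $c_1\otimes\cdots\otimes c_n$ of the $G_2$-crystal $\mathcal B(1)^{\otimes n}$, $\mathcal B(c_1\;c_2\cdots c_n)$ denotes the connected $G_2$-subcrystal it generates. A one-row (semistandard) tableau $[\alpha_1,\dots,\alpha_j]$ is the element $\alpha_j\otimes\alpha_{j-1}\otimes\cdots\otimes\alpha_1$, required to lie in the component $\mathcal B(1\;1\cdots1)\cong\mathcal B(j\Lambda_1)$ of $1^{\otimes j}$. As a $G_2$-crystal, $\mathcal B_l\cong\bigoplus_{j=0}^l\mathcal B(j\Lambda_1)$ by a unique isomorphism, under which $[1^j]$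 corresponds to $(j,0,0,0,0,0)$; elements of $\mathcal B_l$ are identified in this way with one-row tableaux with at most $l$ entries, $\varnothing$ being the empty tableau. Maps. $\xi:\mathcal B(1\;0)\to\mathcal B(1)$, $\eta:\mathcal B(1\;1\;2)\to\mathcal B(1\;2\;1)$, $\theta:\mathcal B(1\;1\;2_3)\to\mathcal B(1\;2_3\;1)$ are the unique $G_2$-crystal isomorphisms. $\xi_i$ applies $\xi$ to the factors in positions $i,i+1$ of a tensor product of elements of $\mathcal B(1)$ (replacing them by one factor), $\xi_1^{-1}$ replaces the first factor $x$ by the two factors of $\xi^{-1}(x)$, and $\eta_i$ (resp. $\theta_i$) applies $\eta$ (resp. $\theta$) to the factors in positions $i,i+1,i+2$; positions are counted from the left, and $b_1\otimes b_2$ stands for $\alpha_j\otimes\cdots\otimes\alpha_1\otimes\beta$. *)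

theory Defs
  imports Complex_Main "HOL-Library.Product_Plus"
begin

section \<open>Crystals\<close>

text \<open>The zero symbol of the operators is rendered by \<^const>\<open>None\<close>.\<close>

record 'b crystal =
  carr :: "'b set"
  et :: "nat \<Rightarrow> 'b \<Rightarrow> 'b option"
  ft :: "nat \<Rightarrow> 'b \<Rightarrow> 'b option"
  eps :: "nat \<Rightarrow> 'b \<Rightarrow> int"
  phi :: "nat \<Rightarrow> 'b \<Rightarrow> int"

text \<open>
  The index set \<open>I\<close> is a parameter: \<open>{0,1,2}\<close> for \<open>U_q'(G_2^{(1)})\<close>-crystals and
  \<open>{1,2}\<close> for \<open>G_2\<close>-crystals, so that an affine crystal is a \<open>G_2\<close>-crystal by
  forgetting the index \<open>0\<close>.
\<close>

definition crystal_iso :: "nat set \<Rightarrow> 'b crystal \<Rightarrow> 'c crystal \<Rightarrow> ('b \<Rightarrow> 'c) \<Rightarrow> bool" where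
  "crystal_iso I A B h \<longleftrightarrow>
     bij_betw h (carr A) (carr B) \<and>
     (\<forall>i\<in>I. \<forall>b\<in>carr A.
        eps B i (h b) = eps A i b \<and>
        phi B i (h b) = phi A i b \<and>
        et B i (h b) = map_option h (et A i b) \<and>
        ft B i (h b) = map_option h (ft A i b))"

definition tensor :: "'b crystal \<Rightarrow> 'c crystal \<Rightarrow> ('b \<times> 'c) crystal" where
  "tensor A B = \<lparr>
     carr = carr A \<times> carr B,
     et = (\<lambda>i (a, b). if phi A i a \<ge> eps B i b then map_option (\<lambda>a'. (a', b)) (et A i a)
                      else map_option (\<lambda>b'. (a, b')) (et B i b)),
     ft = (\<lambda>i (a, b). if phi A i a > eps B i b then map_option (\<lambda>a'. (a', b)) (ft A i a)
                      else map_option (\<lambda>b'. (a, b')) (ft B i b)),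
     eps = (\<lambda>i (a, b). max (eps A i a) (eps B i b - phi A i a + eps A i a)),
     phi = (\<lambda>i (a, b). max (phi B i b) (phi A i a + phi B i b - eps B i b)) \<rparr>"

text \<open>
  Tensor powers of a crystal: the word \<open>[c\<^sub>1, \<dots>, c\<^sub>n]\<close> is \<open>c\<^sub>1 \<otimes> \<dots> \<otimes> c\<^sub>n\<close>, bracketed as
  \<open>c\<^sub>1 \<otimes> (c\<^sub>2 \<otimes> \<dots>)\<close>. The empty word is the one-element crystal \<open>\<B>(0)\<close>; it is a right unit
  for \<open>\<otimes>\<close>, so that one-letter words behave like their letter, as long as \<open>\<phi>\<^sub>i(c) = 0\<close>
  implies \<open>f\<^sub>i c = 0\<close>.
\<close>

primrec word_eps :: "'b crystal \<Rightarrow> nat \<Rightarrow> 'b list \<Rightarrow> int" where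
  "word_eps C i [] = 0"
| "word_eps C i (c # w) = max (eps C i c) (word_eps C i w - phi C i c + eps C i c)"

primrec word_phi :: "'b crystal \<Rightarrow> nat \<Rightarrow> 'b list \<Rightarrow> int" where
  "word_phi C i [] = 0"
| "word_phi C i (c # w) = max (word_phi C i w) (phi C i c + word_phi C i w - word_eps C i w)"

primrec word_et :: "'b crystal \<Rightarrow> nat \<Rightarrow> 'b list \<Rightarrow> 'b list option" where
  "word_et C i [] = None"
| "word_et C i (c # w) =
     (if phi C i c \<ge> word_eps C i w then map_option (\<lambda>c'. c' # w) (et C i c)
      else map_option (\<lambda>w'. c # w') (word_et C i w))"

primrec word_ft :: "'b crystal \<Rightarrow> nat \<Rightarrow> 'b list \<Rightarrow> 'b list option" where
  "word_ft C i [] = None"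
| "word_ft C i (c # w) =
     (if phi C i c > word_eps C i w then map_option (\<lambda>c'. c' # w) (ft C i c)
      else map_option (\<lambda>w'. c # w') (word_ft C i w))"

definition words :: "'b crystal \<Rightarrow> 'b list crystal" where
  "words C = \<lparr> carr = lists (carr C), et = word_et C, ft = word_ft C,
               eps = word_eps C, phi = word_phi C \<rparr>"

definition component :: "nat set \<Rightarrow> 'b crystal \<Rightarrow> 'b \<Rightarrow> 'b set" where
  "component I C c =
     {b. (c, b) \<in> {(x, y). \<exists>i\<in>I. et C i x = Some y \<or> ft C i x = Some y}\<^sup>*}"

section \<open>The crystal \<open>\<B>\<^sub>l\<close>\<close>

text \<open>
  The tuple \<open>(x1, x2, x3, y3, y2, y1)\<close> stands for
  \<open>(x\<^sub>1, x\<^sub>2, x\<^sub>3, \<bar>x\<^sub>3, \<bar>x\<^sub>2, \<bar>x\<^sub>1)\<close>; addition of tuples is componentwise.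
\<close>

type_synonym coords = "rat \<times> rat \<times> rat \<times> rat \<times> rat \<times> rat"

fun s_val :: "coords \<Rightarrow> rat" where
  "s_val (x1, x2, x3, y3, y2, y1) = x1 + x2 + (x3 + y3) / 2 + y2 + y1"

definition thirds :: "rat set" where
  "thirds = {of_nat n / 3 | n. True}"

definition Bset :: "nat \<Rightarrow> coords set" where
  "Bset l = {(x1, x2, x3, y3, y2, y1) | x1 x2 x3 y3 y2 y1.
     {x1, x2, x3, y3, y2, y1} \<subseteq> thirds \<and>
     (\<exists>k::int. 3 * x3 - 3 * y3 = 2 * of_int k) \<and>
     x1 \<in> \<int> \<and> y1 \<in> \<int> \<and> x2 - x3 \<in> \<int> \<and> y3 - y2 \<in> \<int> \<and>
     s_val (x1, x2, x3, y3, y2, y1) \<le> of_nat l}"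

fun z1 :: "coords \<Rightarrow> rat" where "z1 (x1, x2, x3, y3, y2, y1) = y1 - x1"
fun z2 :: "coords \<Rightarrow> rat" where "z2 (x1, x2, x3, y3, y2, y1) = y2 - y3"
fun z3 :: "coords \<Rightarrow> rat" where "z3 (x1, x2, x3, y3, y2, y1) = x3 - x2"
fun z4 :: "coords \<Rightarrow> rat" where "z4 (x1, x2, x3, y3, y2, y1) = (y3 - x3) / 2"

abbreviation pos_part :: "rat \<Rightarrow> rat" where
  "pos_part a \<equiv> max a 0"

definition a_val :: "coords \<Rightarrow> nat \<Rightarrow> rat" where
  "a_val b i = [0, z1 b, z1 b + z2 b, z1 b + z2 b + 3 * z4 b, z1 b + z2 b + z3 b + 3 * z4 b,
                2 * z1 b + z2 b + z3 b + 3 * z4 b] ! (i - 1)"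

definition M_val :: "coords \<Rightarrow> rat" where
  "M_val b = Max (a_val b ` {1..6})"

definition e0_index :: "coords \<Rightarrow> nat" where
  "e0_index b = Max {i \<in> {1..6}. a_val b i = M_val b}"

definition e0_shift :: "coords \<Rightarrow> coords" where
  "e0_shift b =
    (let i = e0_index b in
     if i = 1 then (-1, 0, 0, 0, 0, 0)
     else if i = 2 then (0, 0, -1, -1, 0, 1)
     else if i = 3 then
       (if z4 b = -1/3 then (0, -2/3, -2/3, 4/3, 1/3, 0)
        else if z4 b = -2/3 then (0, -1/3, -4/3, 2/3, 2/3, 0)
        else (0, 0, -2, 0, 1, 0))
     else if i = 4 then (0, -1, 0, 2, 0, 0)
     else if i = 5 then (-1, 0, 1, 1, 0, 0)
     else (0, 0, 0, 0, 0, 1))"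

definition e1_shift :: "coords \<Rightarrow> coords" where
  "e1_shift b =
    (if z2 b \<ge> pos_part (- z3 b) then (0, 0, 0, 0, 1, -1)
     else if z2 b < 0 \<and> 0 \<le> z3 b then (0, 0, 1, -1, 0, 0)
     else (1, -1, 0, 0, 0, 0))"

definition e2_shift :: "coords \<Rightarrow> coords" where
  "e2_shift b =
    (if z4 b \<ge> 0 then (0, 0, 0, 2/3, -1/3, 0) else (0, 1/3, -2/3, 0, 0, 0))"

definition e_shift :: "nat \<Rightarrow> coords \<Rightarrow> coords" where
  "e_shift i b = (if i = 0 then e0_shift b else if i = 1 then e1_shift b else e2_shift b)"

definition B_et :: "nat \<Rightarrow> nat \<Rightarrow> coords \<Rightarrow> coords option" where
  "B_et l i b = (if b + e_shift i b \<in> Bset l then Some (b + e_shift i b) else None)"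

definition B_ft :: "nat \<Rightarrow> nat \<Rightarrow> coords \<Rightarrow> coords option" where
  "B_ft l i b =
    (if \<exists>b'\<in>Bset l. B_et l i b' = Some b
     then Some (THE b'. b' \<in> Bset l \<and> B_et l i b' = Some b) else None)"

text \<open>
  On \<open>\<B>\<^sub>l\<close> the expressions under the floor are non-negative integers; the floor only
  transfers them to the type \<^typ>\<open>int\<close>.
\<close>

fun B_eps :: "nat \<Rightarrow> nat \<Rightarrow> coords \<Rightarrow> int" where
  "B_eps l i (x1, x2, x3, y3, y2, y1) =
    (let b = (x1, x2, x3, y3, y2, y1) in
     if i = 0 then \<lfloor>of_nat l - s_val b + M_val b - a_val b 6\<rfloor>
     else if i = 1 then \<lfloor>y1 + pos_part (y3 - y2 + pos_part (x2 - x3))\<rfloor>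
     else \<lfloor>3 * y2 + 3/2 * pos_part (x3 - y3)\<rfloor>)"

fun B_phi :: "nat \<Rightarrow> nat \<Rightarrow> coords \<Rightarrow> int" where
  "B_phi l i (x1, x2, x3, y3, y2, y1) =
    (let b = (x1, x2, x3, y3, y2, y1) in
     if i = 0 then \<lfloor>of_nat l - s_val b + M_val b\<rfloor>
     else if i = 1 then \<lfloor>x1 + pos_part (x3 - x2 + pos_part (y2 - y3))\<rfloor>
     else \<lfloor>3 * x2 + 3/2 * pos_part (y3 - x3)\<rfloor>)"

definition Bcr :: "nat \<Rightarrow> coords crystal" where
  "Bcr l = \<lparr> carr = Bset l, et = B_et l, ft = B_ft l, eps = B_eps l, phi = B_phi l \<rparr>"

section \<open>Words in \<open>\<B>(1)\<close> and one-row tableaux\<close>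

definition el_empty :: coords where "el_empty = (0, 0, 0, 0, 0, 0)"
definition el_1 :: coords where "el_1 = (1, 0, 0, 0, 0, 0)"
definition el_2 :: coords where "el_2 = (0, 1, 0, 0, 0, 0)"
definition el_2_3 :: coords where "el_2_3 = (0, 1/3, 1/3, 1, 0, 0)"
definition el_0 :: coords where "el_0 = (0, 0, 1, 1, 0, 0)"
definition el_1bar :: coords where "el_1bar = (0, 0, 0, 0, 0, 1)"

text \<open>\<open>\<B>(1) = \<B>\<^sub>1 - {\<emptyset>}\<close>; as a \<open>G_2\<close>-crystal only its indices 1 and 2 are used.\<close>

definition Badj :: "coords crystal" where
  "Badj = (Bcr 1)\<lparr>carr := Bset 1 - {el_empty}\<rparr>"

text \<open>\<open>Bgen [c\<^sub>1, \<dots>, c\<^sub>n]\<close> is \<open>\<B>(c\<^sub>1 \<dots> c\<^sub>n)\<close>.\<close>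

definition Bgen_set :: "coords list \<Rightarrow> coords list set" where
  "Bgen_set cs = component {1, 2} (words Badj) cs"

definition Bgen :: "coords list \<Rightarrow> coords list crystal" where
  "Bgen cs = (words Badj)\<lparr>carr := Bgen_set cs\<rparr>"

text \<open>
  \<open>row [\<alpha>\<^sub>1, \<dots>, \<alpha>\<^sub>j]\<close> is the word \<open>\<alpha>\<^sub>j \<otimes> \<dots> \<otimes> \<alpha>\<^sub>1\<close>. \<open>Rows l\<close> is the crystal
  \<open>\<Oplus>\<^sub>j\<^sub>\<le>\<^sub>l \<B>(j\<Lambda>\<^sub>1)\<close> of one-row tableaux with at most \<open>l\<close> entries; the union is disjoint
  since the operators preserve the length of a word.
\<close>

definition row :: "coords list \<Rightarrow> coords list" where
  "row \<alpha>s = rev \<alpha>s"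

definition Rows :: "nat \<Rightarrow> coords list crystal" where
  "Rows l = (words Badj)\<lparr>carr := (\<Union>j\<in>{0..l}. Bgen_set (replicate j el_1))\<rparr>"

section \<open>Local application of maps\<close>

text \<open>
  \<open>apply_at D h k i w\<close> replaces the \<open>k\<close> factors of \<open>w\<close> in the positions
  \<open>i, \<dots>, i + k - 1\<close> (counted from 1) by their image under \<open>h : D \<rightarrow> words\<close>; it is
  undefined if these positions do not exist or their factors do not lie in the domain \<open>D\<close>.
\<close>

definition apply_at ::
  "'b list set \<Rightarrow> ('b list \<Rightarrow> 'b list) \<Rightarrow> nat \<Rightarrow> nat \<Rightarrow> 'b list \<Rightarrow> 'b list option" where
  "apply_at D h k i w =
    (let u = take k (drop (i - 1) w) in
     if 1 \<le> i \<and> i + k - 1 \<le> length w \<and> u \<in> D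
     then Some (take (i - 1) w @ h u @ drop (i + k - 1) w) else None)"

text \<open>\<open>apply_chain D h k m\<close> is the composition \<open>h\<^sub>1 h\<^sub>2 \<dots> h\<^sub>m\<close>, with \<open>h\<^sub>m\<close> applied first.\<close>

primrec apply_chain ::
  "'b list set \<Rightarrow> ('b list \<Rightarrow> 'b list) \<Rightarrow> nat \<Rightarrow> nat \<Rightarrow> 'b list \<Rightarrow> 'b list option" where
  "apply_chain D h k 0 w = Some w"
| "apply_chain D h k (Suc m) w =
     Option.bind (apply_at D h k (Suc m) w) (apply_chain D h k m)"

end

theory Submission
  imports Defs
begin

text \<open>
  Every map of the statement commutes with \<open>f\<^sub>1\<close> and \<open>f\<^sub>2\<close>: \<open>R\<close> and \<open>T\<close> by assumption,
  and the algorithm because \<open>\<xi>\<close>, \<open>\<eta>\<close>, \<open>\<theta>\<close> may be applied to consecutive factors of any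
  word. Also the case conditions are stable under \<open>f\<^sub>1\<close> and \<open>f\<^sub>2\<close>. As every element of
  \<open>\<B>\<^sub>l \<otimes> \<B>\<^sub>1\<close> is reached from a \<open>G\<^sub>2\<close>-highest weight element, it suffices to compare
  both sides on the elements \<open>[1\<^sup>j] \<otimes> \<beta>\<close>, where \<open>\<beta>\<close> is one of the empty tableau, 1, 2,
  \<open>2\<^sub>3\<close>, 0 and the barred letters 1 and 3. There the weight and \<open>\<epsilon>\<^sub>0\<close> determine the
  image under \<open>R\<close>, except that \<open>[1\<^sup>j] \<otimes> \<emptyset>\<close> and \<open>[1\<^sup>j] \<otimes> 0\<close> (for \<open>j < l\<close>), and
  \<open>[1\<^sup>l\<^sup>-\<^sup>1] \<otimes> 1\<close> and \<open>[1\<^sup>l] \<otimes> 0\<close>, are only separated by the action of \<open>e\<^sub>0\<close>.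
\<close>

section \<open>Words over a seminormal crystal\<close>

text \<open>\<open>T\<close>, \<open>\<xi>\<close>, \<open>\<eta>\<close>, \<open>\<theta>\<close>
  and \<open>R\<close> are given only as some isomorphisms, so even their values on highest weight
  elements have to be derived. Preserving eps_i and phi_i does not suffice unless the component in
  question is known to contain a single suitable highest weight element. The tool for this is the
  decomposition of B(1) \<otimes> B(1) into components of 77, 77, 27, 14 and 1 elements: an operator
  acting on a long word changes one letter, and by associativity of the tensor rule it acts on any
  block as an operator or not at all, so the component of each pair of adjacent letters is constant
  along a component of longer words. The same invariant makes the cases of the algorithm mutually
  exclusive. All crystals are pulled into one crystal of words, where tensor products are
  concatenations and the empty tableau is the empty word. Identities and case conditions then
  descend along paths on which the same f_i acts simultaneously on a source word and on its image
  under \<open>R\<close>.\<close>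

locale seminormal =
  fixes I :: "nat set" and C :: "'b crystal"
  assumes et_SomeD: "\<lbrakk>i \<in> I; c \<in> carr C; et C i c = Some c'\<rbrakk> \<Longrightarrow>
      c' \<in> carr C \<and> ft C i c' = Some c \<and> eps C i c' = eps C i c - 1 \<and> phi C i c'
        = phi C i c + 1"
    and ft_SomeD: "\<lbrakk>i \<in> I; c \<in> carr C; ft C i c = Some c'\<rbrakk>
      \<Longrightarrow> c' \<in> carr C \<and> et C i c' = Some c"
    and et_None_iff: "\<lbrakk>i \<in> I; c \<in> carr C\<rbrakk> \<Longrightarrow> et C i c = None
      \<longleftrightarrow> eps C i c = 0"
    and ft_None_iff: "\<lbrakk>i \<in> I; c \<in> carr C\<rbrakk> \<Longrightarrow> ft C i c = None
      \<longleftrightarrow> phi C i c = 0"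
    and eps_nonneg: "\<lbrakk>i \<in> I; c \<in> carr C\<rbrakk> \<Longrightarrow> eps C i c \<ge> 0"
    and phi_nonneg: "\<lbrakk>i \<in> I; c \<in> carr C\<rbrakk> \<Longrightarrow> phi C i c \<ge> 0"
begin

abbreviation "W \<equiv> lists (carr C)"

lemma word_eps_nonneg: "i \<in> I \<Longrightarrow> w \<in> W \<Longrightarrow> word_eps C i w \<ge> 0"
  by (cases w rule: list.exhaust) (auto dest: eps_nonneg[of i])

lemma word_phi_nonneg: "i \<in> I \<Longrightarrow> w \<in> W \<Longrightarrow> word_phi C i w \<ge> 0"
  by (induction w rule: list.induct) auto

lemma word_et_SomeD:
  assumes "i \<in> I" "w \<in> W" "word_et C i w = Some w'"
  shows "w' \<in> W \<and> word_ft C i w' = Some w \<and> word_eps C i w' = word_eps C i w - 1 \<and>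
         word_phi C i w' = word_phi C i w + 1 \<and> length w' = length w"
  using assms(2,3)
proof (induction w arbitrary: w' rule: list.induct)
  case (Cons c v)
  have c: "c \<in> carr C" and v: "v \<in> W" using Cons.prems(1) by auto
  show ?case
  proof (cases "phi C i c \<ge> word_eps C i v")
    case True
    with Cons.prems obtain c' where "et C i c = Some c'" "w' = c' # v" by auto
    with et_SomeD[OF assms(1) c] True v show ?thesis by auto
  next
    case False
    with Cons.prems obtain v' where "word_et C i v = Some v'" "w' = c # v'" by auto
    with Cons.IH[OF v] False c show ?thesis by auto
  qed
qed simp

lemma word_ft_SomeD:
  assumes "i \<in> I" "w \<in> W" "word_ft C i w = Some w'"
  shows "w' \<in> W \<and> word_et C i w' = Some w"
  using assms(2,3)
proof (induction w arbitrary: w' rule: list.induct)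
  case (Cons c v)
  have c: "c \<in> carr C" and v: "v \<in> W" using Cons.prems(1) by auto
  show ?case
  proof (cases "phi C i c > word_eps C i v")
    case True
    with Cons.prems obtain c' where c': "ft C i c = Some c'" "w' = c' # v" by auto
    moreover from ft_SomeD[OF assms(1) c c'(1)] et_SomeD[OF assms(1), of c' c]
    have "c' \<in> carr C" "et C i c' = Some c" "phi C i c' = phi C i c - 1" by auto
    ultimately show ?thesis using True v by auto
  next
    case False
    with Cons.prems obtain v' where v': "word_ft C i v = Some v'" "w' = c # v'" by auto
    moreover from Cons.IH[OF v v'(1)] word_et_SomeD[OF assms(1), of v' v]
    have "v' \<in> W" "word_et C i v' = Some v" "word_eps C i v' = word_eps C i v + 1" by auto
    ultimately show ?thesis using False c by auto
  qed
qed simp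

lemma word_et_None_iff:
  assumes "i \<in> I" "w \<in> W"
  shows "word_et C i w = None \<longleftrightarrow> word_eps C i w = 0"
  using assms(2)
proof (induction w rule: list.induct)
  case (Cons c v)
  then have c: "c \<in> carr C" and v: "v \<in> W" by auto
  show ?case
    using et_None_iff[OF assms(1) c] Cons.IH[OF v] eps_nonneg[OF assms(1) c]
      phi_nonneg[OF assms(1) c] by auto
qed simp

lemma word_ft_None_iff:
  assumes "i \<in> I" "w \<in> W"
  shows "word_ft C i w = None \<longleftrightarrow> word_phi C i w = 0"
  using assms(2)
proof (induction w rule: list.induct)
  case (Cons c v)
  then have c: "c \<in> carr C" and v: "v \<in> W" by auto
  show ?case
    using ft_None_iff[OF assms(1) c] Cons.IH[OF v] word_eps_nonneg[OF assms(1) v]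
      word_phi_nonneg[OF assms(1) v] phi_nonneg[OF assms(1) c] by auto
qed simp

lemma word_et_inj:
  assumes "i \<in> I" "v \<in> W" "w \<in> W" "word_et C i v = Some u" "word_et C i w = Some u"
  shows "v = w"
  using word_et_SomeD[OF assms(1,2,4)] word_et_SomeD[OF assms(1,3,5)] by auto

text \<open>Associativity of the tensor product. Words are bracketed to the right, whereas maps such
  as \<open>\<eta>\<close> act on blocks in the middle, so a word must be splittable
  anywhere.\<close>

lemma word_eps_append:
  assumes "i \<in> I" "v \<in> W"
  shows "word_eps C i (u @ v) =
    max (word_eps C i u) (word_eps C i v - word_phi C i u + word_eps C i u)"
proof (induction u rule: list.induct)
  case Nil
  show ?case using word_eps_nonneg[OF assms] by simp
next
  case (Cons c u)
  then show ?case by auto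
qed

lemma word_phi_append:
  assumes "i \<in> I" "v \<in> W"
  shows "word_phi C i (u @ v) =
    max (word_phi C i v) (word_phi C i u + word_phi C i v - word_eps C i v)"
proof (induction u rule: list.induct)
  case Nil
  show ?case using word_eps_nonneg[OF assms] by simp
next
  case (Cons c u)
  then show ?case by (auto simp: word_eps_append[OF assms])
qed

lemma word_et_append:
  assumes "i \<in> I" "v \<in> W"
  shows "word_et C i (u @ v) =
    (if word_phi C i u \<ge> word_eps C i v then map_option (\<lambda>u'. u' @ v) (word_et C i u)
     else map_option (\<lambda>v'. u @ v') (word_et C i v))"
proof (induction u rule: list.induct)
  case Nil
  \<comment> \<open>At the tie eps_i(v) = 0 the rule for e_i selects the left factor, here the empty
    word, and gives \<open>None\<close>. Seminormality makes e_i v undefined in exactly this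
    case.\<close>
  show ?case using word_eps_nonneg[OF assms] word_et_None_iff[OF assms] by (cases "word_et C i v") auto
next
  case (Cons c u)
  then show ?case
    by (simp add: word_eps_append[OF assms] option.map_comp comp_def)
qed

lemma word_ft_append:
  assumes "i \<in> I" "u \<in> W" "v \<in> W"
  shows "word_ft C i (u @ v) =
    (if word_phi C i u > word_eps C i v then map_option (\<lambda>u'. u' @ v) (word_ft C i u)
     else map_option (\<lambda>v'. u @ v') (word_ft C i v))"
  using assms(2)
proof (induction u rule: list.induct)
  case Nil
  show ?case using word_eps_nonneg[OF assms(1,3)] by (cases "word_ft C i v") auto
next
  case (Cons c u)
  then show ?case
    by (simp add: word_eps_append[OF assms(1,3)] option.map_comp comp_def)
qed

lemma word_ft_length:
  assumes "i \<in> I" "w \<in> W" "word_ft C i w = Some w'"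
  shows "length w' = length w"
  using word_ft_SomeD[OF assms] word_et_SomeD[OF assms(1), of w' w] by auto

section \<open>Components and partial morphisms\<close>

definition f_step :: "'b list rel" where
  "f_step = {(v, w). \<exists>i\<in>I. v \<in> W \<and> word_ft C i v = Some w}"

text \<open>Both words are lowered by the same index. A path starting at a pair (v0, F v0) consists
  of pairs (v, F v) for every partial morphism F, so one known value spreads to everything below
  it.\<close>

definition joint_f_step :: "('b list \<times> 'b list) rel" where
  "joint_f_step = {((v, w), (v', w')).
     \<exists>i\<in>I. v \<in> W \<and> w \<in> W \<and> word_ft C i v = Some v' \<and> word_ft C i
       w = Some w'}"

lemma joint_f_step_fst: "((v, w), (v', w')) \<in> joint_f_step\<^sup>* \<Longrightarrow> (v, v')
  \<in> f_step\<^sup>*"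
  by (induction rule: rtrancl_induct2)
    (auto simp: f_step_def joint_f_step_def intro: rtrancl_into_rtrancl)

lemma joint_f_step_snd: "((v, w), (v', w')) \<in> joint_f_step\<^sup>* \<Longrightarrow> (w, w')
  \<in> f_step\<^sup>*"
  by (induction rule: rtrancl_induct2)
    (auto simp: f_step_def joint_f_step_def intro: rtrancl_into_rtrancl)

lemma joint_f_step_swap: "((v, w), (v', w')) \<in> joint_f_step\<^sup>* \<Longrightarrow> ((w, v),
  (w', v')) \<in> joint_f_step\<^sup>*"
  by (induction rule: rtrancl_induct2) (auto simp: joint_f_step_def intro: rtrancl_into_rtrancl)

lemma f_step_length: "(v, w) \<in> f_step\<^sup>* \<Longrightarrow> length w = length v"
  by (induction rule: rtrancl_induct) (auto simp: f_step_def dest: word_ft_length)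

lemma component_refl: "w \<in> component I (words C) w"
  by (simp add: component_def)

lemma component_step:
  assumes "v \<in> component I (words C) w" "i \<in> I" "word_et C i v = Some u \<or> word_ft C i v
    = Some u"
  shows "u \<in> component I (words C) w"
  using assms unfolding component_def words_def
  by (auto intro: rtrancl_into_rtrancl)

text \<open>The case \<open>ft\<close> is phrased as a raising step back from the new word, as f_i
  inverts e_i. An invariant therefore needs checking along e_i only.\<close>

lemma component_induct [consumes 2, case_names base et ft]:
  assumes "v \<in> component I (words C) w" "w \<in> W"
    and "P w"
    and "\<And>i v u. \<lbrakk>i \<in> I; v \<in> W; u \<in> W; word_et C i v = Some u; P
      v\<rbrakk> \<Longrightarrow> P u"
    and "\<And>i v u. \<lbrakk>i \<in> I; v \<in> W; u \<in> W; word_et C i u = Some v; P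
      v\<rbrakk> \<Longrightarrow> P u"
  shows "P v"
proof -
  have "(w, v) \<in> {(x, y). \<exists>i\<in>I. word_et C i x = Some y \<or> word_ft C i x = Some
    y}\<^sup>*"
    using assms(1) by (simp add: component_def words_def)
  then have "P v \<and> v \<in> W"
  proof (induction rule: rtrancl_induct)
    case base
    show ?case using assms(2,3) by simp
  next
    case (step y z)
    then obtain i where "i \<in> I" "word_et C i y = Some z \<or> word_ft C i y = Some z" by auto
    then show ?case using step.IH assms(4,5)[of i y z] word_et_SomeD[of i y z] word_ft_SomeD[of i y z]
      by auto
  qed
  then show ?thesis ..
qed

lemma component_W: "v \<in> component I (words C) w \<Longrightarrow> w \<in> W \<Longrightarrow> v
  \<in> W"
  by (drule component_induct[where P = "\<lambda>v. v \<in> W"]) auto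

lemma component_length: "v \<in> component I (words C) w \<Longrightarrow> w \<in> W
  \<Longrightarrow> length v = length w"
  by (drule component_induct[where P = "\<lambda>v. length v = length w"]) (auto dest: word_et_SomeD)

text \<open>Only one of the three blocks is changed, and by associativity it is changed by e_i of
  that block alone.\<close>

lemma word_et_subword:
  assumes "i \<in> I" "x @ u @ y \<in> W" "word_et C i (x @ u @ y) = Some w'"
  shows "\<exists>x' u' y'. w' = x' @ u' @ y' \<and> length x' = length x \<and> length u' = length
    u \<and>
    length y' = length y \<and> (u' = u \<or> word_et C i u = Some u')"
proof -
  have [simp]: "x \<in> W" "u \<in> W" "y \<in> W" using assms(2) by auto
  consider "(\<exists>x'. word_et C i x = Some x' \<and> w' = x' @ u @ y)" |
    "(\<exists>u'. word_et C i u = Some u' \<and> w' = x @ u' @ y)" |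
    "(\<exists>y'. word_et C i y = Some y' \<and> w' = x @ u @ y')"
    using assms(3) by (auto simp: word_et_append[OF assms(1)] split: if_splits)
  then show ?thesis
  proof cases
    case 1
    then obtain x' where "word_et C i x = Some x'" "w' = x' @ u @ y" by blast
    then show ?thesis using word_et_SomeD[OF assms(1), of x x'] by (intro exI[of _ x'] exI[of _ u]
      exI[of _ y]) auto
  next
    case 2
    then obtain u' where "word_et C i u = Some u'" "w' = x @ u' @ y" by blast
    then show ?thesis using word_et_SomeD[OF assms(1), of u u'] by (intro exI[of _ x] exI[of _ u']
      exI[of _ y]) auto
  next
    case 3
    then obtain y' where "word_et C i y = Some y'" "w' = x @ u @ y'" by blast
    then show ?thesis using word_et_SomeD[OF assms(1), of y y'] by (intro exI[of _ x] exI[of _ u]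
      exI[of _ y']) auto
  qed
qed

text \<open>The window of k letters behind position m is either left alone or moved by e_i of the
  k-fold tensor power, so any function constant along the latter stays constant. Applied with k = 2
  to \<open>pair_class\<close>.\<close>

lemma subword_invariant:
  assumes "v \<in> component I (words C) w" "w \<in> W" "m + k \<le> length w"
    and inv: "\<And>i a b. \<lbrakk>i \<in> I; a \<in> W; b \<in> W; length a = k; length b = k;
      word_et C i a = Some b\<rbrakk> \<Longrightarrow> f a = f b"
  shows "f (take k (drop m v)) = f (take k (drop m w))"
proof -
  have step: "f (take k (drop m u)) = f (take k (drop m v))"
    if "i \<in> I" "v \<in> W" "word_et C i v = Some u" "length v = length w" for i u v
  proof -
    note st = that
    have v: "take m v @ take k (drop m v) @ drop (m + k) v = v"
      by (metis append_take_drop_id drop_drop add.commute)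
    obtain x' u' y' where *: "u = x' @ u' @ y'" "length x' = length (take m v)"
      "length u' = length (take k (drop m v))"
      "u' = take k (drop m v) \<or> word_et C i (take k (drop m v)) = Some u'"
      using word_et_subword[OF st(1), of "take m v" "take k (drop m v)" "drop (m + k) v" u, unfolded v,
          OF st(2,3)] by blast
    have "take k (drop m u) = u'" using * assms(3) that by auto
    moreover have "take k (drop m v) \<in> W" using that(2) by (auto dest: in_set_takeD in_set_dropD)
    ultimately show ?thesis
      using * inv[of i "take k (drop m v)" u'] word_et_SomeD[of i "take k (drop m v)" u'] that assms(3)
      by (auto simp: min_def)
  qed
  have "f (take k (drop m v)) = f (take k (drop m w)) \<and> length v = length w"
    using assms(1,2)
  proof (induction rule: component_induct)
    case base
    show ?case by simp
  next
    case (et i v u)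
    with step[of i v u] word_et_SomeD[of i v u] show ?case by auto
  next
    case (ft i v u)
    with step[of i u v] word_et_SomeD[of i u v] show ?case by auto
  qed
  then show ?thesis by simp
qed

text \<open>
  The domain of such an \<open>F\<close> is closed under the \<open>f\<^sub>i\<close>, but it need not be closed under
  the \<open>e\<^sub>i\<close>.
\<close>

definition pmorph :: "('b list \<Rightarrow> 'b list option) \<Rightarrow> bool" where
  "pmorph F \<longleftrightarrow> (\<forall>i\<in>I. \<forall>w\<in>W. \<forall>v. F w = Some v
    \<longrightarrow>
     v \<in> W \<and> word_eps C i v = word_eps C i w \<and> word_phi C i v = word_phi C i w \<and>
     (\<forall>w'. word_ft C i w = Some w' \<longrightarrow> (\<exists>v'. F w' = Some v' \<and>
       word_ft C i v = Some v')))"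

lemma pmorph_Some: "pmorph Some"
  by (auto simp: pmorph_def)

lemma pmorph_bind:
  assumes "pmorph F" "pmorph G"
  shows "pmorph (\<lambda>w. Option.bind (F w) G)"
  unfolding pmorph_def
proof (intro ballI allI impI)
  fix i w v assume i: "i \<in> I" and w: "w \<in> W" and "Option.bind (F w) G = Some v"
  then obtain u where u: "F w = Some u" "G u = Some v" by (auto simp: bind_eq_Some_conv)
  note 1 = assms(1)[unfolded pmorph_def, rule_format, OF i w u(1)]
  then have uW: "u \<in> W" by simp
  note 2 = assms(2)[unfolded pmorph_def, rule_format, OF i uW u(2)]
  show "v \<in> W \<and> word_eps C i v = word_eps C i w \<and> word_phi C i v = word_phi C i w \<and>
    (\<forall>w'. word_ft C i w = Some w' \<longrightarrow>
      (\<exists>v'. Option.bind (F w') G = Some v' \<and> word_ft C i v = Some v'))"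
    using 1 2 by fastforce
qed

text \<open>As \<open>h\<close> preserves eps_i and phi_i, the tensor rule selects the same block in
  \<open>x @ u @ y\<close> and in \<open>x @ h u @ y\<close>. If it selects the middle one,
  \<open>h\<close> commutes with f_i by assumption.\<close>

lemma pmorph_apply_at:
  assumes D: "D \<subseteq> W" "\<And>i u u'. i \<in> I \<Longrightarrow> u \<in> D
    \<Longrightarrow> word_ft C i u = Some u' \<Longrightarrow> u' \<in> D"
    and h: "\<And>u. u \<in> D \<Longrightarrow> h u \<in> W"
      "\<And>i u. i \<in> I \<Longrightarrow> u \<in> D \<Longrightarrow> word_eps C i (h u) =
        word_eps C i u"
      "\<And>i u. i \<in> I \<Longrightarrow> u \<in> D \<Longrightarrow> word_phi C i (h u) =
        word_phi C i u"
      "\<And>i u. i \<in> I \<Longrightarrow> u \<in> D \<Longrightarrow> word_ft C i (h u) =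
        map_option h (word_ft C i u)"
  shows "pmorph (apply_at D h k m)"
  unfolding pmorph_def
proof (intro ballI allI impI)
  fix i w v assume i: "i \<in> I" and w: "w \<in> W" and "apply_at D h k m w = Some v"
  then have m: "1 \<le> m" "m + k - 1 \<le> length w" "take k (drop (m - 1) w) \<in> D"
    and v: "v = take (m - 1) w @ h (take k (drop (m - 1) w)) @ drop (m + k - 1) w"
    by (auto simp: apply_at_def Let_def split: if_splits)
  define x u y where "x = take (m - 1) w" and "u = take k (drop (m - 1) w)"
    and "y = drop (m + k - 1) w"
  have "drop (m + k - 1) w = drop k (drop (m - 1) w)"
    using m(1) by (simp add: add.commute)
  then have "w = x @ u @ y"
    by (simp only: x_def u_def y_def append_take_drop_id)
  then have xuy: "w = x @ u @ y" "length x = m - 1" "length u = k" "u \<in> D" "1 \<le> m"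
    "v = x @ h u @ y"
    using m v by (simp_all add: x_def u_def y_def)
  have app: "apply_at D h k m (x' @ u' @ y') = Some (x' @ h u' @ y')"
    if "length x' = m - 1" "length u' = k" "u' \<in> D" for x' u' y'
    using that xuy(5) by (auto simp: apply_at_def Let_def)
  have [simp]: "x \<in> W" "u \<in> W" "y \<in> W" "h u \<in> W" using w xuy h by auto
  have [simp]: "word_eps C i (h u) = word_eps C i u" "word_phi C i (h u) = word_phi C i u"
    "word_ft C i (h u) = map_option h (word_ft C i u)"
    using h i xuy by auto
  note [simp] = word_ft_append[OF i] word_eps_append[OF i] word_phi_append[OF i]
  have ft: "\<exists>v'. apply_at D h k m w' = Some v' \<and> word_ft C i v = Some v'"
    if w': "word_ft C i w = Some w'" for w'
  proof -
    consider (x) x' where "word_ft C i x = Some x'" "w' = x' @ u @ y" "word_phi C i x > word_eps C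
      i (u @ y)"
      | (u) u' where "word_ft C i u = Some u'" "w' = x @ u' @ y" "\<not> word_phi C i x > word_eps
        C i (u @ y)"
          "word_phi C i u > word_eps C i y"
      | (y) y' where "word_ft C i y = Some y'" "w' = x @ u @ y'" "\<not> word_phi C i x > word_eps
        C i (u @ y)"
          "\<not> word_phi C i u > word_eps C i y"
      using w' by (auto simp: xuy(1) simp del: word_eps_append[OF i] split: if_splits)
    then show ?thesis
    proof cases
      case x
      then show ?thesis using app[of x' u y] word_ft_length[OF i _ x(1)] by (auto simp: xuy)
    next
      case u
      then show ?thesis using app[of x u' y] word_ft_length[OF i _ u(1)] D(2)[OF i xuy(4) u(1)]
        by (auto simp: xuy)
    next
      case y
      then show ?thesis using app[of x u y'] by (auto simp: xuy)
    qed
  qed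
  then show "v \<in> W \<and> word_eps C i v = word_eps C i w \<and> word_phi C i v = word_phi C i
    w \<and>
    (\<forall>w'. word_ft C i w = Some w' \<longrightarrow> (\<exists>v'. apply_at D h k m w' =
      Some v' \<and> word_ft C i v = Some v'))"
    by (simp add: xuy)
qed

lemma pmorph_chain:
  assumes "\<And>m. pmorph (apply_at D h k m)"
  shows "pmorph (apply_chain D h k m)"
proof (induction m)
  case 0
  have "apply_chain D h k 0 = Some" by (rule ext) simp
  then show ?case using pmorph_Some by metis
next
  case (Suc m)
  have "apply_chain D h k (Suc m) = (\<lambda>w. Option.bind (apply_at D h k (Suc m) w)
    (apply_chain D h k m))"
    by (rule ext) simp
  then show ?case using pmorph_bind[OF assms Suc, of "Suc m"] by metis
qed

text \<open>A word with vanishing eps_i and phi_i spans a trivial crystal, a unit for the tensor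
  product. The instance that matters is 1 \<otimes> 1bar, which the algorithm creates in one case
  and removes in another.\<close>

lemma pmorph_singlet_left:
  assumes s: "s \<in> W" "\<And>i. i \<in> I \<Longrightarrow> word_eps C i s = 0 \<and> word_phi C
    i s = 0"
  shows "pmorph (\<lambda>w. Some (s @ w))"
  unfolding pmorph_def
proof (intro ballI allI impI)
  fix i w v assume i: "i \<in> I" and w: "w \<in> W" and "Some (s @ w) = Some v"
  then have v: "v = s @ w" by simp
  note s0 = s(2)[OF i] and nonneg = word_eps_nonneg[OF i w] word_phi_nonneg[OF i w]
  have "word_ft C i v = Some (s @ w')" if w': "word_ft C i w = Some w'" for w'
  proof -
    have "word_phi C i w \<noteq> 0" using w' word_ft_None_iff[OF i w] by simp
    then show ?thesis using nonneg s0 w' unfolding v word_ft_append[OF i s(1) w] by simp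
  qed
  moreover have "v \<in> W" using v s(1) w by simp
  moreover have "word_eps C i v = word_eps C i w"
    using nonneg s0 unfolding v word_eps_append[OF i w] by simp
  moreover have "word_phi C i v = word_phi C i w"
    using nonneg s0 unfolding v word_phi_append[OF i w] by simp
  ultimately show "v \<in> W \<and> word_eps C i v = word_eps C i w \<and> word_phi C i v =
    word_phi C i w \<and>
    (\<forall>w'. word_ft C i w = Some w' \<longrightarrow> (\<exists>v'. Some (s @ w') = Some v'
      \<and> word_ft C i v = Some v'))"
    by blast
qed

lemma pmorph_singlet_right:
  assumes s: "s \<in> W" "\<And>i. i \<in> I \<Longrightarrow> word_eps C i s = 0 \<and> word_phi C
    i s = 0"
  shows "pmorph (\<lambda>w. Some (w @ s))"
  unfolding pmorph_def
proof (intro ballI allI impI)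
  fix i w v assume i: "i \<in> I" and w: "w \<in> W" and "Some (w @ s) = Some v"
  then have v: "v = w @ s" by simp
  note s0 = s(2)[OF i] and nonneg = word_eps_nonneg[OF i w] word_phi_nonneg[OF i w]
  have "word_ft C i v = Some (w' @ s)" if w': "word_ft C i w = Some w'" for w'
  proof -
    \<comment> \<open>The rule for f_i has a strict inequality: the left factor w is lowered only if
      phi_i(w) > 0, which holds because f_i w exists.\<close>
    have "word_phi C i w \<noteq> 0" using w' word_ft_None_iff[OF i w] by simp
    then show ?thesis using nonneg s0 w' unfolding v word_ft_append[OF i w s(1)] by simp
  qed
  moreover have "v \<in> W" using v s(1) w by simp
  moreover have "word_eps C i v = word_eps C i w"
    using nonneg s0 unfolding v word_eps_append[OF i s(1)] by simp
  moreover have "word_phi C i v = word_phi C i w"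
    using nonneg s0 unfolding v word_phi_append[OF i s(1)] by simp
  ultimately show "v \<in> W \<and> word_eps C i v = word_eps C i w \<and> word_phi C i v =
    word_phi C i w \<and>
    (\<forall>w'. word_ft C i w = Some w' \<longrightarrow> (\<exists>v'. Some (w' @ s) = Some v'
      \<and> word_ft C i v = Some v'))"
    by blast
qed

text \<open>The transfer principle: F is evaluated once at the top of the path, and commuting with
  each f_i carries the value down.\<close>

lemma pmorph_joint_f_step:
  assumes "((v0, w0), (v, w)) \<in> joint_f_step\<^sup>*" "pmorph F" "F v0 = Some w0"
  shows "F v = Some w"
  using assms(1)
proof (induction rule: rtrancl_induct2)
  case refl
  show ?case by (rule assms(3))
next
  case (step v w v' w')
  then obtain i where i: "i \<in> I" "v \<in> W" "word_ft C i v = Some v'" "word_ft C i w = Some w'"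
    by (auto simp: joint_f_step_def)
  from assms(2)[unfolded pmorph_def, rule_format, OF i(1,2) step.IH] i(3)
  obtain x where "F v' = Some x" "word_ft C i w = Some x" by blast
  with i(4) show ?case by simp
qed

text \<open>Definedness descends by itself. For a restriction of the identity it expresses that a
  block lies in a given component, so this moves case conditions from the top of a path to its
  end.\<close>

lemma pmorph_f_step:
  assumes "(v0, v) \<in> f_step\<^sup>*" "pmorph F" "F v0 \<noteq> None"
  shows "F v \<noteq> None"
  using assms(1)
proof (induction rule: rtrancl_induct)
  case base
  show ?case by (rule assms(3))
next
  case (step v v')
  then obtain i w where i: "i \<in> I" "v \<in> W" "word_ft C i v = Some v'" "F v = Some w"
    by (auto simp: f_step_def)
  from assms(2)[unfolded pmorph_def, rule_format, OF i(1,2,4)] i(3)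
  obtain x where "F v' = Some x" by blast
  then show ?case by simp
qed

end

section \<open>The letters\<close>

lemma frac_Ints_iff: "(of_nat m / 3 - of_nat n / 3 :: rat) \<in> \<int> \<longleftrightarrow> m mod
  3 = n mod 3"
proof
  assume "(of_nat m / 3 - of_nat n / 3 :: rat) \<in> \<int>"
  then obtain k where "(of_nat m / 3 - of_nat n / 3 :: rat) = of_int k" by (auto elim: Ints_cases)
  then have "(of_int (int m) :: rat) = of_int (int n + 3 * k)" by (simp add: field_simps)
  then have "int m = int n + 3 * k" by (simp only: of_int_eq_iff)
  then show "m mod 3 = n mod 3" by presburger
next
  assume "m mod 3 = n mod 3"
  then have "\<exists>k. int m = int n + 3 * k" by presburger
  then obtain k where "int m = int n + 3 * k" by auto
  then have "(of_int (int m) :: rat) = of_int (int n + 3 * k)" by (simp only: of_int_eq_iff)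
  then have "(of_nat m / 3 - of_nat n / 3 :: rat) = of_int k" by (simp add: field_simps)
  then show "(of_nat m / 3 - of_nat n / 3 :: rat) \<in> \<int>" by simp
qed

fun of_thirds :: "nat \<times> nat \<times> nat \<times> nat \<times> nat \<times> nat
  \<Rightarrow> coords" where
  "of_thirds (n1, n2, n3, n4, n5, n6) =
    (of_nat n1 / 3, of_nat n2 / 3, of_nat n3 / 3, of_nat n4 / 3, of_nat n5 / 3, of_nat n6 / 3)"

text \<open>Membership in B_l for tripled coordinates. Integrality of differences becomes congruence
  mod 3, and the last line is 6 s(b) \<le> 6 l, which clears the thirds together with the half in
  s.\<close>

fun Bset_nat :: "nat \<Rightarrow> nat \<times> nat \<times> nat \<times> nat \<times> nat \<times>
  nat \<Rightarrow> bool" where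
  "Bset_nat l (n1, n2, n3, n4, n5, n6) \<longleftrightarrow>
    n1 mod 3 = 0 \<and> n6 mod 3 = 0 \<and> n2 mod 3 = n3 mod 3 \<and> n4 mod 3 = n5 mod 3 \<and>
      even (n3 + n4) \<and>
    2 * n1 + 2 * n2 + n3 + n4 + 2 * n5 + 2 * n6 \<le> 6 * l"

lemma of_thirds_in_Bset: "of_thirds n \<in> Bset l \<longleftrightarrow> Bset_nat l n"
proof -
  obtain n1 n2 n3 n4 n5 n6 where n: "n = (n1, n2, n3, n4, n5, n6)" by (cases n) auto
  have th: "of_nat m / 3 \<in> thirds" for m by (auto simp: thirds_def)
  have int: "(of_nat m / 3 :: rat) \<in> \<int> \<longleftrightarrow> m mod 3 = 0" for m
    using frac_Ints_iff[of m 0] by simp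
  have even: "(\<exists>k::int. 3 * (of_nat n3 / 3) - 3 * (of_nat n4 / 3 :: rat) = 2 * of_int k)
    \<longleftrightarrow> even (n3 + n4)"
  proof
    assume "\<exists>k::int. 3 * (of_nat n3 / 3) - 3 * (of_nat n4 / 3 :: rat) = 2 * of_int k"
    then obtain k :: int where "3 * (of_nat n3 / 3) - 3 * (of_nat n4 / 3 :: rat) = 2 * of_int k" ..
    then have "(of_int (int n3) :: rat) = of_int (int n4 + 2 * k)" by (simp add: field_simps)
    then have "int n3 = int n4 + 2 * k" by (simp only: of_int_eq_iff)
    then show "even (n3 + n4)" by presburger
  next
    assume "even (n3 + n4)"
    then have "\<exists>k. int n3 = int n4 + 2 * k" by presburger
    then obtain k where "int n3 = int n4 + 2 * k" by auto
    then have "(of_int (int n3) :: rat) = of_int (int n4 + 2 * k)" by (simp only: of_int_eq_iff)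
    then have "3 * (of_nat n3 / 3) - 3 * (of_nat n4 / 3 :: rat) = 2 * of_int k" by (simp add:
      field_simps)
    then show "\<exists>k::int. 3 * (of_nat n3 / 3) - 3 * (of_nat n4 / 3 :: rat) = 2 * of_int k" ..
  qed
  have s: "s_val (of_thirds n) \<le> of_nat l \<longleftrightarrow> 2 * n1 + 2 * n2 + n3 + n4 + 2 *
    n5 + 2 * n6 \<le> 6 * l"
  proof -
    have "s_val (of_thirds n) = of_nat (2 * n1 + 2 * n2 + n3 + n4 + 2 * n5 + 2 * n6) / 6"
      by (simp add: n field_simps)
    moreover have "x \<le> of_nat l \<longleftrightarrow> N \<le> of_nat (6 * l)" if "x = N / 6"
      for x N :: rat
      using that by auto
    ultimately have "s_val (of_thirds n) \<le> of_nat l \<longleftrightarrow>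
      (of_nat (2 * n1 + 2 * n2 + n3 + n4 + 2 * n5 + 2 * n6) :: rat) \<le> of_nat (6 * l)"
      by blast
    then show ?thesis by (simp only: of_nat_le_iff)
  qed
  have "of_thirds n \<in> Bset l \<longleftrightarrow>
     (\<exists>k::int. 3 * (of_nat n3 / 3) - 3 * (of_nat n4 / 3 :: rat) = 2 * of_int k) \<and>
     (of_nat n1 / 3 :: rat) \<in> \<int> \<and> (of_nat n6 / 3 :: rat) \<in> \<int> \<and>
     (of_nat n2 / 3 - of_nat n3 / 3 :: rat) \<in> \<int> \<and> (of_nat n4 / 3 - of_nat n5 / 3 ::
       rat) \<in> \<int> \<and>
     s_val (of_thirds n) \<le> of_nat l"
    unfolding Bset_def n of_thirds.simps using th by blast
  then show ?thesis unfolding even int frac_Ints_iff s by (auto simp: n)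
qed

lemma Bset_of_thirds:
  assumes "b \<in> Bset l"
  obtains n where "b = of_thirds n" "Bset_nat l n"
proof -
  obtain x1 x2 x3 y3 y2 y1 where b: "b = (x1, x2, x3, y3, y2, y1)"
    "{x1, x2, x3, y3, y2, y1} \<subseteq> thirds"
    using assms by (auto simp: Bset_def)
  have "\<exists>n. x = of_nat n / 3" if "x \<in> thirds" for x using that by (auto simp: thirds_def)
  then obtain n1 n2 n3 n4 n5 n6 where "x1 = of_nat n1 / 3" "x2 = of_nat n2 / 3" "x3 = of_nat n3 / 3"
    "y3 = of_nat n4 / 3" "y2 = of_nat n5 / 3" "y1 = of_nat n6 / 3"
    using b(2) by (metis insert_subset)
  then have "b = of_thirds (n1, n2, n3, n4, n5, n6)" using b by simp
  with assms show ?thesis using that of_thirds_in_Bset by metis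
qed

text \<open>The order of the letters matters: raising always moves to a smaller position, which
  permits the induction in \<open>T_letter\<close>.\<close>

definition adj :: "coords list" where
  "adj = [(1,0,0,0,0,0), (0,1,0,0,0,0), (0,2/3,2/3,0,0,0), (0,1/3,4/3,0,0,0), (0,1/3,1/3,1,0,0),
     (0,0,2,0,0,0), (0,0,1,1,0,0), (0,1/3,1/3,1/3,1/3,0), (0,0,0,2,0,0), (0,0,1,1/3,1/3,0),
     (0,0,0,4/3,1/3,0), (0,0,0,2/3,2/3,0), (0,0,0,0,1,0), (0,0,0,0,0,1)]"

lemma Bset_nat_1:
  assumes "Bset_nat 1 n"
  shows "n \<in> set [(0,0,0,0,0,0), (3,0,0,0,0,0), (0,3,0,0,0,0), (0,2,2,0,0,0), (0,1,4,0,0,0),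
    (0,1,1,3,0,0), (0,0,6,0,0,0), (0,0,3,3,0,0), (0,1,1,1,1,0), (0,0,0,6,0,0), (0,0,3,1,1,0),
    (0,0,0,4,1,0), (0,0,0,2,2,0), (0,0,0,0,3,0), (0,0,0,0,0,3)]" (is "n \<in> set ?L")
proof -
  obtain n1 n2 n3 n4 n5 n6 where n: "n = (n1, n2, n3, n4, n5, n6)" by (cases n) auto
  \<comment> \<open>The ranges come from 2 n \<le> 6 for four of the coordinates and from n3 + n4
    \<le> 6 for the other two. The conditions are interleaved with the quantifiers so that most
    tuples are discarded early.\<close>
  have chk: "\<forall>n1\<in>set [0..<4]. n1 mod 3 = 0 \<longrightarrow> (\<forall>n6\<in>set
    [0..<4]. n6 mod 3 = 0 \<longrightarrow>
    (\<forall>n3\<in>set [0..<7]. \<forall>n4\<in>set [0..<7]. even (n3 + n4) \<and> 2 * n1 + n3 +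
      n4 + 2 * n6 \<le> 6 \<longrightarrow>
    (\<forall>n2\<in>set [0..<4]. n2 mod 3 = n3 mod 3 \<longrightarrow>
    (\<forall>n5\<in>set [0..<4]. n4 mod 3 = n5 mod 3 \<longrightarrow> 2 * n1 + 2 * n2 + n3 + n4 +
      2 * n5 + 2 * n6 \<le> 6 \<longrightarrow>
       (n1, n2, n3, n4, n5, n6) \<in> set ?L))))"
    by code_simp
  have "n1 \<in> set [0..<4]" "n2 \<in> set [0..<4]" "n3 \<in> set [0..<7]" "n4 \<in> set [0..<7]"
    "n5 \<in> set [0..<4]" "n6 \<in> set [0..<4]"
    using assms by (auto simp: n)
  moreover have "n1 mod 3 = 0" "n6 mod 3 = 0" "n2 mod 3 = n3 mod 3" "n4 mod 3 = n5 mod 3"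
     "even (n3 + n4) \<and> 2 * n1 + n3 + n4 + 2 * n6 \<le> 6"
     "2 * n1 + 2 * n2 + n3 + n4 + 2 * n5 + 2 * n6 \<le> 6"
    using assms by (auto simp: n)
  ultimately have "(n1, n2, n3, n4, n5, n6) \<in> set ?L" using chk by metis
  then show ?thesis unfolding n .
qed

lemma Bset_1: "Bset 1 = insert el_empty (set adj)"
proof
  show "Bset 1 \<subseteq> insert el_empty (set adj)"
  proof
    fix b assume "b \<in> Bset 1"
    then obtain n where "b = of_thirds n" "Bset_nat 1 n" by (rule Bset_of_thirds)
    with Bset_nat_1[of n] show "b \<in> insert el_empty (set adj)"
      by (auto simp: adj_def el_empty_def)
  qed
  have "b \<in> Bset 1" if "b = of_thirds n" "Bset_nat 1 n" for b n
    using that of_thirds_in_Bset by simp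
  note I = this
  show "insert el_empty (set adj) \<subseteq> Bset 1"
    unfolding adj_def el_empty_def
    by (simp del: One_nat_def, intro conjI)
      (rule I[of _ "(0,0,0,0,0,0)"] I[of _ "(3,0,0,0,0,0)"] I[of _ "(0,3,0,0,0,0)"] I[of _
        "(0,2,2,0,0,0)"]
        I[of _ "(0,1,4,0,0,0)"] I[of _ "(0,1,1,3,0,0)"] I[of _ "(0,0,6,0,0,0)"] I[of _ "(0,0,3,3,0,0)"]
        I[of _ "(0,1,1,1,1,0)"] I[of _ "(0,0,0,6,0,0)"] I[of _ "(0,0,3,1,1,0)"] I[of _ "(0,0,0,4,1,0)"]
        I[of _ "(0,0,0,2,2,0)"] I[of _ "(0,0,0,0,3,0)"] I[of _ "(0,0,0,0,0,3)"]; simp; fail)+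
qed

section \<open>The crystal graph of B(1) and the components of its tensor square\<close>

lemma All_less_14: "(\<forall>n<14. P n) \<longleftrightarrow> P 0 \<and> P 1 \<and> P 2 \<and> P 3
  \<and> P 4 \<and> P 5 \<and> P 6 \<and> P 7 \<and> P 8 \<and> P 9 \<and>
    P 10 \<and> P 11 \<and> P 12 \<and> P (13::nat)"
  by (auto simp: All_less_Suc numeral_eq_Suc)

text \<open>
  The crystal graph of \<open>\<B>(1)\<close>, with letters replaced by their positions in \<^const>\<open>adj\<close>.
\<close>

definition e_table :: "nat \<Rightarrow> nat \<Rightarrow> nat option" where
  "e_table i n = (if i = 1 then [None, Some 0, None, None, Some 3, None, Some 5, None, Some 6,
    None, Some 9,
       None, None, Some 12] ! n
     else [None, None, Some 1, Some 2, None, Some 3, None, Some 4, None, Some 7, Some 8, Some 10,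
       Some 11, None] ! n)"

definition f_table :: "nat \<Rightarrow> nat \<Rightarrow> nat option" where
  "f_table i n = (if i = 1 then [Some 1, None, None, Some 4, None, Some 6, Some 8, None, None, Some
    10, None, None, Some 13, None] ! n
     else [None, Some 2, Some 3, Some 5, Some 7, None, None, Some 9, Some 10, None, Some 11, Some
       12, None, None] ! n)"

definition eps_table :: "nat \<Rightarrow> nat \<Rightarrow> int" where
  "eps_table i n = (if i = 1 then [0, 1, 0, 0, 1, 0, 1, 0, 2, 0, 1, 0, 0, 1] ! n
     else [0, 0, 1, 2, 0, 3, 0, 1, 0, 2, 1, 2, 3, 0] ! n)"

definition phi_table :: "nat \<Rightarrow> nat \<Rightarrow> int" where
  "phi_table i n = (if i = 1 then [1, 0, 0, 1, 0, 2, 1, 0, 0, 1, 0, 0, 1, 0] ! n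
     else [0, 3, 2, 1, 2, 0, 0, 1, 3, 0, 2, 1, 0, 0] ! n)"

lemma adj_length: "length adj = 14" by (simp add: adj_def)

lemma adj_distinct: "distinct adj" by (simp add: adj_def)

lemma el_empty_notin: "el_empty \<notin> set adj" by (simp add: adj_def el_empty_def)

lemma adj_tables:
  assumes "i \<in> {1, 2}"
  shows "\<forall>n<14. B_et 1 i (adj ! n) = map_option ((!) adj) (e_table i n) \<and> B_eps 1 i
    (adj ! n) = eps_table i n \<and>
    B_phi 1 i (adj ! n) = phi_table i n"
proof -
  have "i = 1 \<or> i = 2" using assms by simp
  then show ?thesis
    unfolding All_less_14
    by (elim disjE; intro conjI; simp add: adj_def e_table_def eps_table_def phi_table_def B_et_def
      Bset_1 e_shift_def
      e1_shift_def e2_shift_def el_empty_def del: One_nat_def)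
qed

lemma B_et_adj: "i \<in> {1, 2} \<Longrightarrow> n < 14 \<Longrightarrow> B_et 1 i (adj ! n) =
  map_option ((!) adj) (e_table i n)"
  and B_eps_adj: "i \<in> {1, 2} \<Longrightarrow> n < 14 \<Longrightarrow> B_eps 1 i (adj ! n) =
    eps_table i n"
  and B_phi_adj: "i \<in> {1, 2} \<Longrightarrow> n < 14 \<Longrightarrow> B_phi 1 i (adj ! n) =
    phi_table i n"
  using adj_tables by auto

lemma table_props: "\<forall>n\<in>set [0..<14]. \<forall>i\<in>{1,2}. eps_table i n \<ge> 0 \<and>
  phi_table i n \<ge> 0 \<and> (e_table i n = None) = (eps_table i n = 0) \<and>
  (f_table i n = None) = (phi_table i n = 0) \<and>
  (case e_table i n of None \<Rightarrow> True | Some m \<Rightarrow> m < 14 \<and> f_table i m =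
    Some n \<and> eps_table i m = eps_table i n - 1 \<and> phi_table i m = phi_table i n + 1) \<and>
  (case f_table i n of None \<Rightarrow> True | Some m \<Rightarrow> m < 14 \<and> e_table i m =
    Some n)"
  by code_simp

lemmas tables = table_props[rule_format, unfolded set_upt atLeastLessThan_iff, OF conjI[OF le0]]

lemma e_table_inj: "\<lbrakk>n < 14; m < 14; i \<in> {1, 2}; e_table i n = Some k; e_table i m =
  Some k\<rbrakk> \<Longrightarrow> n = m"
  using tables[of n i] tables[of m i] by simp

declare One_nat_def [simp del]

lemma B_et_empty: "i \<in> {1, 2} \<Longrightarrow> B_et 1 i el_empty = None"
  by (auto simp: adj_def B_et_def Bset_1 e_shift_def e1_shift_def e2_shift_def el_empty_def
    zero_prod_def simp del: One_nat_def)

lemma Badj_carr: "carr Badj = set adj"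
  using el_empty_notin by (simp add: Badj_def Bset_1 del: One_nat_def)

lemma Badj_simps: "et Badj = B_et 1" "ft Badj = B_ft 1" "eps Badj = B_eps 1" "phi Badj = B_phi 1"
  by (simp_all add: Badj_def Bcr_def)

lemma adj_nth: "c \<in> set adj \<longleftrightarrow> (\<exists>n<14. c = adj ! n)"
  by (auto simp: in_set_conv_nth adj_length)

lemma adj_eq: "n < 14 \<Longrightarrow> m < 14 \<Longrightarrow> adj ! n = adj ! m
  \<longleftrightarrow> n = m"
  using adj_distinct adj_length by (simp add: nth_eq_iff_index_eq)

text \<open>\<open>B_ft\<close> is a definite description over all of B_1. Uniqueness of the
  preimage is injectivity of e_i in the table, and the preimage is a letter because e_1 and e_2 kill
  the empty tableau.\<close>

lemma B_ft_adj:
  assumes "i \<in> {1, 2}" "n < 14"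
  shows "B_ft 1 i (adj ! n) = Some c \<longleftrightarrow> c \<in> set adj \<and> B_et 1 i c = Some
    (adj ! n)"
proof -
  have ex: "b \<in> Bset 1 \<and> B_et 1 i b = Some (adj ! n) \<longleftrightarrow> (\<exists>m<14.
    b = adj ! m \<and> e_table i m = Some n)" for b
  proof
    assume b: "b \<in> Bset 1 \<and> B_et 1 i b = Some (adj ! n)"
    then have "b \<in> set adj" using B_et_empty[OF assms(1)] by (auto simp: Bset_1 simp del:
      One_nat_def)
    then obtain m where m: "m < 14" "b = adj ! m" by (auto simp: adj_nth)
    with b assms have "map_option ((!) adj) (e_table i m) = Some (adj ! n)" by (simp add: B_et_adj)
    then obtain k where "e_table i m = Some k" "adj ! k = adj ! n" by auto
    moreover from this have "k < 14" using tables[OF m(1) assms(1)] by simp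
    ultimately show "\<exists>m<14. b = adj ! m \<and> e_table i m = Some n" using assms m adj_eq
      by auto
  next
    assume "\<exists>m<14. b = adj ! m \<and> e_table i m = Some n"
    then show "b \<in> Bset 1 \<and> B_et 1 i b = Some (adj ! n)"
      using assms by (auto simp: B_et_adj Bset_1 adj_nth simp del: One_nat_def)
  qed
  have uniq: "b = b'" if "b \<in> Bset 1 \<and> B_et 1 i b = Some (adj ! n)" "b' \<in> Bset 1
    \<and> B_et 1 i b' = Some (adj ! n)" for b b'
    using that e_table_inj assms(1) unfolding ex by metis
  have "B_ft 1 i (adj ! n) = Some c \<longleftrightarrow> c \<in> Bset 1 \<and> B_et 1 i c = Some
    (adj ! n)"
  proof (cases "\<exists>b'\<in>Bset 1. B_et 1 i b' = Some (adj ! n)")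
    case True
    then obtain b where b: "b \<in> Bset 1 \<and> B_et 1 i b = Some (adj ! n)" by blast
    then have "(THE b'. b' \<in> Bset 1 \<and> B_et 1 i b' = Some (adj ! n)) = b"
      using uniq by blast
    with True have "B_ft 1 i (adj ! n) = Some b" by (simp add: B_ft_def)
    then show ?thesis using b uniq by (metis option.inject)
  next
    case False
    then show ?thesis by (auto simp: B_ft_def)
  qed
  then show ?thesis using B_et_empty[OF assms(1)] by (auto simp: Bset_1 simp del: One_nat_def)
qed

interpretation G2: seminormal "{1, 2}" Badj
proof
  fix i :: nat and c c' :: coords
  assume i: "i \<in> {1, 2}" and "c \<in> carr Badj"
  then obtain n where n: "n < 14" "c = adj ! n" by (auto simp: Badj_carr adj_nth)
  note props = tables[OF n(1) i]
  show "0 \<le> eps Badj i c" "0 \<le> phi Badj i c" "(et Badj i c = None) = (eps Badj i c = 0)"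
    using props i n by (simp_all add: Badj_simps B_eps_adj B_phi_adj B_et_adj)
  have f_ex: "(\<exists>m<14. e_table i m = Some n) \<longleftrightarrow> phi_table i n \<noteq> 0"
    using props tables[OF _ i] by (cases "f_table i n") fastforce+
  have "(ft Badj i c \<noteq> None) \<longleftrightarrow> (\<exists>m<14. e_table i m = Some n)"
  proof -
    have "(ft Badj i c \<noteq> None) \<longleftrightarrow> (\<exists>d. B_ft 1 i (adj ! n) = Some
      d)" using n by (simp add: Badj_simps)
    also have "\<dots> \<longleftrightarrow> (\<exists>m<14. B_et 1 i (adj ! m) = Some (adj ! n))"
      unfolding B_ft_adj[OF i n(1)] adj_nth by blast
    also have "\<dots> \<longleftrightarrow> (\<exists>m<14. e_table i m = Some n)"
    proof (intro ex_cong1 conj_cong refl)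
      fix m :: nat assume m: "m < 14"
      show "B_et 1 i (adj ! m) = Some (adj ! n) \<longleftrightarrow> e_table i m = Some n"
        using tables[OF m i] adj_eq n(1) i m by (auto simp: B_et_adj split: option.splits)
    qed
    finally show ?thesis .
  qed
  then show "(ft Badj i c = None) = (phi Badj i c = 0)"
    using f_ex n i by (auto simp: Badj_simps B_phi_adj)
  {
    assume "ft Badj i c = Some c'"
    then show "c' \<in> carr Badj \<and> et Badj i c' = Some c"
      using i n by (simp add: Badj_simps Badj_carr B_ft_adj)
  }
  {
    assume "et Badj i c = Some c'"
    then obtain m where m: "e_table i n = Some m" "c' = adj ! m" using i n by (auto simp:
      Badj_simps B_et_adj)
    then have "m < 14" using props by simp
    then show "c' \<in> carr Badj \<and> ft Badj i c' = Some c \<and> eps Badj i c' = eps Badj i c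
      - 1 \<and>
        phi Badj i c' = phi Badj i c + 1"
      using props i n m by (auto simp: Badj_simps Badj_carr B_ft_adj adj_nth B_et_adj B_eps_adj
        B_phi_adj)
  }
qed

text \<open>
  The word of the letters \<open>m\<close> and \<open>n\<close> lies in the component of \<open>1 \<otimes> c\<close>, where \<open>c\<close> is
  the letter with number \<open>top_letter m n\<close>. This invariant separates the five
  components of \<open>\<B>(1) \<otimes> \<B>(1)\<close>.
\<close>

definition top_letter :: "nat \<Rightarrow> nat \<Rightarrow> nat" where
  "top_letter m n = [
    [0, 1, 1, 1, 4, 1, 6, 4, 6, 4, 6, 6, 6, 13],
    [0, 0, 1, 1, 1, 1, 1, 4, 1, 4, 4, 6, 6, 6],
    [0, 0, 1, 1, 1, 1, 1, 4, 1, 4, 4, 6, 6, 6],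
    [0, 0, 1, 1, 1, 1, 1, 4, 1, 4, 4, 4, 4, 6],
    [0, 0, 1, 1, 1, 1, 1, 4, 1, 4, 4, 4, 4, 4],
    [0, 0, 0, 0, 1, 0, 1, 1, 1, 1, 1, 1, 1, 6],
    [0, 0, 0, 0, 1, 0, 1, 1, 1, 1, 1, 1, 1, 6],
    [0, 0, 1, 1, 1, 1, 1, 4, 1, 4, 4, 4, 4, 4],
    [0, 0, 0, 0, 0, 0, 0, 1, 0, 1, 1, 1, 1, 1],
    [0, 0, 0, 0, 1, 0, 1, 1, 1, 1, 1, 1, 1, 4],
    [0, 0, 0, 0, 0, 0, 0, 1, 0, 1, 1, 1, 1, 1],
    [0, 0, 0, 0, 0, 0, 0, 1, 0, 1, 1, 1, 1, 1],
    [0, 0, 0, 0, 0, 0, 0, 0, 0, 0, 0, 0, 0, 1],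
    [0, 0, 0, 0, 0, 0, 0, 0, 0, 0, 0, 0, 0, 0]] ! m ! n"

text \<open>A finite check of raising steps suffices: f_i inverts e_i, so constancy along e_i is
  constancy on components.\<close>

lemma top_letter_step: "\<forall>m\<in>set [0..<14]. \<forall>n\<in>set [0..<14]. \<forall>i\<in>{1,2}.
   (if eps_table i n \<le> phi_table i m then (case e_table i m of None \<Rightarrow> True | Some
     m' \<Rightarrow> top_letter m' n = top_letter m n)
    else (case e_table i n of None \<Rightarrow> True | Some n' \<Rightarrow> top_letter m n' =
      top_letter m n))"
  by code_simp

lemmas top_letter_step' = top_letter_step[rule_format, unfolded set_upt atLeastLessThan_iff,
  OF conjI[OF le0] conjI[OF le0]]

definition letter_index :: "coords \<Rightarrow> nat" where
  "letter_index c = (LEAST n. adj ! n = c)"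

lemma letter_index_adj:
  assumes "n < 14"
  shows "letter_index (adj ! n) = n"
  unfolding letter_index_def
proof (rule Least_equality)
  fix m assume "adj ! m = adj ! n"
  then show "n \<le> m" using adj_eq[OF assms, of m] assms by (cases "m < 14") auto
qed simp

definition pair_class :: "coords list \<Rightarrow> nat" where
  "pair_class w = top_letter (letter_index (w ! 0)) (letter_index (w ! 1))"

lemma pair_class_step:
  assumes i: "i \<in> {1, 2}" and a: "a \<in> lists (carr Badj)" "length a = 2" and et: "word_et
    Badj i a = Some b"
  shows "pair_class a = pair_class b"
proof -
  obtain c d where cd: "a = [c, d]" using a(2) by (auto simp: length_Suc_conv numeral_2_eq_2)
  then obtain m n where mn: "m < 14" "n < 14" "c = adj ! m" "d = adj ! n"
    using a(1) by (auto simp: Badj_carr adj_nth)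
  note step = top_letter_step'[OF mn(1,2) i] and pm = tables[OF mn(1) i] and pn = tables[OF mn(2) i]
  show ?thesis
  proof (cases "eps_table i n \<le> phi_table i m")
    case True
    then obtain m' where "e_table i m = Some m'" "b = [adj ! m', adj ! n]"
      using et i mn pn unfolding cd by (auto simp: Badj_simps B_et_adj B_eps_adj B_phi_adj)
    then show ?thesis using step pm True mn unfolding cd pair_class_def by (simp add: letter_index_adj)
  next
    case False
    then obtain n' where "e_table i n = Some n'" "b = [adj ! m, adj ! n']"
      using et i mn pn unfolding cd by (auto simp: Badj_simps B_et_adj B_eps_adj B_phi_adj split:
        if_splits)
    then show ?thesis using step pn False mn unfolding cd pair_class_def by (simp add: letter_index_adj)
  qed
qed

lemma pair_class_component:
  assumes "v \<in> Bgen_set w" "w \<in> lists (carr Badj)" "length w = 2"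
  shows "pair_class v = pair_class w"
proof -
  from assms(1)[unfolded Bgen_set_def] assms(2) have "pair_class v = pair_class w \<and> length v = 2"
  proof (induction rule: G2.component_induct)
    case base
    show ?case using assms by simp
  next
    case (et i v u)
    then show ?case using pair_class_step[of i v u] G2.word_et_SomeD[of i v u] by auto
  next
    case (ft i v u)
    then show ?case using pair_class_step[of i u v] G2.word_et_SomeD[of i u v] by auto
  qed
  then show ?thesis ..
qed

lemma pair_class_subword:
  assumes "v \<in> Bgen_set w" "w \<in> lists (carr Badj)" "m + 2 \<le> length w"
  shows "pair_class (take 2 (drop m v)) = pair_class (take 2 (drop m w))"
  using G2.subword_invariant[of v w m 2 pair_class] assms pair_class_step unfolding Bgen_set_def by
    blast

lemma el_adj: "el_1 = adj ! 0" "el_2 = adj ! 1" "el_2_3 = adj ! 4" "el_0 = adj ! 6" "el_1bar = adj ! 13"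
  by (simp_all add: adj_def el_1_def el_2_def el_2_3_def el_0_def el_1bar_def)

lemma el_in: "el_1 \<in> carr Badj" "el_2 \<in> carr Badj" "el_2_3 \<in> carr Badj" "el_0 \<in>
  carr Badj" "el_1bar \<in> carr Badj"
  by (simp_all add: Badj_carr el_adj adj_length)

lemma pair_class_el_1: "n < 14 \<Longrightarrow> pair_class [el_1, adj ! n] = [0, 1, 1, 1, 4, 1, 6,
  4, 6, 4, 6, 6, 6, 13] ! n"
  by (simp add: pair_class_def el_adj letter_index_adj top_letter_def)

lemma highest_letter:
  assumes "c \<in> carr Badj" "eps Badj 1 c = 0" "eps Badj 2 c = 0"
  shows "c = el_1"
proof -
  obtain n where n: "n < 14" "c = adj ! n" using assms(1) by (auto simp: Badj_carr adj_nth)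
  have "\<forall>n<14. eps_table 1 n = 0 \<longrightarrow> eps_table 2 n = 0 \<longrightarrow> n = 0"
    unfolding All_less_14 by (simp add: eps_table_def)
  then show ?thesis using assms n by (auto simp: Badj_simps B_eps_adj el_adj)
qed

lemma letter_phi_eps:
  "eps Badj 1 el_1 = 0" "eps Badj 2 el_1 = 0" "phi Badj 1 el_1 = 1" "phi Badj 2 el_1 = 0"
  "eps Badj 1 el_2 = 1" "eps Badj 2 el_2 = 0" "phi Badj 1 el_2 = 0" "phi Badj 2 el_2 = 3"
  "eps Badj 1 el_2_3 = 1" "eps Badj 2 el_2_3 = 0" "phi Badj 1 el_2_3 = 0" "phi Badj 2 el_2_3 = 2"
  "eps Badj 1 el_0 = 1" "eps Badj 2 el_0 = 0" "phi Badj 1 el_0 = 1" "phi Badj 2 el_0 = 0"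
  "eps Badj 1 el_1bar = 1" "eps Badj 2 el_1bar = 0" "phi Badj 1 el_1bar = 0" "phi Badj 2 el_1bar = 0"
  by (simp_all add: el_adj Badj_simps B_eps_adj B_phi_adj eps_table_def phi_table_def)

text \<open>Intended for the last letter of a highest weight word: its eps_2 may be absorbed by
  phi_2 of the letters before it, so for index 2 only the difference phi_2 - eps_2 is
  available.\<close>

lemma highest_weight_letter:
  assumes "c \<in> carr Badj" "eps Badj 1 c = 0" "phi Badj 1 c = 1" "eps Badj 2 c = phi Badj 2 c"
  shows "c = el_1"
proof -
  obtain n where n: "n < 14" "c = adj ! n" using assms(1) by (auto simp: Badj_carr adj_nth)
  have "\<forall>n<14. eps_table 1 n = 0 \<longrightarrow> phi_table 1 n = 1 \<longrightarrow>
    eps_table 2 n = phi_table 2 n \<longrightarrow> n = 0"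
    unfolding All_less_14 by (simp add: eps_table_def phi_table_def)
  then show ?thesis using assms n by (auto simp: Badj_simps B_eps_adj B_phi_adj el_adj)
qed

section \<open>Realizations of crystals by words\<close>

abbreviation "adj_words \<equiv> lists (carr Badj)"

text \<open>A common home for the G_2-structures of different crystals. Only e_i is recorded, since
  f_i on words is recovered as its inverse.\<close>

definition realizes :: "'a crystal \<Rightarrow> ('a \<Rightarrow> coords list) \<Rightarrow> bool"
  where
  "realizes A \<tau> \<longleftrightarrow> (\<forall>i\<in>{1,2}. \<forall>a\<in>carr A. \<tau> a
    \<in> adj_words \<and>
     word_eps Badj i (\<tau> a) = eps A i a \<and> word_phi Badj i (\<tau> a) = phi A i a \<and>
     word_et Badj i (\<tau> a) = map_option \<tau> (et A i a) \<and> (\<forall>a'. et A i a = Some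
       a' \<longrightarrow> a' \<in> carr A))"

lemma realizesD:
  assumes "realizes A \<tau>" "i \<in> {1, 2}" "a \<in> carr A"
  shows "\<tau> a \<in> adj_words" "word_eps Badj i (\<tau> a) = eps A i a" "word_phi Badj i
    (\<tau> a) = phi A i a"
    "word_et Badj i (\<tau> a) = map_option \<tau> (et A i a)" "\<And>a'. et A i a = Some a'
      \<Longrightarrow> a' \<in> carr A"
  using assms unfolding realizes_def by blast+

lemma realizes_tensor:
  assumes "realizes A \<sigma>" "realizes B \<tau>"
  shows "realizes (tensor A B) (\<lambda>(a, b). \<sigma> a @ \<tau> b)"
  unfolding realizes_def
proof (intro ballI)
  fix i x assume i: "i \<in> {1, 2::nat}" and x: "x \<in> carr (tensor A B)"
  obtain a b where ab: "x = (a, b)" "a \<in> carr A" "b \<in> carr B"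
    using x by (auto simp: tensor_def)
  note a = realizesD[OF assms(1) i ab(2)] and b = realizesD[OF assms(2) i ab(3)]
  have 1: "word_et Badj i (\<sigma> a @ \<tau> b) = map_option (\<lambda>(a, b). \<sigma> a @
    \<tau> b) (et (tensor A B) i x)"
    unfolding G2.word_et_append[OF i b(1)] a b ab(1)
    by (simp add: tensor_def option.map_comp comp_def)
  have 2: "\<forall>a'. et (tensor A B) i x = Some a' \<longrightarrow> a' \<in> carr (tensor A B)"
    using a(5) b(5) ab by (auto simp: tensor_def split: if_splits)
  show "(case x of (a, b) \<Rightarrow> \<sigma> a @ \<tau> b) \<in> adj_words \<and>
     word_eps Badj i (case x of (a, b) \<Rightarrow> \<sigma> a @ \<tau> b) = eps (tensor A B) i x
       \<and>
     word_phi Badj i (case x of (a, b) \<Rightarrow> \<sigma> a @ \<tau> b) = phi (tensor A B) i x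
       \<and>
     word_et Badj i (case x of (a, b) \<Rightarrow> \<sigma> a @ \<tau> b) = map_option
       (\<lambda>(a, b). \<sigma> a @ \<tau> b) (et (tensor A B) i x) \<and>
     (\<forall>a'. et (tensor A B) i x = Some a' \<longrightarrow> a' \<in> carr (tensor A B))"
    using 1 2 a(1) b(1) unfolding ab(1)
    by (simp add: G2.word_eps_append[OF i b(1)] G2.word_phi_append[OF i b(1)] a(2,3) b(2,3) tensor_def)
qed

lemma crystal_isoD:
  assumes "crystal_iso I A B h" "i \<in> I" "b \<in> carr A"
  shows "h b \<in> carr B" "eps B i (h b) = eps A i b" "phi B i (h b) = phi A i b"
    "et B i (h b) = map_option h (et A i b)" "ft B i (h b) = map_option h (ft A i b)"
  using assms unfolding crystal_iso_def bij_betw_def by auto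

lemma Bcr_simps: "carr (Bcr l) = Bset l" "et (Bcr l) = B_et l" "ft (Bcr l) = B_ft l"
    "eps (Bcr l) = B_eps l" "phi (Bcr l) = B_phi l"
  by (simp_all add: Bcr_def)

lemma Bgen_adj_words: "v \<in> Bgen_set w \<Longrightarrow> w \<in> adj_words \<Longrightarrow> v
  \<in> adj_words"
  unfolding Bgen_set_def by (rule G2.component_W)

lemma Bgen_length: "v \<in> Bgen_set w \<Longrightarrow> w \<in> adj_words \<Longrightarrow> length
  v = length w"
  unfolding Bgen_set_def by (rule G2.component_length)

lemma Bgen_refl: "w \<in> Bgen_set w"
  unfolding Bgen_set_def by (rule G2.component_refl)

lemma Rows_simps: "et (Rows l) = word_et Badj" "ft (Rows l) = word_ft Badj"
    "eps (Rows l) = word_eps Badj" "phi (Rows l) = word_phi Badj"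
  by (simp_all add: Rows_def words_def)

lemma Bgen_simps: "et (Bgen w) = word_et Badj" "ft (Bgen w) = word_ft Badj"
    "eps (Bgen w) = word_eps Badj" "phi (Bgen w) = word_phi Badj" "carr (Bgen w) = Bgen_set w"
  by (simp_all add: Bgen_def words_def)

lemma replicate_adj_words: "replicate k el_1 \<in> adj_words"
  using el_in(1) by (induction k) auto

lemma Rows_adj_words: "w \<in> carr (Rows l) \<Longrightarrow> w \<in> adj_words"
  unfolding Rows_def using Bgen_adj_words[OF _ replicate_adj_words] by auto

lemma realizes_Rows:
  assumes "crystal_iso {1, 2} (Bcr l) (Rows l) T"
  shows "realizes (Bcr l) T"
  unfolding realizes_def
proof (intro ballI conjI allI impI)
  fix i a assume i: "i \<in> {1, 2::nat}" and a: "a \<in> carr (Bcr l)"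
  note D = crystal_isoD[OF assms i a]
  show "T a \<in> adj_words" using D(1) Rows_adj_words by blast
  show "word_eps Badj i (T a) = eps (Bcr l) i a" "word_phi Badj i (T a) = phi (Bcr l) i a"
    "word_et Badj i (T a) = map_option T (et (Bcr l) i a)"
    using D by (simp_all add: Rows_simps)
  show "a' \<in> carr (Bcr l)" if "et (Bcr l) i a = Some a'" for a'
    using that by (auto simp: Bcr_simps B_et_def split: if_splits)
qed

text \<open>As a G_2-crystal, B_1 is B(1) together with the trivial crystal B(0), whose element is
  the empty word.\<close>

definition word_of :: "coords \<Rightarrow> coords list" where
  "word_of b = (if b = el_empty then [] else [b])"

lemma B_eps_empty: "i \<in> {1, 2} \<Longrightarrow> B_eps l i el_empty = 0" "i \<in> {1, 2}
  \<Longrightarrow> B_phi l i el_empty = 0"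
  by (auto simp: el_empty_def)

lemma realizes_word_of: "realizes (Bcr 1) word_of"
  unfolding realizes_def
proof (intro ballI)
  fix i a assume i: "i \<in> {1, 2::nat}" and a: "a \<in> carr (Bcr 1)"
  show "word_of a \<in> adj_words \<and> word_eps Badj i (word_of a) = eps (Bcr 1) i a \<and>
     word_phi Badj i (word_of a) = phi (Bcr 1) i a \<and>
     word_et Badj i (word_of a) = map_option word_of (et (Bcr 1) i a) \<and>
     (\<forall>a'. et (Bcr 1) i a = Some a' \<longrightarrow> a' \<in> carr (Bcr 1))"
  proof (cases "a = el_empty")
    case True
    then show ?thesis using i B_et_empty[OF i]
      by (auto simp: word_of_def Bcr_simps B_eps_empty)
  next
    case False
    then have c: "a \<in> carr Badj" using a by (auto simp: Bcr_simps Bset_1 Badj_carr)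
    have b: "b \<in> carr Badj" if "B_et 1 i a = Some b" for b
      using G2.et_SomeD[OF i c, of b] that by (simp add: Badj_simps)
    then have "map_option word_of (B_et 1 i a) = map_option (\<lambda>b. [b]) (B_et 1 i a)"
      using el_empty_notin by (cases "B_et 1 i a") (auto simp: word_of_def Badj_carr)
    then show ?thesis using False c b G2.eps_nonneg[OF i c] G2.phi_nonneg[OF i c]
      by (auto simp: word_of_def Bcr_simps Badj_simps Bset_1 Badj_carr)
  qed
qed

lemma word_eps_1: "i \<in> {1, 2} \<Longrightarrow> word_eps Badj i (replicate k el_1) = 0"
  by (induction k) (auto simp: letter_phi_eps(1-4))

lemma word_phi_1: "word_phi Badj 1 (replicate k el_1) = int k" "word_phi Badj 2 (replicate k el_1) = 0"
  using word_eps_1 by (induction k) (auto simp: letter_phi_eps(1-4))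

text \<open>Uniqueness of the highest weight element in B(j \<Lambda>_1). The first letter is itself
  highest, hence 1; every adjacent pair has the class of 1 \<otimes> 1, and the only letter with
  this class behind a 1 is again 1.\<close>

lemma Rows_highest:
  assumes "w \<in> carr (Rows l)" "word_eps Badj 1 w = 0" "word_eps Badj 2 w = 0"
  shows "\<exists>k\<le>l. w = replicate k el_1"
proof -
  obtain k where k: "k \<le> l" "w \<in> Bgen_set (replicate k el_1)"
    using assms(1) by (auto simp: Rows_def)
  then have w: "w \<in> adj_words" "length w = k"
    using Bgen_adj_words[OF _ replicate_adj_words] Bgen_length[OF _ replicate_adj_words] by auto
  have "w ! n = el_1" if "n < k" for n
    using that
  proof (induction n)
    case 0
    then obtain c v where c: "w = c # v" using w by (cases w rule: list.exhaust) auto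
    then have "c \<in> carr Badj" using w by auto
    moreover have "eps Badj 1 c = 0" "eps Badj 2 c = 0"
      using assms(2,3) G2.eps_nonneg[of 1 c] G2.eps_nonneg[of 2 c] \<open>c \<in> carr Badj\<close>
        unfolding c by auto
    ultimately show ?case using highest_letter c by simp
  next
    case (Suc n)
    have "w ! Suc n \<in> carr Badj" using w Suc.prems by auto
    then obtain m where m: "m < 14" "w ! Suc n = adj ! m" by (auto simp: Badj_carr adj_nth)
    have tk: "take 2 (drop n u) = [u ! n, u ! Suc n]" if "length u = k" for u :: "coords list"
      using that Suc.prems by (simp add: numeral_2_eq_2 take_Suc hd_drop_conv_nth
        tl_drop[symmetric] drop_Suc nth_tl)
        (simp add: Cons_nth_drop_Suc[symmetric])
    have "pair_class [el_1, adj ! m] = pair_class [el_1, el_1]"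
      using pair_class_subword[OF k(2) replicate_adj_words, of n] Suc w m
      unfolding tk[OF w(2)] tk[OF length_replicate] by simp
    then have "[0, 1, 1, 1, 4, 1, 6, 4, 6, 4, 6, 6, 6, 13::nat] ! m = 0"
      using pair_class_el_1[OF m(1)] pair_class_el_1[of 0] by (simp add: el_adj(1))
    moreover have "\<forall>m<14. [0, 1, 1, 1, 4, 1, 6, 4, 6, 4, 6, 6, 6, 13::nat] ! m = 0
      \<longrightarrow> m = 0"
      unfolding All_less_14 by simp
    ultimately show ?case using m el_adj(1) by auto
  qed
  then have "w = replicate k el_1" using w(2) by (auto intro: nth_equalityI)
  with k(1) show ?thesis by auto
qed

section \<open>Shifted letters\<close>

text \<open>On tableaux this adds k entries 1 at the start of the row, that is, k letters 1 at the
  right end of the word; \<open>T_letter\<close> and \<open>T_20\<close> confirm it for the elements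
  that occur.\<close>

fun add_ones :: "nat \<Rightarrow> coords \<Rightarrow> coords" where
  "add_ones k (x1, x2, x3, y3, y2, y1) = (of_nat k + x1, x2, x3, y3, y2, y1)"

text \<open>The two-entry tableau \<open>[2, 0]\<close>.\<close>

definition el_20 :: coords where "el_20 = (0, 1, 1, 1, 0, 0)"

text \<open>The case distinctions of e_1 and e_2 compare only z_2, z_3 and z_4, in which x_1 does
  not occur.\<close>

lemma e_shift_add_ones: "i \<in> {1, 2} \<Longrightarrow> e_shift i (add_ones k b) = e_shift i b"
  by (cases b) (auto simp: e_shift_def e1_shift_def e2_shift_def)

lemma add_ones_plus: "add_ones k b + s = add_ones k (b + s)"
  by (cases b, cases s) auto

lemma add_ones_in_Bset:
  assumes "b \<in> Bset m" "k + m \<le> l"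
  shows "add_ones k b \<in> Bset l"
proof -
  obtain n where n: "b = of_thirds n" "Bset_nat m n" using assms(1) by (rule Bset_of_thirds)
  obtain n1 n2 n3 n4 n5 n6 where n': "n = (n1, n2, n3, n4, n5, n6)" by (cases n) auto
  have "add_ones k b = of_thirds (3 * k + n1, n2, n3, n4, n5, n6)"
    by (simp add: n n' add_divide_distrib)
  moreover have "Bset_nat l (3 * k + n1, n2, n3, n4, n5, n6)"
    using n(2) assms(2) by (auto simp: n')
  ultimately show ?thesis by (simp only: of_thirds_in_Bset)
qed

lemma B_et_add_ones:
  assumes "i \<in> {1, 2}" "B_et m i b = Some b'" "k + m \<le> l"
  shows "B_et l i (add_ones k b) = Some (add_ones k b')"
proof -
  have "b + e_shift i b \<in> Bset m" "b' = b + e_shift i b"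
    using assms(2) by (auto simp: B_et_def split: if_splits)
  then show ?thesis
    using add_ones_in_Bset[of b' m k l] assms by (simp add: B_et_def e_shift_add_ones add_ones_plus)
qed

text \<open>The bounds 1 and 0 are phi_1 and phi_2 of the letter 1, so these are the candidates for
  c in a highest weight element 1 \<otimes> c.\<close>

lemma small_highest:
  assumes "b \<in> Bset l" "B_eps l 1 b \<le> 1" "B_eps l 2 b = 0"
  shows "\<exists>k g. b = add_ones k g \<and> g \<in> {el_empty, el_2, el_0, el_20, el_2_3, el_1bar}"
proof -
  obtain n where n: "b = of_thirds n" "Bset_nat l n" using assms(1) by (rule Bset_of_thirds)
  obtain n1 n2 n3 n4 n5 n6 where n': "n = (n1, n2, n3, n4, n5, n6)" by (cases n) auto
  have "(of_nat n5 :: rat) + 3/2 * max (of_nat n3 / 3 - of_nat n4 / 3) 0 < 1"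
  proof -
    have "B_eps l 2 b = \<lfloor>of_nat n5 + 3/2 * max (of_nat n3 / 3 - of_nat n4 / 3 :: rat)
      0\<rfloor>"
      unfolding n n' by simp
    with assms(3) show ?thesis by linarith
  qed
  then have "(of_nat (2 * n5 + n3) :: rat) < of_nat (2 + n4)" "(of_nat n5 :: rat) < 1"
    by (auto simp: max_def field_simps split: if_splits)
  then have 5: "2 * n5 + n3 < 2 + n4" "n5 < 1" unfolding of_nat_less_iff by auto
  have "of_nat n6 / 3 + max (of_nat n4 / 3 - of_nat n5 / 3 + max (of_nat n2 / 3 - of_nat n3 / 3) 0)
    0 < (2 :: rat)"
    using assms(2) unfolding n n' by (simp add: floor_le_iff)
  then have "(of_nat (n6 + n4 + n2) :: rat) < of_nat (6 + n3)" "(of_nat (n6 + n4) :: rat) < of_nat 6"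
    using 5(2) by (auto simp: max_def field_simps split: if_splits)
  then have 1: "n6 + n4 + n2 < 6 + n3" "n6 + n4 < 6" unfolding of_nat_less_iff by auto
  \<comment> \<open>The inequalities, the congruences and the parity of n3 + n4 together leave six
    tuples (n2, n3, n4, n6), one for each g; n1 is free and yields k.\<close>
  have m: "n1 mod 3 = 0" "n6 mod 3 = 0" "n2 mod 3 = n3 mod 3" "n4 mod 3 = n5 mod 3" "even (n3 + n4)"
    using n by (auto simp: n')
  have n5: "n5 = 0" using 5 by simp
  have mult3: "x = 0 \<or> x = 3" if "x mod 3 = 0" "x < 6" for x :: nat
    using that by presburger
  have 46: "n4 = 0 \<or> n4 = 3" "n6 = 0 \<or> n6 = 3" using mult3 m n5 1 by simp_all
  have "n3 < 5" using 5 46 by auto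
  then have n3: "n3 = 0 \<or> n3 = 1 \<or> n3 = 2 \<or> n3 = 3 \<or> n3 = 4" by auto
  have mod3: "x = 0 \<or> x = 3 \<or> x = 6 \<or> x \<ge> 9" if "x mod 3 = 0" for x :: nat using
    that by presburger
  have mod3': "x = 1 \<or> x = 4 \<or> x = 7 \<or> x \<ge> 9" if "x mod 3 = 1" for x :: nat using
    that by presburger
  have "(n2, n3, n4, n6) \<in> {(0,0,0,0), (3,0,0,0), (0,3,3,0), (3,3,3,0), (1,1,3,0), (0,0,0,3)}"
    using 46 n3 m(3,5) 1 5 n5 mod3[of n2] mod3'[of n2] by (elim disjE) auto
  moreover obtain k where "n1 = 3 * k" using m(1) by (auto simp: mod_eq_0_iff_dvd)
  moreover have "b = add_ones k (of_thirds (0, n2, n3, n4, 0, n6))" if "n1 = 3 * k" for k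
    using that n5 by (simp add: n n')
  ultimately show ?thesis
    by (intro exI[of _ k] exI[of _ "of_thirds (0, n2, n3, n4, 0, n6)"])
      (auto simp: el_empty_def el_2_def el_0_def el_20_def el_2_3_def el_1bar_def)
qed

lemma add_ones_eps_phi:
  "B_eps l 1 (add_ones k el_empty) = 0" "B_eps l 2 (add_ones k el_empty) = 0"
  "B_phi l 1 (add_ones k el_empty) = int k" "B_phi l 2 (add_ones k el_empty) = 0"
  "B_eps l 1 (add_ones k el_2) = 1" "B_eps l 2 (add_ones k el_2) = 0"
  "B_phi l 1 (add_ones k el_2) = int k" "B_phi l 2 (add_ones k el_2) = 3"
  "B_eps l 1 (add_ones k el_0) = 1" "B_eps l 2 (add_ones k el_0) = 0"
  "B_phi l 1 (add_ones k el_0) = int k + 1" "B_phi l 2 (add_ones k el_0) = 0"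
  "B_eps l 1 (add_ones k el_20) = 1" "B_eps l 2 (add_ones k el_20) = 0"
  "B_phi l 1 (add_ones k el_20) = int k" "B_phi l 2 (add_ones k el_20) = 3"
  "B_eps l 1 (add_ones k el_2_3) = 1" "B_eps l 2 (add_ones k el_2_3) = 0"
  "B_phi l 1 (add_ones k el_2_3) = int k" "B_phi l 2 (add_ones k el_2_3) = 2"
  "B_eps l 1 (add_ones k el_1bar) = 1" "B_eps l 2 (add_ones k el_1bar) = 0"
  "B_phi l 1 (add_ones k el_1bar) = int k" "B_phi l 2 (add_ones k el_1bar) = 0"
  by (simp_all add: el_empty_def el_2_def el_0_def el_20_def el_2_3_def el_1bar_def)

section \<open>The operator \<open>e\<^sub>0\<close>\<close>

lemma M_val_alt: "M_val b = max 0 (max (z1 b) (max (z1 b + z2 b) (max (z1 b + z2 b + 3 * z4 b)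
   (max (z1 b + z2 b + z3 b + 3 * z4 b) (2 * z1 b + z2 b + z3 b + 3 * z4 b)))))"
proof -
  have "{1..6::nat} = {1, 2, 3, 4, 5, 6}" by auto
  then show ?thesis by (simp add: M_val_def a_val_def)
qed

lemma a_val_6: "a_val b 6 = 2 * z1 b + z2 b + z3 b + 3 * z4 b"
  by (simp add: a_val_def)

lemma B_eps_0:
  assumes "of_nat l - s_val b + M_val b - a_val b 6 = of_int z"
  shows "B_eps l 0 b = z"
proof (cases b)
  case (fields x1 x2 x3 y3 y2 y1)
  then have "B_eps l 0 b = \<lfloor>of_nat l - s_val b + M_val b - a_val b 6\<rfloor>" by (simp
    add: Let_def)
  then show ?thesis unfolding assms by simp
qed

lemma B_phi_0:
  assumes "of_nat l - s_val b + M_val b = of_int z"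
  shows "B_phi l 0 b = z"
proof (cases b)
  case (fields x1 x2 x3 y3 y2 y1)
  then have "B_phi l 0 b = \<lfloor>of_nat l - s_val b + M_val b\<rfloor>" by (simp add: Let_def)
  then show ?thesis unfolding assms by simp
qed

text \<open>For \<open>el_1bar\<close> one has z_1 = 1 - k and z_2 = z_3 = z_4 = 0, so the maximum M
  is a_6 = 2 if k = 0 and a_1 = 0 if k > 0. This causes the case distinction.\<close>

lemma eps_0_add_ones:
  "B_eps l 0 (add_ones k el_empty) = int l + int k"
  "B_eps l 0 (add_ones k el_2) = int l + int k"
  "B_eps l 0 (add_ones k el_0) = int l + int k - 1"
  "B_eps l 0 (add_ones k el_20) = int l + int k - 1"
  "B_eps l 0 (add_ones k el_1bar) = (if k = 0 then int l - 1 else int l + int k - 3)"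
  by (rule B_eps_0; cases k;
      simp add: M_val_alt a_val_6 el_empty_def el_2_def el_0_def el_20_def el_1bar_def max_def; fail)+

lemma phi_0_add_ones: "B_phi l 0 (add_ones k el_empty) = int l - int k"
  by (rule B_phi_0) (simp add: M_val_alt el_empty_def max_def)

lemma el_1_add_ones: "el_1 = add_ones 1 el_empty"
  by (simp add: el_1_def el_empty_def)

lemma add_ones_0 [simp]: "add_ones 0 b = b"
  by (cases b) simp

lemma eps_0_letters:
  "B_eps 1 0 el_empty = 1" "B_eps 1 0 el_1 = 2" "B_eps 1 0 el_2 = 1" "B_eps 1 0 el_0 = 0"
  "B_eps 1 0 el_1bar = 0" "B_phi 1 0 el_empty = 1" "B_phi 1 0 el_1 = 0"
  using eps_0_add_ones[of 1 0] eps_0_add_ones(1)[of 1 1] phi_0_add_ones[of 1 0] phi_0_add_ones[of 1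
    1] by (simp_all add: el_1_add_ones)

lemma eps_0_3bar: "B_eps 1 0 (adj ! 8) = 0"
  by (rule B_eps_0) (simp add: M_val_alt a_val_6 adj_def)

text \<open>Here z_1 = -(k + 1) and the other z vanish, so a_1 = 0 is the unique maximum and e_0
  subtracts 1 from x_1.\<close>

lemma e0_empty:
  assumes "k + 1 \<le> l"
  shows "B_et l 0 (add_ones (k + 1) el_empty) = Some (add_ones k el_empty)"
proof -
  have a: "a_val (add_ones (k + 1) el_empty) i < 0 \<or> i \<notin> {2..6}" for i
    by (auto simp: a_val_def el_empty_def nth_Cons' )
  have M: "M_val (add_ones (k + 1) el_empty) = 0" by (simp add: M_val_alt el_empty_def max_def)
  have "{i \<in> {1..6}. a_val (add_ones (k + 1) el_empty) i = M_val (add_ones (k + 1) el_empty)} = {1}"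
  proof -
    have "i = 1" if "i \<in> {1..6}" "a_val (add_ones (k + 1) el_empty) i = 0" for i
      using a[of i] that by auto
    moreover have "a_val (add_ones (k + 1) el_empty) 1 = 0" by (simp add: a_val_def)
    ultimately show ?thesis unfolding M by auto
  qed
  then have "e0_index (add_ones (k + 1) el_empty) = 1" by (simp add: e0_index_def)
  then have "add_ones (k + 1) el_empty + e_shift 0 (add_ones (k + 1) el_empty) = add_ones k el_empty"
    by (simp add: e_shift_def e0_shift_def el_empty_def)
  moreover have "add_ones k el_empty \<in> Bset l"
    using add_ones_in_Bset[of el_empty 1 k l] assms by (simp add: Bset_1)
  ultimately show ?thesis by (simp add: B_et_def)
qed

lemma e0_el_1: "B_et 1 0 el_1 = Some el_empty"
  using e0_empty[of 0 1] by (simp add: el_1_add_ones)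

lemma s_val_add_ones: "s_val (add_ones k b) = of_nat k + s_val b"
  by (cases b) simp

lemma add_ones_le:
  "add_ones k el_empty \<in> Bset l \<Longrightarrow> k \<le> l"
  "add_ones k el_2 \<in> Bset l \<Longrightarrow> k + 1 \<le> l"
  "add_ones k el_0 \<in> Bset l \<Longrightarrow> k + 1 \<le> l"
  "add_ones k el_20 \<in> Bset l \<Longrightarrow> k + 2 \<le> l"
  "add_ones k el_2_3 \<in> Bset l \<Longrightarrow> k + 1 \<le> l"
  "add_ones k el_1bar \<in> Bset l \<Longrightarrow> k + 1 \<le> l"
proof -
  have "k + m \<le> l" if "b \<in> Bset l" "s_val b = of_nat (k + m)" for b m
  proof -
    have "s_val b \<le> of_nat l" using that(1) by (auto simp: Bset_def)
    then show ?thesis using that(2) by (simp only: of_nat_le_iff)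
  qed
  note * = this[of _ 0] this[of _ 1] this[of _ 2]
  show "add_ones k el_empty \<in> Bset l \<Longrightarrow> k \<le> l"
    using *(1)[of "add_ones k el_empty"] by (simp add: s_val_add_ones el_empty_def)
  show "add_ones k el_2 \<in> Bset l \<Longrightarrow> k + 1 \<le> l"
    using *(2)[of "add_ones k el_2"] by (simp add: s_val_add_ones el_2_def)
  show "add_ones k el_0 \<in> Bset l \<Longrightarrow> k + 1 \<le> l"
    using *(2)[of "add_ones k el_0"] by (simp add: s_val_add_ones el_0_def)
  show "add_ones k el_20 \<in> Bset l \<Longrightarrow> k + 2 \<le> l"
    using *(3)[of "add_ones k el_20"] by (simp add: s_val_add_ones el_20_def)
  show "add_ones k el_2_3 \<in> Bset l \<Longrightarrow> k + 1 \<le> l"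
    using *(2)[of "add_ones k el_2_3"] by (simp add: s_val_add_ones el_2_3_def)
  show "add_ones k el_1bar \<in> Bset l \<Longrightarrow> k + 1 \<le> l"
    using *(2)[of "add_ones k el_1bar"] by (simp add: s_val_add_ones el_1bar_def)
qed

lemma add_ones_inj: "add_ones k g = add_ones k' g \<longleftrightarrow> k = k'"
  by (cases g) auto

section \<open>The rows of the shifted letters\<close>

locale rows =
  fixes l :: nat and T :: "coords \<Rightarrow> coords list"
  assumes T: "crystal_iso {1, 2} (Bcr l) (Rows l) T"
begin

lemmas T_word = realizes_Rows[OF T]

text \<open>e_i is injective on words where it is defined, so a known value of T determines the
  value one step further down. All values of T beyond the powers of 1 are obtained in this
  way.\<close>

lemma T_back:
  assumes "i \<in> {1, 2}" "b \<in> Bset l" "B_et l i b = Some b'" "w \<in> adj_words" "word_et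
    Badj i w = Some (T b')"
  shows "T b = w"
  using G2.word_et_inj[OF assms(1) _ assms(4) _ assms(5), of "T b"] realizesD[OF T_word assms(1),
    of b] assms(2,3)
  by (simp add: Bcr_simps)

text \<open>The image is highest, hence a power of 1, and phi_1 fixes the exponent.\<close>

lemma T_empty:
  assumes "k \<le> l"
  shows "T (add_ones k el_empty) = replicate k el_1"
proof -
  have b: "add_ones k el_empty \<in> carr (Bcr l)"
    using add_ones_in_Bset[of el_empty 0 k l] assms of_thirds_in_Bset[of "(0,0,0,0,0,0)" 0]
    by (simp add: Bcr_simps el_empty_def)
  note D1 = crystal_isoD[OF T, of 1, OF _ b] and D2 = crystal_isoD[OF T, of 2, OF _ b]
  obtain k' where "T (add_ones k el_empty) = replicate k' el_1"
    using Rows_highest[of "T (add_ones k el_empty)" l] D1 D2 by (auto simp: Rows_simps Bcr_simps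
      add_ones_eps_phi)
  moreover from this have "k' = k" using D1(3) by (simp add: Rows_simps Bcr_simps add_ones_eps_phi
    word_phi_1)
  ultimately show ?thesis by simp
qed

text \<open>Trailing ones have eps_i = 0, so the tensor rule sends e_i to the word in front of
  them.\<close>

lemma word_et_1:
  assumes "i \<in> {1, 2}" "u \<in> adj_words"
  shows "word_et Badj i (u @ replicate k el_1) = map_option (\<lambda>u'. u' @ replicate k el_1)
    (word_et Badj i u)"
  using G2.word_et_append[OF assms(1) replicate_adj_words, of u k] word_eps_1[OF assms(1)]
    G2.word_phi_nonneg[OF assms]
  by simp

lemma T_letter:
  assumes "n < 14" "k + 1 \<le> l"
  shows "T (add_ones k (adj ! n)) = adj ! n # replicate k el_1"
  using assms(1)
proof (induction n rule: less_induct)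
  case (less n)
  show ?case
  proof (cases "n = 0")
    case True
    have "add_ones k (adj ! 0) = add_ones (Suc k) el_empty" by (simp add: adj_def el_empty_def)
    then show ?thesis using T_empty[of "Suc k"] assms(2) True by (simp add: el_adj)
  next
    case False
    \<comment> \<open>Every letter except 1 can be raised, and the position then decreases, so the
      induction hypothesis applies to the raised letter.\<close>
    have "\<forall>n<14. n \<noteq> 0 \<longrightarrow> e_table 1 n \<noteq> None \<or> e_table 2 n
      \<noteq> None" unfolding All_less_14 by (simp add: e_table_def)
    then obtain i where i: "i \<in> {1, 2}" "e_table i n \<noteq> None" using False less.prems by blast
    have "\<forall>n<14. \<forall>i\<in>{1,2}. \<forall>m. e_table i n = Some m \<longrightarrow> m
      < n" unfolding All_less_14 by (simp add: e_table_def)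
    then obtain m where m: "e_table i n = Some m" "m < n" using i less.prems by auto
    then have e: "B_et 1 i (adj ! n) = Some (adj ! m)" using B_et_adj[OF i(1) less.prems] by simp
    have c: "adj ! n \<in> carr Badj" using less.prems by (auto simp: Badj_carr adj_length)
    have "word_et Badj i ([adj ! n] @ replicate k el_1) = Some (T (add_ones k (adj ! m)))"
      using word_et_1[OF i(1), of "[adj ! n]" k] c e less m G2.phi_nonneg[OF i(1) c] by (simp add:
        Badj_simps)
    moreover have "add_ones k (adj ! n) \<in> Bset l"
      using add_ones_in_Bset[of "adj ! n" 1 k l] c assms(2) by (simp add: Bset_1 Badj_carr)
    ultimately show ?thesis
      using T_back[OF i(1) _ B_et_add_ones[OF i(1) e assms(2)], of "adj ! n # replicate k el_1"] c
        replicate_adj_words by simp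
  qed
qed

lemma T_letters:
  assumes "k + 1 \<le> l"
  shows "T (add_ones k el_2) = el_2 # replicate k el_1" "T (add_ones k el_0) = el_0 # replicate k el_1"
   "T (add_ones k el_2_3) = el_2_3 # replicate k el_1" "T (add_ones k el_1bar) = el_1bar #
     replicate k el_1"
  using T_letter[OF _ assms, of 1] T_letter[OF _ assms, of 6] T_letter[OF _ assms, of 4]
    T_letter[OF _ assms, of 13]
  unfolding el_adj by simp_all

text \<open>Descent from 2 \<otimes> 1 by f_1, f_2, f_2, f_2, f_1 through 2 \<otimes> 2, 2_1
  \<otimes> 2, 2_2 \<otimes> 2 and 3 \<otimes> 2 to 0 \<otimes> 2, always followed by k ones. Each
  use of \<open>lift\<close> is one step, with letters given by their positions.\<close>

lemma T_20:
  assumes "k + 2 \<le> l"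
  shows "T (add_ones k el_20) = el_0 # el_2 # replicate k el_1"
proof -
  have lift: "T (add_ones k (of_thirds b)) = adj ! m # adj ! n # replicate k el_1"
    if "i \<in> {1, 2}" "m < 14" "n < 14" "Bset_nat 2 b" "T (add_ones k (of_thirds b')) = adj ! m'
      # adj ! n' # replicate k el_1"
      "of_thirds b + e_shift i (of_thirds b) = of_thirds b'" "Bset_nat 2 b'"
      "(if phi_table i m \<ge> eps_table i n then e_table i m = Some m' \<and> n' = n else e_table
        i n = Some n' \<and> m' = m)"
    for i m n m' n' b b'
  proof -
    have c: "adj ! m \<in> carr Badj" "adj ! n \<in> carr Badj" using that(2,3) by (auto simp:
      Badj_carr adj_length)
    have "B_et 2 i (of_thirds b) = Some (of_thirds b')"
      using that(6,7) of_thirds_in_Bset[of b' 2] by (simp add: B_et_def)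
    then have "B_et l i (add_ones k (of_thirds b)) = Some (add_ones k (of_thirds b'))"
      using B_et_add_ones[OF that(1)] assms by blast
    moreover have "add_ones k (of_thirds b) \<in> Bset l"
      using add_ones_in_Bset[of "of_thirds b" 2 k l] that(4) of_thirds_in_Bset[of b 2] assms by blast
    moreover have "word_et Badj i ([adj ! m, adj ! n] @ replicate k el_1) = Some (T (add_ones k
      (of_thirds b')))"
      using word_et_1[OF that(1), of "[adj ! m, adj ! n]" k] c that(1,2,3,5,8) G2.phi_nonneg[OF
        that(1) c(1)] G2.phi_nonneg[OF that(1) c(2)]
      by (auto simp: Badj_simps B_et_adj B_eps_adj B_phi_adj split: if_splits)
    ultimately show ?thesis
      using T_back[OF that(1), of "add_ones k (of_thirds b)" "add_ones k (of_thirds b')" "[adj ! m,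
        adj ! n] @ replicate k el_1"]
        c replicate_adj_words by simp
  qed
  have "add_ones k (of_thirds (3,3,0,0,0,0)) = add_ones (Suc k) el_2" by (simp add: el_2_def)
  then have 1: "T (add_ones k (of_thirds (3,3,0,0,0,0))) = adj ! 1 # adj ! 0 # replicate k el_1"
    using T_letters(1)[of "Suc k"] assms by (simp add: el_adj)
  note sh = e_shift_def e1_shift_def e2_shift_def e_table_def eps_table_def phi_table_def
  have 2: "T (add_ones k (of_thirds (0,6,0,0,0,0))) = adj ! 1 # adj ! 1 # replicate k el_1"
    by (rule lift[OF _ _ _ _ 1, of 1]) (simp_all add: sh)
  have 3: "T (add_ones k (of_thirds (0,5,2,0,0,0))) = adj ! 2 # adj ! 1 # replicate k el_1"
    by (rule lift[OF _ _ _ _ 2, of 2]) (simp_all add: sh)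
  have 4: "T (add_ones k (of_thirds (0,4,4,0,0,0))) = adj ! 3 # adj ! 1 # replicate k el_1"
    by (rule lift[OF _ _ _ _ 3, of 2]) (simp_all add: sh)
  have 5: "T (add_ones k (of_thirds (0,3,6,0,0,0))) = adj ! 5 # adj ! 1 # replicate k el_1"
    by (rule lift[OF _ _ _ _ 4, of 2]) (simp_all add: sh)
  have 6: "T (add_ones k (of_thirds (0,3,3,3,0,0))) = adj ! 6 # adj ! 1 # replicate k el_1"
    by (rule lift[OF _ _ _ _ 5, of 1]) (simp_all add: sh)
  then show ?thesis by (simp add: el_20_def el_adj)
qed

end

section \<open>The images of the highest weight elements\<close>

lemma tensor_simps:
  "carr (tensor A B) = carr A \<times> carr B"
  "et (tensor A B) i (a, b) = (if phi A i a \<ge> eps B i b then map_option (\<lambda>a'. (a', b))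
    (et A i a)
                      else map_option (\<lambda>b'. (a, b')) (et B i b))"
  "eps (tensor A B) i (a, b) = max (eps A i a) (eps B i b - phi A i a + eps A i a)"
  "phi (tensor A B) i (a, b) = max (phi B i b) (phi A i a + phi B i b - eps B i b)"
  by (simp_all add: tensor_def)

lemma el_neq: "el_1 \<noteq> el_empty" "el_2 \<noteq> el_empty" "el_2_3 \<noteq> el_empty" "el_0
  \<noteq> el_empty" "el_1bar \<noteq> el_empty"
  "add_ones k el_0 \<noteq> add_ones m el_empty"
  by (auto simp: el_1_def el_2_def el_2_3_def el_0_def el_1bar_def el_empty_def)

lemma realizes_nonneg:
  assumes "realizes A \<tau>" "i \<in> {1, 2}" "a \<in> carr A"
  shows "eps A i a \<ge> 0"
  using realizesD[OF assms] G2.word_eps_nonneg[OF assms(2), of "\<tau> a"] by metis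

lemma tensor_highest:
  assumes "eps (tensor A B) i (a, b) = 0" "eps A i a \<ge> 0"
  shows "eps A i a = 0" "eps B i b \<le> phi A i a"
  using assms unfolding tensor_simps by linarith+

locale R_matrix = rows l T for l T +
  fixes R :: "coords \<times> coords \<Rightarrow> coords \<times> coords"
  assumes l: "l \<ge> 1"
    and R: "crystal_iso {0, 1, 2} (tensor (Bcr l) (Bcr 1)) (tensor (Bcr 1) (Bcr l)) R"
begin

abbreviation "src \<equiv> tensor (Bcr l) (Bcr 1)"
abbreviation "tgt \<equiv> tensor (Bcr 1) (Bcr l)"

definition src_word :: "coords \<times> coords \<Rightarrow> coords list" where
  "src_word = (\<lambda>(a, b). T a @ word_of b)"

definition tgt_word :: "coords \<times> coords \<Rightarrow> coords list" where
  "tgt_word = (\<lambda>(a, b). word_of a @ T b)"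

lemma src_real: "realizes src src_word"
  unfolding src_word_def by (rule realizes_tensor[OF T_word realizes_word_of])

lemma tgt_real: "realizes tgt tgt_word"
  unfolding tgt_word_def by (rule realizes_tensor[OF realizes_word_of T_word])

lemma nonneg:
  assumes "i \<in> {1, 2}"
  shows "b \<in> Bset l \<Longrightarrow> B_eps l i b \<ge> 0" "b \<in> Bset 1 \<Longrightarrow>
    B_eps 1 i b \<ge> 0"
  using realizes_nonneg[OF T_word assms, of b] realizes_nonneg[OF realizes_word_of assms, of b]
  by (simp_all only: Bcr_simps)

text \<open>The first factor must be highest, hence empty or 1, and its phi_i bound eps_i of the
  second. For an empty first factor the bounds are 0 and only powers of 1 survive.\<close>

lemma tgt_highest:
  assumes t: "t \<in> carr tgt" and e: "eps tgt 1 t = 0" "eps tgt 2 t = 0"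
  shows "(\<exists>k. t = (el_empty, add_ones k el_empty)) \<or>
    (\<exists>k g. t = (el_1, add_ones k g) \<and> g \<in> {el_empty, el_2, el_0, el_20, el_2_3,
      el_1bar})"
proof -
  obtain p c where pc: "t = (p, c)" "p \<in> Bset 1" "c \<in> Bset l"
    using t by (auto simp: tensor_simps Bcr_simps)
  have p: "B_eps 1 1 p = 0" "B_eps 1 2 p = 0"
    and c: "B_eps l 1 c \<le> B_phi 1 1 p" "B_eps l 2 c \<le> B_phi 1 2 p"
    using tensor_highest[OF e(1)[unfolded pc(1)]] tensor_highest[OF e(2)[unfolded pc(1)]]
      nonneg(2)[of 1, OF _ pc(2)] nonneg(2)[of 2, OF _ pc(2)] unfolding Bcr_simps by simp_all
  have "p = el_empty \<or> p = el_1"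
    using pc(2) p highest_letter[of p] by (auto simp: Bset_1 Badj_carr Badj_simps)
  then show ?thesis
  proof
    assume p: "p = el_empty"
    then have "B_eps l 1 c = 0" "B_eps l 2 c = 0"
      using c nonneg(1)[of 1, OF _ pc(3)] nonneg(1)[of 2, OF _ pc(3)] by (auto simp: B_eps_empty)
    moreover from this obtain k g where "c = add_ones k g" "g \<in> {el_empty, el_2, el_0, el_20,
      el_2_3, el_1bar}"
      using small_highest[OF pc(3)] by auto
    ultimately show ?thesis using p pc(1) by (auto simp: add_ones_eps_phi)
  next
    assume p: "p = el_1"
    then have "B_eps l 1 c \<le> 1" "B_eps l 2 c = 0"
      using c nonneg(1)[of 2, OF _ pc(3)] letter_phi_eps(1-4) by (auto simp: Badj_simps)
    then show ?thesis using small_highest[OF pc(3)] p pc(1) by auto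
  qed
qed

text \<open>After [1^j] the letter must satisfy eps_1 \<le> j and eps_2 = 0. Position 8 is 3bar, the
  only such letter with eps_1 = 2.\<close>

lemma src_highest:
  assumes x: "x \<in> carr src" and e: "eps src 1 x = 0" "eps src 2 x = 0"
  shows "\<exists>j b. x = (add_ones j el_empty, b) \<and> j \<le> l \<and> (b \<in> {el_empty,
    el_1} \<or>
    j \<ge> 1 \<and> b \<in> {el_2, el_2_3, el_0, el_1bar} \<or> j \<ge> 2 \<and> b = adj ! 8)"
proof -
  obtain a b where ab: "x = (a, b)" "a \<in> Bset l" "b \<in> Bset 1"
    using x by (auto simp: tensor_simps Bcr_simps)
  have a: "B_eps l 1 a = 0" "B_eps l 2 a = 0"
    and b: "B_eps 1 1 b \<le> B_phi l 1 a" "B_eps 1 2 b \<le> B_phi l 2 a"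
    using tensor_highest[OF e(1)[unfolded ab(1)]] tensor_highest[OF e(2)[unfolded ab(1)]]
      nonneg(1)[of 1, OF _ ab(2)] nonneg(1)[of 2, OF _ ab(2)] unfolding Bcr_simps by simp_all
  obtain j g where "a = add_ones j g" "g \<in> {el_empty, el_2, el_0, el_20, el_2_3, el_1bar}"
    using small_highest[OF ab(2)] a by auto
  then have j: "a = add_ones j el_empty" using a by (auto simp: add_ones_eps_phi)
  then have "j \<le> l" using ab(2) add_ones_le by auto
  have b': "B_eps 1 1 b \<le> int j" "B_eps 1 2 b \<le> 0" using b j by (auto simp: add_ones_eps_phi)
  have "b \<in> {el_empty, el_1} \<or> j \<ge> 1 \<and> b \<in> {el_2, el_2_3, el_0, el_1bar} \<or>
    j \<ge> 2 \<and> b = adj ! 8"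
  proof (cases "b = el_empty")
    case False
    then obtain n where n: "n < 14" "b = adj ! n" using ab(3) by (auto simp: Bset_1 adj_nth)
    have *: "\<forall>n<14. eps_table 1 n \<le> int j \<longrightarrow> eps_table 2 n \<le> 0
      \<longrightarrow>
      n = 0 \<or> j \<ge> 1 \<and> n \<in> {1, 4, 6, 13} \<or> j \<ge> 2 \<and> n = 8"
      unfolding All_less_14 by (simp add: eps_table_def)
    have "n = 0 \<or> j \<ge> 1 \<and> n \<in> {1, 4, 6, 13} \<or> j \<ge> 2 \<and> n = 8"
      using b' *[rule_format, OF n(1)] by (simp add: n B_eps_adj)
    then show ?thesis unfolding n(2) el_adj by auto
  qed simp
  then show ?thesis using ab(1) j \<open>j \<le> l\<close> by blast
qed

section \<open>Values of \<open>R\<close> determined by weight, eps_0 and e_0\<close>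

lemma R_carr: "x \<in> carr src \<Longrightarrow> R x \<in> carr tgt"
  by (rule crystal_isoD(1)[OF R, of 0]) simp_all

lemma R_eps: "x \<in> carr src \<Longrightarrow> i \<in> {0, 1, 2} \<Longrightarrow> eps tgt i (R
  x) = eps src i x"
  by (rule crystal_isoD(2)[OF R])

lemma R_phi: "x \<in> carr src \<Longrightarrow> i \<in> {0, 1, 2} \<Longrightarrow> phi tgt i (R
  x) = phi src i x"
  by (rule crystal_isoD(3)[OF R])

lemma R_et: "x \<in> carr src \<Longrightarrow> i \<in> {0, 1, 2} \<Longrightarrow> et tgt i (R x)
  = map_option R (et src i x)"
  by (rule crystal_isoD(4)[OF R])

lemma R_inj: "x \<in> carr src \<Longrightarrow> y \<in> carr src \<Longrightarrow> R x = R y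
  \<Longrightarrow> x = y"
  using R unfolding crystal_iso_def bij_betw_def inj_on_def by blast

text \<open>The candidates of \<open>tgt_highest\<close> with their phi_1, phi_2 and eps_0.
  Inserting the values of a concrete source element leaves one disjunct by arithmetic, or two in the
  ambiguous cases. The value phi_2 = 2 occurs for \<open>el_2_3\<close> alone, so its disjunct
  carries no eps_0.\<close>

lemma R_possible:
  assumes x: "x \<in> carr src" and e: "eps src 1 x = 0" "eps src 2 x = 0"
    and F: "F1 = phi src 1 x" "F2 = phi src 2 x" "E = eps src 0 x"
  shows "\<exists>k. R x = (el_empty, add_ones k el_empty) \<and> F1 = int k \<and> F2 = 0 \<and> E
    = int l + int k \<or>
    R x = (el_1, add_ones k el_empty) \<and> F1 = int k + 1 \<and> F2 = 0 \<and> E = int l + int k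
      + 2 \<or>
    R x = (el_1, add_ones k el_2) \<and> F1 = int k \<and> F2 = 3 \<and> E = int l + int k + 2 \<or>
    R x = (el_1, add_ones k el_0) \<and> F1 = int k + 1 \<and> F2 = 0 \<and> E = int l + int k + 1 \<or>
    R x = (el_1, add_ones k el_20) \<and> F1 = int k \<and> F2 = 3 \<and> E = int l + int k + 1
      \<and> k + 2 \<le> l \<or>
    R x = (el_1, add_ones k el_2_3) \<and> F1 = int k \<and> F2 = 2 \<or>
    R x = (el_1, add_ones k el_1bar) \<and> F1 = int k \<and> F2 = 0 \<and>
      E = (if k = 0 then int l + 1 else int l + int k - 1) \<and> k + 1 \<le> l"
proof -
  note t = R_carr[OF x]
  have eF: "eps tgt 1 (R x) = 0" "eps tgt 2 (R x) = 0" "phi tgt 1 (R x) = F1" "phi tgt 2 (R x) = F2"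
    "eps tgt 0 (R x) = E"
    unfolding F using R_eps[OF x, of 1] R_eps[OF x, of 2] R_eps[OF x, of 0] R_phi[OF x, of 1]
      R_phi[OF x, of 2] e
    by simp_all
  have ph: "B_phi 1 1 el_empty = 0" "B_phi 1 2 el_empty = 0" "B_phi 1 1 el_1 = 1" "B_phi 1 2 el_1 = 0"
    using B_eps_empty(2)[of 1 1] B_eps_empty(2)[of 2 1] letter_phi_eps(1-4) by (simp_all add:
      Badj_simps)
  show ?thesis using tgt_highest[OF t eF(1,2)]
  proof (elim disjE exE conjE)
    fix k assume "R x = (el_empty, add_ones k el_empty)"
    note R = this
    note * = eF(3-5)[unfolded R tensor_simps Bcr_simps, symmetric]
    have "F1 = int k" "F2 = 0" "E = int l + int k"
      unfolding * using l by (simp_all add: ph add_ones_eps_phi eps_0_add_ones eps_0_letters)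
    then show ?thesis using R by (intro exI[of _ k]) simp
  next
    fix k g assume R: "R x = (el_1, add_ones k g)" and g: "g \<in> {el_empty, el_2, el_0, el_20,
      el_2_3, el_1bar}"
    have c: "add_ones k g \<in> Bset l" using t unfolding R by (simp add: tensor_simps Bcr_simps)
    note * = eF(3-5)[unfolded R tensor_simps Bcr_simps, symmetric]
    note val = ph add_ones_eps_phi eps_0_add_ones eps_0_letters
    from g consider "g = el_empty" | "g = el_2" | "g = el_0" | "g = el_20" | "g = el_2_3" | "g =
      el_1bar" by blast
    then show ?thesis
    proof cases
      case 1
      have "F1 = int k + 1" "F2 = 0" "E = int l + int k + 2"
        unfolding * 1 by (simp_all add: val)
      then show ?thesis using R 1 by (intro exI[of _ k]) simp
    next
      case 2
      have "F1 = int k" "F2 = 3" "E = int l + int k + 2"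
        unfolding * 2 by (simp_all add: val)
      then show ?thesis using R 2 by (intro exI[of _ k]) simp
    next
      case 3
      have "F1 = int k + 1" "F2 = 0" "E = int l + int k + 1"
        unfolding * 3 using l by (simp_all add: val)
      then show ?thesis using R 3 by (intro exI[of _ k]) simp
    next
      case 4
      have "F1 = int k" "F2 = 3" "E = int l + int k + 1"
        unfolding * 4 using l by (simp_all add: val)
      moreover have "k + 2 \<le> l" using add_ones_le(4) c 4 by blast
      ultimately show ?thesis using R 4 by (intro exI[of _ k]) simp
    next
      case 5
      have "F1 = int k" "F2 = 2"
        unfolding * 5 by (simp_all add: val)
      then show ?thesis using R 5 by (intro exI[of _ k]) simp
    next
      case 6
      \<comment> \<open>The tensor rule gives eps_0 = max 2 (eps_0(c) + 2). If k > 0, the bound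
        forces l \<ge> 2, so l + k - 3 \<ge> 0 and the second entry wins.\<close>
      have k: "k + 1 \<le> l" using add_ones_le(6) c 6 by blast
      have "F1 = int k" "F2 = 0" "E = (if k = 0 then int l + 1 else int l + int k - 1)"
        unfolding * 6 using k by (auto simp: val)
      then show ?thesis using R 6 k by (intro exI[of _ k]) simp
    qed
  qed
qed

lemma src_mem:
  assumes "j \<le> l" "b \<in> Bset 1"
  shows "(add_ones j el_empty, b) \<in> carr src"
  using assms add_ones_in_Bset[of el_empty 0 j l] of_thirds_in_Bset[of "(0,0,0,0,0,0)" 0]
  by (simp add: tensor_simps Bcr_simps el_empty_def)

lemma letters_in: "el_empty \<in> Bset 1" "el_1 \<in> Bset 1" "el_2 \<in> Bset 1" "el_2_3 \<in>
  Bset 1" "el_0 \<in> Bset 1"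
   "el_1bar \<in> Bset 1" "adj ! 8 \<in> Bset 1"
  using el_in by (auto simp: Bset_1 Badj_carr adj_length)

lemma letter_data:
  "B_eps 1 1 el_empty = 0" "B_eps 1 2 el_empty = 0" "B_phi 1 1 el_empty = 0" "B_phi 1 2 el_empty = 0"
  "B_eps 1 1 el_1 = 0" "B_eps 1 2 el_1 = 0" "B_phi 1 1 el_1 = 1" "B_phi 1 2 el_1 = 0"
  "B_eps 1 1 el_2 = 1" "B_eps 1 2 el_2 = 0" "B_phi 1 1 el_2 = 0" "B_phi 1 2 el_2 = 3"
  "B_eps 1 1 el_2_3 = 1" "B_eps 1 2 el_2_3 = 0" "B_phi 1 1 el_2_3 = 0" "B_phi 1 2 el_2_3 = 2"
  "B_eps 1 1 el_0 = 1" "B_eps 1 2 el_0 = 0" "B_phi 1 1 el_0 = 1" "B_phi 1 2 el_0 = 0"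
  "B_eps 1 1 el_1bar = 1" "B_eps 1 2 el_1bar = 0" "B_phi 1 1 el_1bar = 0" "B_phi 1 2 el_1bar = 0"
  "B_eps 1 1 (adj ! 8) = 2" "B_eps 1 2 (adj ! 8) = 0" "B_phi 1 1 (adj ! 8) = 0" "B_phi 1 2 (adj !
    8) = 3"
  by (simp_all add: B_eps_empty) (simp_all add: el_adj B_eps_adj B_phi_adj eps_table_def phi_table_def)

lemmas src_data = tensor_simps Bcr_simps add_ones_eps_phi letter_data eps_0_add_ones eps_0_letters
  eps_0_3bar phi_0_add_ones

lemma R_2_3: "1 \<le> j \<Longrightarrow> j \<le> l \<Longrightarrow> R (add_ones j el_empty,
  el_2_3) = (el_1, add_ones (j - 1) el_2_3)"
  using R_possible[OF src_mem[OF _ letters_in(4)] _ _ refl refl refl, of j] by (auto simp: src_data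
    add_ones_inj)

text \<open>On [1^j] \<otimes> 2 one has eps_0 = max (l + j) (2 j + 1), which exceeds l + j exactly
  for j = l. This decides between \<open>el_2\<close> and \<open>el_20\<close>.\<close>

lemma R_2_l: "R (add_ones l el_empty, el_2) = (el_1, add_ones (l - 1) el_2)"
  using R_possible[OF src_mem[OF _ letters_in(3)] _ _ refl refl refl, of l] l by (auto simp:
    src_data add_ones_inj)

lemma R_2: "1 \<le> j \<Longrightarrow> j < l \<Longrightarrow> R (add_ones j el_empty, el_2) =
  (el_1, add_ones (j - 1) el_20)"
  using R_possible[OF src_mem[OF _ letters_in(3)] _ _ refl refl refl, of j] by (auto simp: src_data
    add_ones_inj)

lemma R_3bar: "2 \<le> j \<Longrightarrow> j \<le> l \<Longrightarrow> R (add_ones j el_empty, adj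
  ! 8) = (el_1, add_ones (j - 2) el_2)"
  using R_possible[OF src_mem[OF _ letters_in(7)] _ _ refl refl refl, of j] by (auto simp: src_data
    add_ones_inj)

lemma R_1bar: "2 \<le> j \<Longrightarrow> j \<le> l \<Longrightarrow> R (add_ones j el_empty,
  el_1bar) = (el_1, add_ones (j - 2) el_empty)"
  using R_possible[OF src_mem[OF _ letters_in(6)] _ _ refl refl refl, of j] by (auto simp: src_data
    add_ones_inj split: if_splits)

lemma R_1bar_1: "R (add_ones 1 el_empty, el_1bar) = (el_1, add_ones 0 el_1bar)"
  using R_possible[OF src_mem[OF _ letters_in(6)] _ _ refl refl refl, of 1] l by (auto simp:
    src_data add_ones_inj split: if_splits)

lemma R_1_l: "R (add_ones l el_empty, el_1) = (el_1, add_ones l el_empty)"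
  using R_possible[OF src_mem[OF _ letters_in(2)] _ _ refl refl refl, of l] l by (auto simp:
    src_data add_ones_inj split: if_splits)

lemma R_1: "j + 1 < l \<Longrightarrow> R (add_ones j el_empty, el_1) = (el_1, add_ones (j + 1)
  el_1bar)"
  using R_possible[OF src_mem[OF _ letters_in(2)] _ _ refl refl refl, of j] l by (auto simp:
    src_data add_ones_inj split: if_splits)

lemma R_empty_l: "R (add_ones l el_empty, el_empty) = (el_1, add_ones (l - 1) el_empty)"
  using R_possible[OF src_mem[OF _ letters_in(1)] _ _ refl refl refl, of l] l
  by (auto simp: src_data add_ones_inj split: if_splits)

text \<open>On 1 \<otimes> c the operator e_0 either keeps the first factor 1 or turns it into the
  empty tableau and leaves c unchanged. Neither yields a power of 1 behind an empty factor if c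
  contains the letter 0.\<close>

lemma R_not_el_0:
  assumes x: "x \<in> carr src" and y: "et src 0 x = Some y" "R y = (el_empty, add_ones k el_empty)"
    and "R x = (el_1, add_ones m el_0)"
  shows False
  using R_et[OF x, of 0] y assms(4) el_neq by (auto simp: tensor_simps split: if_splits)

text \<open>The rival value 1 \<otimes> \<open>add_ones (j - 1) el_0\<close> has the same weight and
  eps_0. It does not exist for j = 0; for larger j, e_0 removes a 1 from the first source factor,
  and the induction hypothesis refutes it through \<open>R_not_el_0\<close>.\<close>

lemma R_empty: "j < l \<Longrightarrow> R (add_ones j el_empty, el_empty) = (el_empty, add_ones j
  el_empty)"
proof (induction j)
  case 0
  then show ?case
    using R_possible[OF src_mem[OF _ letters_in(1)] _ _ refl refl refl, of 0] l
    by (auto simp: src_data add_ones_inj simp del: add_ones_0 split: if_splits)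
next
  case (Suc j)
  have x: "(add_ones (Suc j) el_empty, el_empty) \<in> carr src" using src_mem[OF _ letters_in(1)]
    Suc.prems by simp
  have "et src 0 (add_ones (Suc j) el_empty, el_empty) = Some (add_ones j el_empty, el_empty)"
    using e0_empty[of j l, unfolded Suc_eq_plus1[symmetric]] Suc.prems by (simp add: src_data)
  then have "R (add_ones (Suc j) el_empty, el_empty) \<noteq> (el_1, add_ones m el_0)" for m
    using R_not_el_0[OF x] Suc by fastforce
  then show ?case
    using R_possible[OF x _ _ refl refl refl] Suc.prems l
    by (auto simp: src_data add_ones_inj split: if_splits)
qed

text \<open>Since phi_0([1^(l-1)]) = 1 < 2 = eps_0(1), e_0 turns the second factor into the empty
  tableau, and \<open>R_empty\<close> gives the image of the result.\<close>

lemma R_1_empty: "R (add_ones (l - 1) el_empty, el_1) = (el_empty, add_ones l el_empty)"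
proof -
  have x: "(add_ones (l - 1) el_empty, el_1) \<in> carr src" using src_mem[OF _ letters_in(2)] by simp
  have "et src 0 (add_ones (l - 1) el_empty, el_1) = Some (add_ones (l - 1) el_empty, el_empty)"
    using e0_el_1 l by (simp add: src_data add_ones_inj)
  then have "R (add_ones (l - 1) el_empty, el_1) \<noteq> (el_1, add_ones m el_0)" for m
    using R_not_el_0[OF x _ R_empty] l by fastforce
  then show ?thesis
    using R_possible[OF x _ _ refl refl refl] l
    by (auto simp: src_data add_ones_inj split: if_splits)
qed

text \<open>The rival value, [1^j] behind an empty factor, is already the image of another element:
  of \<open>(add_ones j el_empty, el_empty)\<close> if j < l, and of
  \<open>(add_ones (l - 1) el_empty, el_1)\<close> if j = l.\<close>

lemma R_0:
  assumes "1 \<le> j" "j \<le> l"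
  shows "R (add_ones j el_empty, el_0) = (el_1, add_ones (j - 1) el_0)"
proof -
  have x: "(add_ones j el_empty, el_0) \<in> carr src" using src_mem[OF _ letters_in(5)] assms by simp
  have "R (add_ones j el_empty, el_0) \<noteq> (el_empty, add_ones j el_empty)"
  proof (cases "j < l")
    case True
    then show ?thesis
      using R_inj[OF x src_mem[OF _ letters_in(1)], of j] R_empty el_neq by force
  next
    case False
    then show ?thesis
      using R_inj[OF x src_mem[OF _ letters_in(2)], of "l - 1"] R_1_empty assms
      by (force simp: el_1_def el_0_def)
  qed
  then show ?thesis
    using R_possible[OF x _ _ refl refl refl] assms
    by (auto simp: src_data add_ones_inj split: if_splits)
qed

end

section \<open>Highest weight words\<close>

lemma crystal_iso_inv_into:
  assumes h: "crystal_iso I A B h"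
    and closed: "\<And>i a a'. i \<in> I \<Longrightarrow> a \<in> carr A \<Longrightarrow> et A i
      a = Some a' \<or> ft A i a = Some a' \<Longrightarrow> a' \<in> carr A"
  shows "crystal_iso I B A (inv_into (carr A) h)"
  unfolding crystal_iso_def
proof (intro conjI ballI)
  have bij: "bij_betw h (carr A) (carr B)" using h by (simp add: crystal_iso_def)
  then show "bij_betw (inv_into (carr A) h) (carr B) (carr A)" by (rule bij_betw_inv_into)
  fix i b assume i: "i \<in> I" and b: "b \<in> carr B"
  define a where "a = inv_into (carr A) h b"
  have a: "a \<in> carr A" "h a = b"
    using bij b unfolding a_def by (auto simp: bij_betw_def inv_into_into f_inv_into_f)
  note D = crystal_isoD[OF h i a(1), unfolded a(2)]
  have inv: "inv_into (carr A) h (h a') = a'" if "a' \<in> carr A" for a'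
    using bij that by (simp add: bij_betw_def)
  show "eps A i (inv_into (carr A) h b) = eps B i b" "phi A i (inv_into (carr A) h b) = phi B i b"
    using D by (simp_all add: a_def[symmetric])
  show "et A i (inv_into (carr A) h b) = map_option (inv_into (carr A) h) (et B i b)"
    using D(4) closed[OF i a(1)] inv by (cases "et A i a") (simp_all add: a_def[symmetric])
  show "ft A i (inv_into (carr A) h b) = map_option (inv_into (carr A) h) (ft B i b)"
    using D(5) closed[OF i a(1)] inv by (cases "ft A i a") (simp_all add: a_def[symmetric])
qed

lemma Bgen_step:
  assumes "v \<in> Bgen_set w" "i \<in> {1, 2}" "word_et Badj i v = Some u \<or> word_ft Badj i v =
    Some u"
  shows "u \<in> Bgen_set w"
  using assms G2.component_step unfolding Bgen_set_def by blast

lemma Bgen_iso_pmorph: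
  assumes h: "crystal_iso {1, 2} (Bgen v) (Bgen w) h" and "v \<in> adj_words" "w \<in> adj_words"
  shows "G2.pmorph (apply_at (Bgen_set v) h k m)"
proof (rule G2.pmorph_apply_at)
  show "Bgen_set v \<subseteq> adj_words" using Bgen_adj_words[OF _ assms(2)] by blast
  show "\<And>i u u'. i \<in> {1, 2} \<Longrightarrow> u \<in> Bgen_set v \<Longrightarrow> word_ft
    Badj i u = Some u' \<Longrightarrow> u' \<in> Bgen_set v"
    using Bgen_step by blast
  show "h u \<in> adj_words" if "u \<in> Bgen_set v" for u
    using crystal_isoD(1)[OF h, of 1 u] that Bgen_adj_words[OF _ assms(3)] by (simp add: Bgen_simps)
  show "word_eps Badj i (h u) = word_eps Badj i u" "word_phi Badj i (h u) = word_phi Badj i u"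
    "word_ft Badj i (h u) = map_option h (word_ft Badj i u)" if "i \<in> {1, 2}" "u \<in> Bgen_set
      v" for i u
    using crystal_isoD(2,3,5)[OF h that(1), of u] that(2) by (simp_all only: Bgen_simps)
qed

text \<open>Restrictions of the identity turn the case conditions of the algorithm into partial morphisms.\<close>

lemma pmorph_filter:
  assumes "v \<in> adj_words"
  shows "G2.pmorph (apply_at (Bgen_set v) id k m)"
proof (rule G2.pmorph_apply_at)
  show "Bgen_set v \<subseteq> adj_words" using Bgen_adj_words[OF _ assms] by blast
  show "\<And>i u u'. i \<in> {1, 2} \<Longrightarrow> u \<in> Bgen_set v \<Longrightarrow> word_ft
    Badj i u = Some u' \<Longrightarrow> u' \<in> Bgen_set v"
    using Bgen_step by blast
  show "id u \<in> adj_words" if "u \<in> Bgen_set v" for u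
    using that Bgen_adj_words[OF _ assms] by simp
qed (auto simp: option.map_id0 option.map_ident)

section \<open>The action of \<open>\<eta>\<close> and \<open>\<theta>\<close> on highest weight
  words\<close>

lemma pair_class_highest: "pair_class [el_1, el_1] = 0" "pair_class [el_1, el_2] = 1" "pair_class
  [el_1, el_2_3] = 4"
  "pair_class [el_1, el_0] = 6" "pair_class [el_1, el_1bar] = 13"
  using pair_class_el_1[of 0] pair_class_el_1[of 1] pair_class_el_1[of 4] pair_class_el_1[of 6]
    pair_class_el_1[of 13]
  by (simp_all add: el_adj)

lemma second_highest:
  assumes "b \<in> carr Badj" "eps Badj 1 b \<le> 1" "eps Badj 2 b \<le> 0" "pair_class [el_1, b] =
    pair_class [el_1, g]"
    and "g \<in> {el_2, el_2_3}"
  shows "b = g"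
proof -
  obtain n where n: "n < 14" "b = adj ! n" using assms(1) by (auto simp: Badj_carr adj_nth)
  have *: "\<forall>n<14. eps_table 1 n \<le> 1 \<longrightarrow> eps_table 2 n \<le> 0
    \<longrightarrow>
    ([0, 1, 1, 1, 4, 1, 6, 4, 6, 4, 6, 6, 6, 13::nat] ! n = 1 \<longrightarrow> n = 1) \<and>
    ([0, 1, 1, 1, 4, 1, 6, 4, 6, 4, 6, 6, 6, 13::nat] ! n = 4 \<longrightarrow> n = 4)"
    unfolding All_less_14 by (simp add: eps_table_def)
  have e: "eps_table 1 n \<le> 1" "eps_table 2 n \<le> 0" using assms(2,3) n by (simp_all add:
    Badj_simps B_eps_adj)
  have pair_class: "pair_class [el_1, b] = [0, 1, 1, 1, 4, 1, 6, 4, 6, 4, 6, 6, 6, 13] ! n" using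
    pair_class_el_1[OF n(1)] n(2) by simp
  from assms(5) consider "g = el_2" | "g = el_2_3" by blast
  then show ?thesis
  proof cases
    case 1
    with pair_class assms(4) have "[0, 1, 1, 1, 4, 1, 6, 4, 6, 4, 6, 6, 6, 13::nat] ! n = 1" by
      (simp only: pair_class_highest)
    with *[rule_format, OF n(1) e] n(2) 1 show ?thesis by (simp only: el_adj)
  next
    case 2
    with pair_class assms(4) have "[0, 1, 1, 1, 4, 1, 6, 4, 6, 4, 6, 6, 6, 13::nat] ! n = 4" by
      (simp only: pair_class_highest)
    with *[rule_format, OF n(1) e] n(2) 2 show ?thesis by (simp only: el_adj)
  qed
qed

lemma shift_data:
  assumes "g \<in> {el_2, el_2_3}"
  shows "word_eps Badj 1 [el_1, el_1, g] = 0" "word_eps Badj 2 [el_1, el_1, g] = 0"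
    "word_phi Badj 1 [el_1, el_1, g] = 1" "word_phi Badj 2 [el_1, el_1, g] = phi Badj 2 g"
proof -
  have g: "eps Badj 1 g = 1" "eps Badj 2 g = 0" "phi Badj 1 g = 0" "phi Badj 2 g \<ge> 0"
    using assms by (auto simp: letter_phi_eps)
  show "word_eps Badj 1 [el_1, el_1, g] = 0" by (simp add: g letter_phi_eps)
  show "word_eps Badj 2 [el_1, el_1, g] = 0" using g(4) by (simp add: g(1-3) letter_phi_eps)
  show "word_phi Badj 1 [el_1, el_1, g] = 1" by (simp add: g letter_phi_eps)
  show "word_phi Badj 2 [el_1, el_1, g] = phi Badj 2 g" using g(4) by (simp add: g(1-3) letter_phi_eps)
qed

text \<open>The image is identified letter by letter: the first is a highest letter, the second is
  fixed by the class of the first pair, and the third by what eps and phi of the whole word leave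
  open.\<close>

lemma shift_highest:
  assumes h: "crystal_iso {1, 2} (Bgen [el_1, el_1, g]) (Bgen [el_1, g, el_1]) h"
    and g: "g \<in> {el_2, el_2_3}"
  shows "h [el_1, el_1, g] = [el_1, g, el_1]"
proof -
  have wd: "[el_1, el_1, g] \<in> adj_words" "[el_1, g, el_1] \<in> adj_words" using g el_in by auto
  define u where "u = h [el_1, el_1, g]"
  have c: "[el_1, el_1, g] \<in> carr (Bgen [el_1, el_1, g])" using Bgen_refl by (simp add: Bgen_simps)
  note D = crystal_isoD[OF h insertI1 c, folded u_def]
    crystal_isoD[OF h insertI2[OF singletonI] c, folded u_def]
  have u: "u \<in> Bgen_set [el_1, g, el_1]" using D(1) by (simp add: Bgen_simps)
  then have "u \<in> adj_words" "length u = 3" using Bgen_adj_words[OF _ wd(2)] Bgen_length[OF _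
    wd(2)] by simp_all
  then obtain a b d where abd: "u = [a, b, d]" "a \<in> carr Badj" "b \<in> carr Badj" "d \<in>
    carr Badj"
    by (auto simp: length_Suc_conv numeral_3_eq_3)
  have nn: "eps Badj i x \<ge> 0" if "x \<in> carr Badj" "i \<in> {1, 2}" for x i using
    G2.eps_nonneg that by blast
  have we: "word_eps Badj 1 u = 0" "word_eps Badj 2 u = 0"
    "word_phi Badj 1 u = 1" "word_phi Badj 2 u = phi Badj 2 g"
    using D(2,3,7,8) shift_data[OF g] unfolding Bgen_simps by (simp_all only:)
  have "eps Badj 1 a = 0" "eps Badj 2 a = 0"
    using we(1,2) nn[OF abd(2), of 1] nn[OF abd(2), of 2] unfolding abd(1) by (simp_all add:
      max_def split: if_splits)
  then have a: "a = el_1" using highest_letter abd(2) by blast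
  have "eps Badj 1 b \<le> 1" "eps Badj 2 b \<le> 0"
    using we(1,2) unfolding abd(1) a by (simp_all add: letter_phi_eps max_def split: if_splits)
  moreover have "pair_class [el_1, b] = pair_class [el_1, g]"
    using pair_class_subword[OF u wd(2), of 0] by (simp add: abd(1) a)
  ultimately have b: "b = g" using second_highest[OF abd(3)] g by blast
  have gd: "eps Badj 1 g = 1" "eps Badj 2 g = 0" "phi Badj 1 g = 0" "phi Badj 2 g \<ge> 0"
    using g by (auto simp: letter_phi_eps)
  note w = we[unfolded abd(1) a b word_eps.simps word_phi.simps gd(1-3) letter_phi_eps(1-4)]
  have d1: "eps Badj 1 d = 0"
    using w(1) nn[OF abd(4), of 1] by (simp split: split_max)
  have "eps Badj 2 d \<le> phi Badj 2 g" using w(2) gd(4) by (simp split: split_max)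
  then have "eps Badj 2 d = phi Badj 2 d" using w(4) gd(4) G2.phi_nonneg[OF insertI2[OF singletonI]
    abd(4)]
    by linarith
  moreover have "phi Badj 1 d = 1" using w(3) d1 G2.phi_nonneg[OF insertI1 abd(4)] by linarith
  moreover note d1
  ultimately have "d = el_1" using highest_weight_letter[OF abd(4)] by blast
  then show ?thesis using abd(1) a b by (simp add: u_def)
qed

text \<open>Each application carries \<open>g\<close> one place to the left past a 1. The number
  \<open>n\<close> of ones already passed is kept general for the induction.\<close>

lemma chain_highest:
  assumes "h [el_1, el_1, g] = [el_1, g, el_1]"
  shows "apply_chain (Bgen_set [el_1, el_1, g]) h 3 m (replicate (Suc m) el_1 @ [g] @ replicate n
    el_1) =
    Some ([el_1, g] @ replicate (m + n) el_1)"
proof (induction m arbitrary: n)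
  case (Suc m)
  have w: "replicate (Suc (Suc m)) el_1 @ [g] @ replicate n el_1 =
    replicate m el_1 @ [el_1, el_1, g] @ replicate n el_1"
    by (simp add: replicate_append_same[symmetric])
  have "apply_at (Bgen_set [el_1, el_1, g]) h 3 (Suc m) (replicate (Suc (Suc m)) el_1 @ [g] @
    replicate n el_1) =
    Some (replicate m el_1 @ [el_1, g, el_1] @ replicate n el_1)"
    unfolding w using Bgen_refl[of "[el_1, el_1, g]"] assms by (simp add: apply_at_def)
  also have "replicate m el_1 @ [el_1, g, el_1] @ replicate n el_1 =
    replicate (Suc m) el_1 @ [g] @ replicate (Suc n) el_1"
    by (simp add: replicate_append_same[symmetric])
  finally show ?case using Suc[of "Suc n"] by simp
qed simp

text \<open>
  The linear form with value \<open>-1\<close> on all shifts of \<open>e\<^sub>1\<close> and \<open>e\<^sub>2\<close>.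
\<close>

fun depth :: "coords \<Rightarrow> rat" where
  "depth (x1, x2, x3, y3, y2, y1) = x2 + 2 * x3 + 3 * y3 + 9 * y2 + 10 * y1"

section \<open>Climbing to highest weight elements\<close>

lemma depth_step:
  assumes "i \<in> {1, 2}" "B_et l i b = Some b'"
  shows "depth b' = depth b - 1"
proof -
  have "depth (b + s) = depth b + depth s" for s by (cases b; cases s) (simp add: algebra_simps)
  moreover have "depth (e_shift i b) = - 1"
    using assms(1) by (auto simp: e_shift_def e1_shift_def e2_shift_def)
  moreover have "b' = b + e_shift i b" using assms(2) by (auto simp: B_et_def split: if_splits)
  ultimately show ?thesis by simp
qed

lemma depth_nonneg: "b \<in> Bset l \<Longrightarrow> depth b \<ge> 0"
  by (auto elim!: Bset_of_thirds)

lemma realizes_tensor_length: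
  assumes "realizes A \<sigma>" "realizes B \<tau>" "i \<in> {1, 2}" "a \<in> carr A" "b \<in> carr B"
    and "et (tensor A B) i (a, b) = Some (a', b')"
  shows "length (\<sigma> a') = length (\<sigma> a) \<and> length (\<tau> b') = length (\<tau> b)"
  using assms(6) realizesD[OF assms(1,3,4)] realizesD[OF assms(2,3,5)]
    G2.word_et_SomeD[OF assms(3), of "\<sigma> a"] G2.word_et_SomeD[OF assms(3), of "\<tau> b"]
  by (auto simp: tensor_simps split: if_splits)

context R_matrix begin

text \<open>Raising lowers the total \<open>depth\<close> by 1 and so must stop. As \<open>R\<close>
  commutes with e_i, the climb is mirrored in the target, and reversed it is a joint path. The
  lengths are carried along to recover j and to tell which B_1-factors are empty.\<close>

lemma reach:
  assumes "x \<in> carr src"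
  shows "\<exists>h\<in>carr src. eps src 1 h = 0 \<and> eps src 2 h = 0 \<and>
    ((src_word h, tgt_word (R h)), (src_word x, tgt_word (R x))) \<in> G2.joint_f_step\<^sup>* \<and>
    length (T (fst h)) = length (T (fst x)) \<and> length (word_of (snd h)) = length (word_of (snd
      x)) \<and>
    length (word_of (fst (R h))) = length (word_of (fst (R x)))"
proof -
  obtain n where "depth (fst x) + depth (snd x) \<le> rat_of_nat n" by (meson real_arch_simple)
  then show ?thesis using assms
  proof (induction n arbitrary: x rule: nat_less_induct)
    case (1 n)
    show ?case
    proof (cases "eps src 1 x = 0 \<and> eps src 2 x = 0")
      case True
      then show ?thesis using 1(3) by blast
    next
      case False
      then obtain i where i: "i \<in> {1, 2}" "eps src i x \<noteq> 0" by blast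
      then have i0: "i \<in> {0, 1, 2}" by blast
      note W = realizesD[OF src_real i(1) 1(3)] and V = realizesD[OF tgt_real i(1) R_carr[OF 1(3)]]
      have "word_et Badj i (src_word x) \<noteq> None"
        using G2.word_et_None_iff[OF i(1) W(1)] W(2) i(2) by simp
      then obtain y where y: "et src i x = Some y" using W(4) by auto
      then have yc: "y \<in> carr src" using W(5) by blast
      have Ry: "et tgt i (R x) = Some (R y)" using R_et[OF 1(3) i0] y by simp
      obtain a b a' b' where ab: "x = (a, b)" "y = (a', b')" by (cases x, cases y) blast
      have abc: "a \<in> carr (Bcr l)" "b \<in> carr (Bcr 1)" using 1(3) ab by (simp_all add:
        tensor_simps)
      have "depth a' + depth b' = depth a + depth b - 1"
      proof (cases "B_eps 1 i b \<le> B_phi l i a")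
        case True
        then have "B_et l i a = Some a'" "b' = b" using y unfolding ab tensor_simps Bcr_simps by auto
        then show ?thesis using depth_step[OF i(1), of l a a'] by simp
      next
        case False
        then have "B_et 1 i b = Some b'" "a' = a" using y unfolding ab tensor_simps Bcr_simps by auto
        then show ?thesis using depth_step[OF i(1), of 1 b b'] by simp
      qed
      moreover have "depth a' \<ge> 0" "depth b' \<ge> 0"
        using yc unfolding ab tensor_simps Bcr_simps by (blast intro: depth_nonneg)+
      ultimately have n: "n - 1 < n" "depth (fst y) + depth (snd y) \<le> rat_of_nat (n - 1)"
        using 1(2) by (cases n; simp add: ab)+
      obtain h where h: "h \<in> carr src" "eps src 1 h = 0" "eps src 2 h = 0"
        "((src_word h, tgt_word (R h)), (src_word y, tgt_word (R y))) \<in> G2.joint_f_step\<^sup>*"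
        "length (T (fst h)) = length (T (fst y))" "length (word_of (snd h)) = length (word_of (snd y))"
        "length (word_of (fst (R h))) = length (word_of (fst (R y)))"
        using 1(1)[rule_format, OF n yc] by blast
      have "word_et Badj i (src_word x) = Some (src_word y)" "word_et Badj i (tgt_word (R x)) =
        Some (tgt_word (R y))"
        using W(4) V(4) y Ry by simp_all
      then have "((src_word y, tgt_word (R y)), (src_word x, tgt_word (R x))) \<in> G2.joint_f_step"
        using G2.word_et_SomeD[OF i(1) W(1)] G2.word_et_SomeD[OF i(1) V(1)] i(1) unfolding
          G2.joint_f_step_def by blast
      with h(4) have "((src_word h, tgt_word (R h)), (src_word x, tgt_word (R x))) \<in>
        G2.joint_f_step\<^sup>*"
        by (rule rtrancl_into_rtrancl)
      moreover have "length (T (fst y)) = length (T (fst x))" "length (word_of (snd y)) = length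
        (word_of (snd x))"
        using realizes_tensor_length[OF T_word realizes_word_of i(1) abc, of a' b'] y unfolding ab
          by simp_all
      moreover have "length (word_of (fst (R y))) = length (word_of (fst (R x)))"
        using realizes_tensor_length[OF realizes_word_of T_word i(1), of "fst (R x)" "snd (R x)"
          "fst (R y)" "snd (R y)"]
          R_carr[OF 1(3)] Ry by (cases "R x", cases "R y") (simp add: tensor_simps)
      ultimately show ?thesis using h by (intro bexI[of _ h]) simp_all
    qed
  qed
qed

end

section \<open>The algorithm\<close>

locale combinatorial_R = R_matrix l T R for l T R +
  fixes \<xi> \<eta> \<theta> :: "coords list \<Rightarrow> coords list"
  assumes \<xi>: "crystal_iso {1, 2} (Bgen [el_1, el_0]) (Bgen [el_1]) \<xi>"
    and \<eta>: "crystal_iso {1, 2} (Bgen [el_1, el_1, el_2]) (Bgen [el_1, el_2, el_1]) \<eta>"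
    and \<theta>: "crystal_iso {1, 2} (Bgen [el_1, el_1, el_2_3]) (Bgen [el_1, el_2_3, el_1]) \<theta>"
begin

abbreviation "\<xi>_at \<equiv> apply_at (Bgen_set [el_1, el_0]) \<xi> 2"
abbreviation "\<xi>_inv \<equiv> inv_into (Bgen_set [el_1, el_0]) \<xi>"
abbreviation "\<xi>_inv_at \<equiv> apply_at (Bgen_set [el_1]) \<xi>_inv 1"
abbreviation "\<eta>_chain \<equiv> apply_chain (Bgen_set [el_1, el_1, el_2]) \<eta> 3"
abbreviation "\<theta>_chain \<equiv> apply_chain (Bgen_set [el_1, el_1, el_2_3]) \<theta> 3"

lemma highest_words: "[el_1, el_0] \<in> adj_words" "[el_1] \<in> adj_words" "[el_1, el_1, el_2]
  \<in> adj_words" "[el_1, el_2, el_1] \<in> adj_words"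
   "[el_1, el_1, el_2_3] \<in> adj_words" "[el_1, el_2_3, el_1] \<in> adj_words" "[el_1, el_1]
     \<in> adj_words" "[el_1, el_2] \<in> adj_words"
   "[el_1, el_2_3] \<in> adj_words" "[el_1, el_1bar] \<in> adj_words"
  using el_in by auto

lemma \<xi>_inv_iso: "crystal_iso {1, 2} (Bgen [el_1]) (Bgen [el_1, el_0]) \<xi>_inv"
  using crystal_iso_inv_into[OF \<xi>, unfolded Bgen_simps] Bgen_step[of _ "[el_1, el_0]"] by blast

lemma pmorphs: "G2.pmorph (\<xi>_at m)" "G2.pmorph (\<xi>_inv_at m)" "G2.pmorph (\<eta>_chain m)"
  "G2.pmorph (\<theta>_chain m)"
  using Bgen_iso_pmorph[OF \<xi> highest_words(1,2)] Bgen_iso_pmorph[OF \<xi>_inv_iso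
    highest_words(2,1)]
    G2.pmorph_chain[OF Bgen_iso_pmorph[OF \<eta> highest_words(3,4)]]
    G2.pmorph_chain[OF Bgen_iso_pmorph[OF \<theta> highest_words(5,6)]] by blast+

lemma \<xi>_highest: "\<xi> [el_1, el_0] = [el_1]"
proof -
  have c: "[el_1, el_0] \<in> carr (Bgen [el_1, el_0])" using Bgen_refl by (simp add: Bgen_simps)
  note D = crystal_isoD[OF \<xi> insertI1 c, unfolded Bgen_simps]
    crystal_isoD[OF \<xi> insertI2[OF singletonI] c, unfolded Bgen_simps]
  have "\<xi> [el_1, el_0] \<in> adj_words" "length (\<xi> [el_1, el_0]) = 1"
    using Bgen_adj_words[OF D(1) highest_words(2)] Bgen_length[OF D(1) highest_words(2)] by simp_all
  then obtain c where c: "\<xi> [el_1, el_0] = [c]" "c \<in> carr Badj"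
    by (auto simp: length_Suc_conv One_nat_def)
  have "word_eps Badj 1 [el_1, el_0] = 0" "word_eps Badj 2 [el_1, el_0] = 0"
    by (simp_all add: letter_phi_eps)
  then have "word_eps Badj 1 [c] = 0" "word_eps Badj 2 [c] = 0" using D(2,7) c(1) by (simp_all only:)
  then have "eps Badj 1 c = 0" "eps Badj 2 c = 0"
    using G2.eps_nonneg[OF insertI1 c(2)] G2.eps_nonneg[OF insertI2[OF singletonI] c(2)] by simp_all
  then show ?thesis using highest_letter[OF c(2)] c(1) by simp
qed

lemma \<xi>_inv_highest: "\<xi>_inv [el_1] = [el_1, el_0]"
proof -
  have "inj_on \<xi> (Bgen_set [el_1, el_0])"
    using \<xi> by (simp add: crystal_iso_def bij_betw_def Bgen_simps)
  then show ?thesis using inv_into_f_f[OF _ Bgen_refl, of \<xi> "[el_1, el_0]"] \<xi>_highest by simp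
qed

lemma \<xi>_length: "u \<in> Bgen_set [el_1, el_0] \<Longrightarrow> length (\<xi> u) = 1"
  using crystal_isoD(1)[OF \<xi> insertI1, of u] Bgen_length[OF _ highest_words(2)] by (simp add:
    Bgen_simps)

lemma \<xi>_inv_length: "u \<in> Bgen_set [el_1] \<Longrightarrow> length (\<xi>_inv u) = 2"
  using crystal_isoD(1)[OF \<xi>_inv_iso insertI1, of u] Bgen_length[OF _ highest_words(1)] by
    (simp add: Bgen_simps)

lemmas \<eta>_highest = shift_highest[OF \<eta> insertI1]
lemmas \<theta>_highest = shift_highest[OF \<theta> insertI2[OF singletonI]]

text \<open>1 \<otimes> 3bar is f_1(1 \<otimes> 0), so \<open>\<xi>\<close> sends it to f_1(1) = 2.
  The result behind further ones is 1 \<otimes> 2, which is why this case continues with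
  \<open>\<eta>\<close>.\<close>

lemma el_3bar: "[el_1, adj ! 8] \<in> Bgen_set [el_1, el_0]" "\<xi> [el_1, adj ! 8] = [el_2]"
proof -
  have e: "et Badj 1 (adj ! 8) = Some el_0" "et Badj 1 el_2 = Some el_1"
    by (simp_all add: Badj_simps B_et_adj el_adj e_table_def)
  have d: "eps Badj 1 (adj ! 8) = 2" by (simp add: Badj_simps B_eps_adj eps_table_def)
  have w: "[el_1, adj ! 8] \<in> adj_words" "[el_2] \<in> adj_words" using el_in by (auto simp:
    Badj_carr adj_length)
  have et: "word_et Badj 1 [el_1, adj ! 8] = Some [el_1, el_0]"
    using e d G2.phi_nonneg[OF insertI1, of "adj ! 8"] w by (simp add: letter_phi_eps)
  then have ft: "word_ft Badj 1 [el_1, el_0] = Some [el_1, adj ! 8]"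
    using G2.word_et_SomeD[OF insertI1 w(1)] by blast
  then show mem: "[el_1, adj ! 8] \<in> Bgen_set [el_1, el_0]"
    using Bgen_step[OF Bgen_refl insertI1] by blast
  have "word_et Badj 1 [el_2] = Some [el_1]" using e by (simp add: letter_phi_eps)
  then have "word_ft Badj 1 [el_1] = Some [el_2]" using G2.word_et_SomeD[OF insertI1 w(2)] by blast
  moreover have "word_ft Badj 1 (\<xi> [el_1, el_0]) = map_option \<xi> (word_ft Badj 1 [el_1, el_0])"
    using crystal_isoD(5)[OF \<xi> insertI1, of "[el_1, el_0]"] Bgen_refl by (simp add: Bgen_simps)
  ultimately show "\<xi> [el_1, adj ! 8] = [el_2]" unfolding ft \<xi>_highest by simp
qed

lemma el_1_1bar: "i \<in> {1, 2} \<Longrightarrow> word_eps Badj i [el_1, el_1bar] = 0 \<and>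
  word_phi Badj i [el_1, el_1bar] = 0"
  by (auto simp: letter_phi_eps)

lemma word_of_letter: "b \<noteq> el_empty \<Longrightarrow> word_of b = [b]" "word_of el_empty = []"
  by (simp_all add: word_of_def)

lemma word_of_length: "length (word_of b) = length (word_of b') \<Longrightarrow> b = el_empty
  \<longleftrightarrow> b' = el_empty"
  by (auto simp: word_of_def split: if_splits)

lemma apply_at_last:
  assumes "length v = m"
  shows "apply_at D h 2 (Suc m) (v @ [a, b]) = (if [a, b] \<in> D then Some (v @ h [a, b]) else None)"
  using assms by (simp add: apply_at_def)

lemma apply_at_first: "apply_at D h 1 1 (a # v) = (if [a] \<in> D then Some (h [a] @ v) else None)"
  by (simp add: apply_at_def One_nat_def)

end

text \<open>All eps_i and phi_i vanish, so no operator leaves this word.\<close>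

lemma Bgen_singlet: "v \<in> Bgen_set [el_1, el_1bar] \<Longrightarrow> v = [el_1, el_1bar]"
proof -
  assume v: "v \<in> Bgen_set [el_1, el_1bar]"
  have w: "[el_1, el_1bar] \<in> adj_words" using el_in by simp
  have none: "word_et Badj i [el_1, el_1bar] = None" "word_ft Badj i [el_1, el_1bar] = None"
    if "i \<in> {1, 2}" for i
    using G2.word_et_None_iff[OF that w] G2.word_ft_None_iff[OF that w] that
    by (auto simp: letter_phi_eps)
  from v[unfolded Bgen_set_def] w show ?thesis
  proof (induction rule: G2.component_induct)
    case (et i v u)
    then show ?case using none by simp
  next
    case (ft i v u)
    then show ?case using none G2.word_et_SomeD[of i u v] by simp
  qed simp
qed

context combinatorial_R begin

text \<open>One alternative for each kind of highest weight element and range of j. Results are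
  stated for the whole word \<open>p # c\<close>, which is what joint paths transport; its splitting
  into tableau entries is postponed.\<close>

lemma families:
  fixes b1 b2 :: coords and \<alpha>s :: "coords list"
  assumes b1: "b1 \<in> Bset l" "T b1 = rev \<alpha>s" and b2: "b2 \<in> Bset 1"
    and p: "p = fst (R (b1, b2))" and c: "c = T (snd (R (b1, b2)))"
    and j: "j = length \<alpha>s" and w: "w = rev \<alpha>s @ [b2]"
  obtains (empty_full) "b2 = el_empty" "j = l" "p # c = rev \<alpha>s"
  | (empty) "b2 = el_empty" "j < l" "p = el_empty" "c = rev \<alpha>s"
  | (one_full) "b2 \<noteq> el_empty" "j = 0 \<or> [hd \<alpha>s, b2] \<in> Bgen_set [el_1, el_1]"
    "j = l" "p # c = w"
  | (one_last) "b2 \<noteq> el_empty" "j = 0 \<or> [hd \<alpha>s, b2] \<in> Bgen_set [el_1, el_1]"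
    "j + 1 = l"
      "p = el_empty" "c = w"
  | (one) "b2 \<noteq> el_empty" "j = 0 \<or> [hd \<alpha>s, b2] \<in> Bgen_set [el_1, el_1]" "j +
    1 < l"
      "p # c = [el_1, el_1bar] @ w"
  | (two_full) "b2 \<noteq> el_empty" "j \<ge> 1" "[hd \<alpha>s, b2] \<in> Bgen_set [el_1, el_2]"
    "j = l"
      "\<eta>_chain (j - 1) w = Some (p # c)"
  | (two) "b2 \<noteq> el_empty" "j \<ge> 1" "[hd \<alpha>s, b2] \<in> Bgen_set [el_1, el_2]" "j < l"
      "Option.bind (\<eta>_chain (j - 1) w) (\<xi>_inv_at 1) = Some (p # c)" "c \<noteq> []"
  | (two_three) "b2 \<noteq> el_empty" "j \<ge> 1" "[hd \<alpha>s, b2] \<in> Bgen_set [el_1, el_2_3]"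
      "\<theta>_chain (j - 1) w = Some (p # c)"
  | (zero_one) "b2 \<noteq> el_empty" "j = 1" "[hd \<alpha>s, b2] \<in> Bgen_set [el_1, el_0]" "p #
    c = w"
  | (zero) u where "b2 \<noteq> el_empty" "j \<ge> 2" "[hd \<alpha>s, b2] \<in> Bgen_set [el_1, el_0]"
      "\<xi>_at j w = Some u" "take 2 (drop (j - 2) u) \<in> Bgen_set [el_1, el_1]"
      "\<xi>_inv_at 1 u = Some (p # c)"
  | (three) u where "b2 \<noteq> el_empty" "j \<ge> 2" "[hd \<alpha>s, b2] \<in> Bgen_set [el_1, el_0]"
      "\<xi>_at j w = Some u" "take 2 (drop (j - 2) u) \<in> Bgen_set [el_1, el_2]"
      "\<eta>_chain (j - 2) u = Some (p # c)"
  | (bar_one) "b2 \<noteq> el_empty" "j = 1" "hd \<alpha>s = el_1" "b2 = el_1bar" "p # c = w"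
  | (bar) "b2 \<noteq> el_empty" "j \<ge> 2" "hd \<alpha>s = el_1" "b2 = el_1bar" "w = (p # c) @
    [el_1, el_1bar]"
proof -
  note goals = that
  define x where "x = (b1, b2)"
  have "x \<in> carr src" using b1 b2 by (simp add: x_def tensor_simps Bcr_simps)
  from reach[OF this] obtain h where hc: "h \<in> carr src" and hh: "eps src 1 h = 0 \<and> eps src
    2 h = 0 \<and>
    ((src_word h, tgt_word (R h)), (src_word x, tgt_word (R x))) \<in> G2.joint_f_step\<^sup>* \<and>
    length (T (fst h)) = length (T (fst x)) \<and> length (word_of (snd h)) = length (word_of (snd
      x)) \<and>
    length (word_of (fst (R h))) = length (word_of (fst (R x)))" by (rule bexE)
  note h = hc hh[THEN conjunct1] hh[THEN conjunct2, THEN conjunct1]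
  note path = hh[THEN conjunct2, THEN conjunct2, THEN conjunct1]
  note len' = hh[THEN conjunct2, THEN conjunct2, THEN conjunct2]
  have len: "length (T (fst h)) = length (T b1)" "length (word_of (snd h)) = length (word_of b2)"
      "length (word_of (fst (R h))) = length (word_of p)"
    using len' by (simp_all add: x_def p)
  obtain k b where kb: "h = (add_ones k el_empty, b)" "k \<le> l" "b \<in> {el_empty, el_1} \<or>
    k \<ge> 1 \<and> b \<in> {el_2, el_2_3, el_0, el_1bar} \<or> k \<ge> 2 \<and> b = adj ! 8"
    using src_highest[OF h] by blast
  have "k = j" using len(1) T_empty[OF kb(2)] b1(2) j by (simp add: kb(1))
  with kb have hj: "h = (add_ones j el_empty, b)" "j \<le> l" and b: "b \<in> {el_empty, el_1} \<or>
    j \<ge> 1 \<and> b \<in> {el_2, el_2_3, el_0, el_1bar} \<or> j \<ge> 2 \<and> b = adj ! 8" by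
      simp_all
  have b_empty: "b2 = el_empty \<longleftrightarrow> b = el_empty" using word_of_length[OF len(2)]
    hj(1) by simp
  have p_empty: "p = el_empty \<longleftrightarrow> fst (R h) = el_empty" using word_of_length[OF
    len(3)] by simp
  have h_word: "src_word h = replicate j el_1 @ word_of b"
    by (simp add: src_word_def hj T_empty)
  have x_word: "src_word x = rev \<alpha>s @ word_of b2" by (simp add: src_word_def x_def b1)
  have R_word: "tgt_word (R x) = word_of p @ c" by (simp add: tgt_word_def x_def p c split_beta)
  have transfer: "F (src_word x) = Some (word_of p @ c)" if "G2.pmorph F" "F (src_word h) = Some
    (tgt_word (R h))" for F
    using G2.pmorph_joint_f_step[OF path that] R_word by simp
  note steps = G2.joint_f_step_fst[OF path]
  have tgt: "tgt_word (R h) = word_of q @ T d" if "R h = (q, d)" for q d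
    using that by (simp add: tgt_word_def)
  show thesis
  proof (cases "b = el_empty")
    case True
    then have e: "b2 = el_empty" "src_word x = rev \<alpha>s" "src_word h = replicate j el_1"
      using b_empty x_word h_word by (simp_all add: word_of_letter)
    show thesis
    proof (cases "j = l")
      case jl: True
      then have Rh: "R h = (el_1, add_ones (l - 1) el_empty)" using R_empty_l hj True by simp
      have "replicate j el_1 = el_1 # replicate (l - 1) el_1" using jl l by (cases l) auto
      then have "Some (src_word h) = Some (tgt_word (R h))"
        unfolding tgt[OF Rh] e(3) by (simp add: T_empty word_of_letter el_neq)
      from transfer[OF G2.pmorph_Some this] have "p # c = rev \<alpha>s"
        using p_empty e Rh el_neq by (simp add: word_of_letter)
      then show thesis using goals(1) e jl by blast
    next
      case jl: False
      then have Rh: "R h = (el_empty, add_ones j el_empty)" using R_empty[of j] hj True by simp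
      have "Some (src_word h) = Some (tgt_word (R h))"
        unfolding tgt[OF Rh] e(3) using hj by (simp add: T_empty word_of_letter)
      from transfer[OF G2.pmorph_Some this] have "c = rev \<alpha>s" "p = el_empty"
        using p_empty e Rh by (simp_all add: word_of_letter)
      then show thesis using goals(2) e jl hj(2) by simp
    qed
  next
    case False
    then have e: "b2 \<noteq> el_empty" "src_word x = w" "src_word h = replicate j el_1 @ [b]"
      using b_empty x_word h_word w by (simp_all add: word_of_letter)
    \<comment> \<open>\<alpha>_1 and \<beta> are the letters in positions j and j + 1. The filter
      for their component is defined at the top of the path, hence also at its end.\<close>
    have cond: "[hd \<alpha>s, b2] \<in> Bgen_set v" if "j \<ge> 1" "v \<in> adj_words" "[el_1, b]
      \<in> Bgen_set v" for v
    proof -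
      obtain m where m: "j = Suc m" using \<open>j \<ge> 1\<close> by (cases j) auto
      then obtain a as where as: "\<alpha>s = a # as" "length as = m" using j by (cases \<alpha>s) auto
      have "src_word h = replicate m el_1 @ [el_1, b]"
        by (simp add: e m replicate_append_same[symmetric])
      then have "apply_at (Bgen_set v) id 2 j (src_word h) \<noteq> None"
        using that(3) m apply_at_last[of "replicate m el_1" m "Bgen_set v" id el_1 b] by simp
      then have "apply_at (Bgen_set v) id 2 j (src_word x) \<noteq> None"
        by (rule G2.pmorph_f_step[OF steps pmorph_filter[OF that(2)]])
      then show ?thesis
        using apply_at_last[of "rev as" m "Bgen_set v" id a b2] unfolding e(2) w m as(1)
        by (auto simp: as(2) split: if_splits)
    qed
    \<comment> \<open>The same for \<alpha>_2 \<otimes> \<open>\<xi>\<close>(\<alpha>_1 \<otimes>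
      \<beta>): after \<open>\<xi>\<close> at position j these are the letters in positions j - 1
      and j.\<close>
    have cond': "\<exists>u. \<xi>_at j w = Some u \<and> take 2 (drop (j - 2) u) \<in> Bgen_set v"
      if "j \<ge> 2" "v \<in> adj_words" "\<xi>_at j (src_word h) = Some (replicate (j - 2) el_1 @
        v)" "length v = 2" for v
    proof -
      obtain m where m: "j = Suc (Suc m)" using \<open>j \<ge> 2\<close> by (cases j; cases "j -
        1") auto
      let ?F = "\<lambda>w. Option.bind (\<xi>_at j w) (apply_at (Bgen_set v) id 2 (Suc m))"
      have "?F (src_word h) \<noteq> None"
        using that(3,4) m Bgen_refl[of v] by (simp add: apply_at_def)
      then have "?F (src_word x) \<noteq> None"
        by (rule G2.pmorph_f_step[OF steps G2.pmorph_bind[OF pmorphs(1) pmorph_filter[OF that(2)]]])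
      then obtain u where "\<xi>_at j w = Some u" "apply_at (Bgen_set v) id 2 (Suc m) u \<noteq> None"
        unfolding e(2) by (cases "\<xi>_at j w") auto
      then show ?thesis using m by (auto simp: apply_at_def Let_def split: if_splits)
    qed
    have p1: "word_of p @ c = p # c" if "fst (R h) = el_1"
      using p_empty that el_neq by (simp add: word_of_letter)
    consider "b = el_1" | "j \<ge> 1" "b = el_2" | "j \<ge> 1" "b = el_2_3" | "j \<ge> 1" "b = el_0"
      | "j \<ge> 1" "b = el_1bar" | "j \<ge> 2" "b = adj ! 8"
      using b False by blast
    then show thesis
    proof cases
      case 1
      have in11: "j = 0 \<or> [hd \<alpha>s, b2] \<in> Bgen_set [el_1, el_1]"
        using cond[OF _ highest_words(7)] Bgen_refl 1 by (cases j) auto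
      consider "j = l" | "j + 1 = l" | "j + 1 < l" using hj(2) by linarith
      then show thesis
      proof cases
        case jl: 1
        have Rh: "R h = (el_1, add_ones l el_empty)" using R_1_l hj 1 jl by simp
        have "Some (src_word h) = Some (tgt_word (R h))"
          unfolding tgt[OF Rh] e(3) 1 jl
          by (simp add: T_empty word_of_letter el_neq replicate_append_same)
        from transfer[OF G2.pmorph_Some this] have "p # c = w" using p1 Rh e(2) by simp
        then show thesis using goals(3) e(1) in11 jl by blast
      next
        case jl: 2
        have rl: "replicate l el_1 = replicate j el_1 @ [el_1]"
          unfolding jl[symmetric] Suc_eq_plus1[symmetric] by (simp add: replicate_append_same)
        have Rh: "R h = (el_empty, add_ones l el_empty)" using R_1_empty hj 1 jl by auto
        have "Some (src_word h) = Some (tgt_word (R h))"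
          unfolding tgt[OF Rh] e(3) 1 by (simp add: T_empty word_of_letter rl)
        from transfer[OF G2.pmorph_Some this] have "p = el_empty" "c = w"
          using p_empty Rh e(2) by (simp_all add: word_of_letter)
        then show thesis using goals(4) e(1) in11 jl by blast
      next
        case jl: 3
        have rl: "replicate (j + 1) el_1 = el_1 # replicate j el_1"
          unfolding Suc_eq_plus1[symmetric] by simp
        have Rh: "R h = (el_1, add_ones (j + 1) el_1bar)" using R_1[OF jl] hj 1 by simp
        have "Some ([el_1, el_1bar] @ src_word h) = Some (tgt_word (R h))"
          unfolding tgt[OF Rh] e(3) 1
          using jl by (simp add: T_letters word_of_letter el_neq replicate_append_same rl)
        from transfer[OF G2.pmorph_singlet_left[OF highest_words(10) el_1_1bar] this]
        have "p # c = [el_1, el_1bar] @ w" using p1 Rh e(2) by simp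
        then show thesis using goals(5) e(1) in11 jl by blast
      qed
    next
      case 2
      obtain m where m: "j = Suc m" using \<open>j \<ge> 1\<close> by (cases j) auto
      have in12: "[hd \<alpha>s, b2] \<in> Bgen_set [el_1, el_2]"
        using cond[OF 2(1) highest_words(8)] Bgen_refl 2 by auto
      have ch: "\<eta>_chain (j - 1) (src_word h) = Some ([el_1, el_2] @ replicate m el_1)"
        using chain_highest[of \<eta> el_2 m 0, OF \<eta>_highest] unfolding e(3) m 2 by simp
      show thesis
      proof (cases "j = l")
        case jl: True
        have Rh: "R h = (el_1, add_ones (l - 1) el_2)" using R_2_l hj 2 jl by simp
        have "tgt_word (R h) = [el_1, el_2] @ replicate m el_1"
          unfolding tgt[OF Rh] using jl m by (simp add: T_letters word_of_letter el_neq)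
        with ch transfer[OF pmorphs(3)] have "\<eta>_chain (j - 1) w = Some (p # c)" using p1 Rh
          e(2) by simp
        then show thesis using goals(6) e(1) 2(1) in12 jl by blast
      next
        case False
        then have jl: "j < l" using hj(2) by simp
        have Rh: "R h = (el_1, add_ones m el_20)" using R_2[OF 2(1) jl] hj 2 m by simp
        have Rw: "tgt_word (R h) = [el_1, el_0] @ [el_2] @ replicate m el_1"
          unfolding tgt[OF Rh] using jl m by (simp add: T_20 word_of_letter el_neq)
        have "Option.bind (\<eta>_chain (j - 1) (src_word h)) (\<xi>_inv_at 1) = Some (tgt_word (R h))"
          unfolding Rw ch using Bgen_refl[of "[el_1]"] by (simp add: apply_at_first \<xi>_inv_highest)
        from transfer[OF G2.pmorph_bind[OF pmorphs(3,2)] this]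
        have res: "Option.bind (\<eta>_chain (j - 1) w) (\<xi>_inv_at 1) = Some (p # c)" using p1
          Rh e(2) by simp
        \<comment> \<open>The top has at least three letters and lengths are preserved, so
          \<open>c\<close> is nonempty and supplies the entry r.\<close>
        have "length (tgt_word (R x)) = length (tgt_word (R h))"
          by (rule G2.f_step_length[OF G2.joint_f_step_snd[OF path]])
        then have "c \<noteq> []" using R_word Rw p1 Rh by auto
        with res show thesis using goals(7) e(1) 2(1) in12 jl by blast
      qed
    next
      case 3
      obtain m where m: "j = Suc m" using \<open>j \<ge> 1\<close> by (cases j) auto
      have in13: "[hd \<alpha>s, b2] \<in> Bgen_set [el_1, el_2_3]"
        using cond[OF 3(1) highest_words(9)] Bgen_refl 3 by auto
      have ch: "\<theta>_chain (j - 1) (src_word h) = Some ([el_1, el_2_3] @ replicate m el_1)"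
        using chain_highest[of \<theta> el_2_3 m 0, OF \<theta>_highest] unfolding e(3) m 3 by simp
      have Rh: "R h = (el_1, add_ones m el_2_3)" using R_2_3[OF 3(1) hj(2)] hj 3 m by simp
      have "tgt_word (R h) = [el_1, el_2_3] @ replicate m el_1"
        unfolding tgt[OF Rh] using hj(2) m by (simp add: T_letters word_of_letter el_neq)
      with ch transfer[OF pmorphs(4)] have "\<theta>_chain (j - 1) w = Some (p # c)" using p1 Rh
        e(2) by simp
      then show thesis using goals(8) e(1) 3(1) in13 by blast
    next
      case 4
      have in10: "[hd \<alpha>s, b2] \<in> Bgen_set [el_1, el_0]"
        using cond[OF 4(1) highest_words(1)] Bgen_refl 4 by auto
      have Rh: "R h = (el_1, add_ones (j - 1) el_0)" using R_0[OF 4(1) hj(2)] hj 4 by simp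
      have Rw: "tgt_word (R h) = [el_1, el_0] @ replicate (j - 1) el_1"
        unfolding tgt[OF Rh] using hj(2) 4 by (simp add: T_letters word_of_letter el_neq)
      show thesis
      proof (cases "j = 1")
        case j1: True
        have "Some (src_word h) = Some (tgt_word (R h))"
          unfolding Rw e(3) 4(2) j1 by (simp add: One_nat_def)
        from transfer[OF G2.pmorph_Some this] have "p # c = w" using p1 Rh e(2) by simp
        then show thesis using goals(9) e(1) in10 j1 by blast
      next
        case False
        then have j2: "j \<ge> 2" using 4(1) by linarith
        then obtain m where m: "j = Suc (Suc m)" by (cases j; cases "j - 1") auto
        have sw: "src_word h = replicate (Suc m) el_1 @ [el_1, el_0]"
          unfolding e(3) m 4 by (simp add: replicate_append_same[symmetric])
        have at: "\<xi>_at j (src_word h) = Some (replicate (Suc m) el_1 @ [el_1])"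
          unfolding sw m using apply_at_last[of "replicate (Suc m) el_1" "Suc m" "Bgen_set [el_1,
            el_0]" \<xi>]
            Bgen_refl[of "[el_1, el_0]"] \<xi>_highest by simp
        then have "\<xi>_at j (src_word h) = Some (replicate (j - 2) el_1 @ [el_1, el_1])"
          unfolding m by (simp add: replicate_append_same[symmetric])
        from cond'[OF j2 highest_words(7) this] obtain u where
          u: "\<xi>_at j w = Some u" "take 2 (drop (j - 2) u) \<in> Bgen_set [el_1, el_1]" by auto
        have "Option.bind (\<xi>_at j (src_word h)) (\<xi>_inv_at 1) = \<xi>_inv_at 1 (el_1 #
          replicate m el_1 @ [el_1])"
          by (simp add: at)
        also have "\<dots> = Some ([el_1, el_0] @ replicate m el_1 @ [el_1])"
          using Bgen_refl[of "[el_1]"] by (simp only: apply_at_first \<xi>_inv_highest if_True)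
        also have "\<dots> = Some (tgt_word (R h))"
          unfolding Rw m by (simp add: replicate_append_same)
        finally have "Option.bind (\<xi>_at j (src_word h)) (\<xi>_inv_at 1) = Some (tgt_word (R h))" .
        from transfer[OF G2.pmorph_bind[OF pmorphs(1,2)] this]
        have "\<xi>_inv_at 1 u = Some (p # c)" using p1 Rh e(2) u(1) by simp
        then show thesis using goals(10) e(1) j2 in10 u by blast
      qed
    next
      case 5
      have "[hd \<alpha>s, b2] = [el_1, el_1bar]"
        using cond[OF 5(1) highest_words(10)] Bgen_refl 5 Bgen_singlet by auto
      then have in1: "hd \<alpha>s = el_1" "b2 = el_1bar" by simp_all
      show thesis
      proof (cases "j = 1")
        case j1: True
        have Rh: "R h = (el_1, add_ones 0 el_1bar)" using R_1bar_1 hj 5 j1 by simp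
        have "Some (src_word h) = Some (tgt_word (R h))"
          unfolding tgt[OF Rh] e(3) 5(2) j1 using T_letters[of 0] l by (simp add: word_of_letter
            el_neq One_nat_def)
        from transfer[OF G2.pmorph_Some this] have "p # c = w" using p1 Rh e(2) by simp
        then show thesis using goals(12) e(1) in1 j1 by blast
      next
        case False
        then have j2: "j \<ge> 2" using 5(1) by linarith
        then obtain m where m: "j = Suc (Suc m)" by (cases j; cases "j - 1") auto
        have Rh: "R h = (el_1, add_ones (j - 2) el_empty)" using R_1bar[OF j2 hj(2)] hj 5 by simp
        have "Some (tgt_word (R h) @ [el_1, el_1bar]) = Some (src_word h)"
          unfolding tgt[OF Rh] e(3) 5(2) using hj(2) m
          by (simp add: T_empty word_of_letter el_neq replicate_append_same[symmetric])
        \<comment> \<open>The target is now the shorter word, so the path is read from target to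
          source, with the morphism appending 1 \<otimes> 1bar.\<close>
        from G2.pmorph_joint_f_step[OF G2.joint_f_step_swap[OF path] G2.pmorph_singlet_right[OF
          highest_words(10) el_1_1bar] this]
        have "w = (p # c) @ [el_1, el_1bar]" using p1 Rh e(2) R_word by simp
        then show thesis using goals(13) e(1) in1 j2 by blast
      qed
    next
      case 6
      have in10: "[hd \<alpha>s, b2] \<in> Bgen_set [el_1, el_0]"
        using cond[OF _ highest_words(1)] 6 el_3bar(1) by simp
      obtain m where m: "j = Suc (Suc m)" using 6(1) by (cases j; cases "j - 1") auto
      have jm: "j - 2 = m" using m by simp
      have Rh: "R h = (el_1, add_ones m el_2)" using R_3bar[OF 6(1) hj(2)] hj 6 m by simp
      have Rw: "tgt_word (R h) = [el_1, el_2] @ replicate m el_1"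
        unfolding tgt[OF Rh] using hj(2) m by (simp add: T_letters word_of_letter el_neq)
      have sw: "src_word h = replicate (Suc m) el_1 @ [el_1, adj ! 8]"
        unfolding e(3) m 6 by (simp add: replicate_append_same[symmetric])
      have at: "\<xi>_at j (src_word h) = Some (replicate (Suc m) el_1 @ [el_2])"
        unfolding sw m using apply_at_last[of "replicate (Suc m) el_1" "Suc m" "Bgen_set [el_1,
          el_0]" \<xi>]
          el_3bar by simp
      then have "\<xi>_at j (src_word h) = Some (replicate (j - 2) el_1 @ [el_1, el_2])"
        unfolding m by (simp add: replicate_append_same[symmetric])
      from cond'[OF 6(1) highest_words(8) this] obtain u where
        u: "\<xi>_at j w = Some u" "take 2 (drop (j - 2) u) \<in> Bgen_set [el_1, el_2]" by auto
      have "Option.bind (\<xi>_at j (src_word h)) (\<eta>_chain (j - 2)) = Some (tgt_word (R h))"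
        unfolding Rw at jm Option.bind.bind_lunit
        using chain_highest[of \<eta> el_2 m 0, OF \<eta>_highest] by simp
      from transfer[OF G2.pmorph_bind[OF pmorphs(1,3)] this]
      have "\<eta>_chain (j - 2) u = Some (p # c)" using p1 Rh e(2) u(1) by simp
      then show thesis using goals(11) e(1) 6(1) in10 u by blast
    qed
  qed
qed

lemma pair_class_Bgen:
  "v \<in> Bgen_set [el_1, el_1] \<Longrightarrow> pair_class v = 0" "v \<in> Bgen_set [el_1, el_2]
    \<Longrightarrow> pair_class v = 1"
  "v \<in> Bgen_set [el_1, el_2_3] \<Longrightarrow> pair_class v = 4" "v \<in> Bgen_set [el_1,
    el_0] \<Longrightarrow> pair_class v = 6"
  using pair_class_component[OF _ highest_words(7)] pair_class_component[OF _ highest_words(8)]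
    pair_class_component[OF _ highest_words(9)] pair_class_component[OF _ highest_words(1)]
      pair_class_highest by simp_all

lemma \<xi>_at_row:
  assumes "\<alpha>s = a # a' # as" "[a, b] \<in> Bgen_set [el_1, el_0]"
    "\<xi>_at (length \<alpha>s) (rev \<alpha>s @ [b]) = Some u"
  obtains r where "\<xi> [a, b] = [r]" "u = rev as @ [a', r]" "take 2 (drop (length \<alpha>s - 2)
    u) = [a'] @ \<xi> [a, b]"
proof -
  obtain r where r: "\<xi> [a, b] = [r]"
    using \<xi>_length[OF assms(2)] by (auto simp: length_Suc_conv One_nat_def)
  have "u = rev as @ [a', r]"
    using assms(2,3) apply_at_last[of "rev as @ [a']" "Suc (length as)" "Bgen_set [el_1, el_0]"
      \<xi> a b]
    unfolding assms(1) by (simp add: r)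
  then show thesis using that r by (simp add: assms(1))
qed

lemma \<xi>_inv_at_row:
  assumes "\<xi>_inv_at 1 (a # v) = Some (p # c)"
  obtains q where "\<xi>_inv [a] = [p, q]" "c = q # v"
proof -
  have a: "[a] \<in> Bgen_set [el_1]" "\<xi>_inv [a] @ v = p # c"
    using assms apply_at_first[of "Bgen_set [el_1]" \<xi>_inv a v] by (auto split: if_splits)
  then show thesis using that \<xi>_inv_length[OF a(1)] by (auto simp: length_Suc_conv numeral_2_eq_2)
qed

end

lemma row_split:
  assumes "p # c = rev as @ v" "as \<noteq> []"
  shows "p = last as" "c = rev (butlast as) @ v"
  using assms by (cases as rule: rev_cases; simp)+

theorem theorem3:
  fixes l :: nat
    and R :: "coords \<times> coords \<Rightarrow> coords \<times> coords"
    and T :: "coords \<Rightarrow> coords list"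
    and \<xi> \<eta> \<theta> :: "coords list \<Rightarrow> coords list"
    and b1 b2 :: coords
    and \<alpha>s :: "coords list"
  assumes l: "l \<ge> 1"
    and R: "crystal_iso {0, 1, 2} (tensor (Bcr l) (Bcr 1)) (tensor (Bcr 1) (Bcr l)) R"
    and T: "crystal_iso {1, 2} (Bcr l) (Rows l) T"
    and \<xi>: "crystal_iso {1, 2} (Bgen [el_1, el_0]) (Bgen [el_1]) \<xi>"
    and \<eta>: "crystal_iso {1, 2} (Bgen [el_1, el_1, el_2]) (Bgen [el_1, el_2, el_1]) \<eta>"
    and \<theta>: "crystal_iso {1, 2} (Bgen [el_1, el_1, el_2_3]) (Bgen [el_1, el_2_3, el_1]) \<theta>"
    and b1: "b1 \<in> Bset l" "T b1 = row \<alpha>s"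
    and b2: "b2 \<in> Bset 1"
  shows
    "let j = length \<alpha>s;
         \<alpha>\<^sub>1 = hd \<alpha>s; \<alpha>\<^sub>2 = \<alpha>s ! 1; \<alpha>\<^sub>j = last \<alpha>s;
         w = row \<alpha>s @ [b2];
         res = map_prod id T (R (b1, b2));
         \<xi>_inv = inv_into (Bgen_set [el_1, el_0]) \<xi>;
         \<xi>_at = apply_at (Bgen_set [el_1, el_0]) \<xi> 2;
         \<xi>_inv_at = apply_at (Bgen_set [el_1]) \<xi>_inv 1;
         \<eta>_chain = apply_chain (Bgen_set [el_1, el_1, el_2]) \<eta> 3;
         \<theta>_chain = apply_chain (Bgen_set [el_1, el_1, el_2_3]) \<theta> 3;
         in11 = (b2 \<noteq> el_empty \<and> (j = 0 \<or> [\<alpha>\<^sub>1, b2] \<in> Bgen_set [el_1, el_1]));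
         in12 = (b2 \<noteq> el_empty \<and> j \<ge> 1 \<and> [\<alpha>\<^sub>1, b2] \<in> Bgen_set [el_1, el_2]);
         in12\<^sub>3 = (b2 \<noteq> el_empty \<and> j \<ge> 1 \<and> [\<alpha>\<^sub>1, b2] \<in> Bgen_set [el_1, el_2_3]);
         in10 = (b2 \<noteq> el_empty \<and> j \<ge> 1 \<and> [\<alpha>\<^sub>1, b2] \<in> Bgen_set [el_1, el_0]);
         case1 = (in11 \<and> j = l);
         case2 = (in11 \<and> j + 1 = l);
         case3 = (in11 \<and> j + 1 < l);
         case4 = (b2 = el_empty \<and> j = l);
         case5 = (b2 = el_empty \<and> j < l);
         case6 = (in12 \<and> j = l);
         case7 = (in12 \<and> 1 \<le> j \<and> j < l);
         case8 = (in12\<^sub>3 \<and> j > 1);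
         case9 = (in10 \<and> j > 1 \<and> [\<alpha>\<^sub>2] @ \<xi> [\<alpha>\<^sub>1, b2] \<in> Bgen_set [el_1, el_1]);
         case10 = (in10 \<and> j > 1 \<and> [\<alpha>\<^sub>2] @ \<xi> [\<alpha>\<^sub>1, b2] \<in> Bgen_set [el_1, el_2]);
         case11 = (j > 1 \<and> \<alpha>\<^sub>1 = el_1 \<and> b2 = el_1bar)
     in
       (case1 \<longrightarrow> res = (\<alpha>\<^sub>j, row (b2 # butlast \<alpha>s))) \<and>
       (case2 \<longrightarrow> res = (el_empty, row (b2 # \<alpha>s))) \<and>
       (case3 \<longrightarrow> res = (el_1, row (b2 # \<alpha>s @ [el_1bar]))) \<and>
       (case4 \<longrightarrow> res = (\<alpha>\<^sub>j, row (butlast \<alpha>s))) \<and>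
       (case5 \<longrightarrow> res = (el_empty, row \<alpha>s)) \<and>
       (case6 \<longrightarrow> (\<exists>q qs. \<eta>_chain (l - 1) w = Some (q # row qs) \<and> res = (q, row qs))) \<and>
       (case7 \<longrightarrow> (\<exists>p r qs.
          Option.bind (\<eta>_chain (j - 1) w) (\<xi>_inv_at 1) = Some (p # r # row qs) \<and>
          res = (p, row (qs @ [r])))) \<and>
       (case8 \<longrightarrow> (\<exists>q qs. \<theta>_chain (j - 1) w = Some (q # row qs) \<and> res = (q, row qs))) \<and>
       (case9 \<longrightarrow> (\<exists>p q r.
          \<xi>_inv [\<alpha>\<^sub>j] = [p, q] \<and> \<xi> [\<alpha>\<^sub>1, b2] = [r] \<and>
          res = (p, row (r # butlast (tl \<alpha>s) @ [q])))) \<and>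
       (case10 \<longrightarrow> (\<exists>p qs.
          Option.bind (\<xi>_at j w) (\<eta>_chain (j - 2)) = Some (p # row qs) \<and> res = (p, row qs))) \<and>
       (case11 \<longrightarrow> res = (\<alpha>\<^sub>j, row (butlast (tl \<alpha>s)))) \<and>
       (\<not> (case1 \<or> case2 \<or> case3 \<or> case4 \<or> case5 \<or> case6 \<or> case7 \<or> case8 \<or> case9 \<or>
            case10 \<or> case11) \<longrightarrow>
          j = 1 \<and> b2 \<noteq> el_empty \<and> res = (\<alpha>\<^sub>1, row [b2]))"
proof -
  interpret combinatorial_R l T R \<xi> \<eta> \<theta>
    using l R T \<xi> \<eta> \<theta> by unfold_locales
  define j where "j = length \<alpha>s"
  define w where "w = rev \<alpha>s @ [b2]"
  define p where "p = fst (R (b1, b2))"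
  define c where "c = T (snd (R (b1, b2)))"
  have res: "map_prod id T (R (b1, b2)) = (p, c)" by (simp add: p_def c_def map_prod_def split_beta)
  have T': "T b1 = rev \<alpha>s" using b1(2) by (simp add: row_def)
  have w': "row \<alpha>s @ [b2] = w" by (simp add: row_def w_def)
  have a2: "\<alpha>s = hd \<alpha>s # \<alpha>s ! 1 # tl (tl \<alpha>s)" if "j \<ge> 2"
    using that by (cases \<alpha>s; cases "tl \<alpha>s") (auto simp: j_def)
  have class_bar: "pair_class [el_1, el_1bar] = 13" by (rule pair_class_highest)
  have cl: "[hd \<alpha>s, b2] \<in> Bgen_set [el_1, el_1] \<Longrightarrow> pair_class [hd
    \<alpha>s, b2] = 0"
    "[hd \<alpha>s, b2] \<in> Bgen_set [el_1, el_2] \<Longrightarrow> pair_class [hd \<alpha>s, b2] = 1"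
    "[hd \<alpha>s, b2] \<in> Bgen_set [el_1, el_2_3] \<Longrightarrow> pair_class [hd \<alpha>s,
      b2] = 4"
    "[hd \<alpha>s, b2] \<in> Bgen_set [el_1, el_0] \<Longrightarrow> pair_class [hd \<alpha>s, b2] = 6"
    "hd \<alpha>s = el_1 \<and> b2 = el_1bar \<Longrightarrow> pair_class [hd \<alpha>s, b2] = 13"
    using pair_class_Bgen[of "[hd \<alpha>s, b2]"] class_bar by auto
  have w1: "w = [hd \<alpha>s, b2]" if "j = 1"
    using that unfolding w_def j_def by (cases \<alpha>s) (auto simp: One_nat_def)
  have single: "p = hd \<alpha>s" "c = row [b2]" if "j = 1" "p # c = w"
    using that(2) unfolding w1[OF that(1)] by (simp_all add: row_def)
  have rev_c: "c = row (rev c)" by (simp add: row_def)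
  define A1 where "A1 \<longleftrightarrow> [hd \<alpha>s, b2] \<in> Bgen_set [el_1, el_1]"
  define A2 where "A2 \<longleftrightarrow> [hd \<alpha>s, b2] \<in> Bgen_set [el_1, el_2]"
  define A3 where "A3 \<longleftrightarrow> [hd \<alpha>s, b2] \<in> Bgen_set [el_1, el_2_3]"
  define A0 where "A0 \<longleftrightarrow> [hd \<alpha>s, b2] \<in> Bgen_set [el_1, el_0]"
  define Ab where "Ab \<longleftrightarrow> hd \<alpha>s = el_1 \<and> b2 = el_1bar"
  define D1 where "D1 \<longleftrightarrow> [\<alpha>s ! 1] @ \<xi> [hd \<alpha>s, b2] \<in>
    Bgen_set [el_1, el_1]"
  define D2 where "D2 \<longleftrightarrow> [\<alpha>s ! 1] @ \<xi> [hd \<alpha>s, b2] \<in>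
    Bgen_set [el_1, el_2]"
  note defs = A1_def[symmetric] A2_def[symmetric] A3_def[symmetric] A0_def[symmetric] Ab_def[symmetric]
    D1_def[symmetric] D2_def[symmetric]
  have D12: "\<not> (D1 \<and> D2)"
    unfolding D1_def D2_def using pair_class_Bgen(1,2) by fastforce
  \<comment> \<open>The five conditions give \<open>pair_class\<close> the different values 0, 1, 4,
    6 and 13.\<close>
  have excl: "A1 \<Longrightarrow> \<not> A2 \<and> \<not> A3 \<and> \<not> A0 \<and> \<not> Ab"
    "A2 \<Longrightarrow> \<not> A1 \<and> \<not> A3 \<and> \<not> A0 \<and> \<not> Ab"
    "A3 \<Longrightarrow> \<not> A1 \<and> \<not> A2 \<and> \<not> A0 \<and> \<not> Ab" "A0
      \<Longrightarrow> \<not> A1 \<and> \<not> A2 \<and> \<not> A3 \<and> \<not> Ab"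
    "Ab \<Longrightarrow> \<not> A1 \<and> \<not> A2 \<and> \<not> A3 \<and> \<not> A0"
    using cl unfolding defs by auto
  show ?thesis
    unfolding Let_def w' res j_def[symmetric] defs
  proof (rule families[OF b1(1) T' b2 p_def c_def j_def w_def], unfold defs, goal_cases)
    case 1
    have ne: "\<alpha>s \<noteq> []" using 1(2) l by (auto simp: j_def)
    have "p = last \<alpha>s" "c = row (butlast \<alpha>s)" using row_split[of p c \<alpha>s "[]"]
      1(3) ne by (simp_all add: row_def)
    moreover have "\<not> Ab" using 1(1) el_neq by (simp add: Ab_def)
    ultimately show ?case using 1(1,2) by simp
  next
    case 2
    moreover have "\<not> Ab" using 2(1) el_neq by (simp add: Ab_def)
    ultimately show ?case by (simp add: row_def)
  next
    case 3
    have ne: "\<alpha>s \<noteq> []" "j \<noteq> 0" using 3(3) l by (auto simp: j_def)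
    have "p = last \<alpha>s" "c = row (b2 # butlast \<alpha>s)"
      using row_split[of p c \<alpha>s "[b2]"] 3(4) ne by (simp_all add: row_def w_def)
    then show ?case using 3(1-3) ne(2) excl(1) by simp
  next
    case 4
    then show ?case using excl(1) by (cases "j = 0") (simp_all add: row_def w_def)
  next
    case 5
    then have "p = el_1" "c = row (b2 # \<alpha>s @ [el_1bar])" by (simp_all add: row_def w_def)
    then show ?case using 5(1-3) excl(1) by (cases "j = 0") simp_all
  next
    case 6
    have "\<exists>q qs. \<eta>_chain (l - 1) w = Some (q # row qs) \<and> (p, c) = (q, row qs)"
      using 6(4,5) rev_c by metis
    then show ?case using 6(1-4) excl(2) by simp
  next
    case 7
    obtain r c' where "c = r # c'" using 7(6) by (cases c) auto
    then have "\<exists>p' r qs. Option.bind (\<eta>_chain (j - 1) w) (\<xi>_inv_at 1) = Some (p' #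
      r # row qs) \<and>
        (p, c) = (p', row (qs @ [r]))"
      unfolding 7(5) by - (rule exI[of _ p], rule exI[of _ r], rule exI[of _ "rev c'"], simp add:
        row_def)
    then show ?case using 7(1-4) excl(2) by simp
  next
    case 8
    show ?case
    proof (cases "j = 1")
      \<comment> \<open>For j = 1 the chain is empty, and this alternative belongs to the residual
        case.\<close>
      case True
      then have "p # c = w" using 8(4) by simp
      from single[OF True this] show ?thesis using True 8(1-3) excl(3) by simp
    next
      case False
      have "\<exists>q qs. \<theta>_chain (j - 1) w = Some (q # row qs) \<and> (p, c) = (q, row qs)"
        using 8(4) rev_c by metis
      then show ?thesis using False 8(1-3) excl(3) by simp
    qed
  next
    case 9
    from single[OF 9(2,4)] show ?case using 9(1-3) excl(4) by simp
  next
    case (10 u)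
    obtain a a' as where as: "\<alpha>s = a # a' # as" using a2[OF 10(2)] by blast
    have "[a, b2] \<in> Bgen_set [el_1, el_0]" using 10(3) as by (simp add: A0_def)
    from \<xi>_at_row[OF as this] 10(4) obtain r where r: "\<xi> [a, b2] = [r]" "u = rev as @ [a', r]"
      "take 2 (drop (j - 2) u) = [a'] @ \<xi> [a, b2]" unfolding w_def j_def by blast
    have "D1" using 10(5) r as by (simp add: D1_def One_nat_def)
    \<comment> \<open>The first letter of u is \<alpha>_j also for j = 2, where \<open>as\<close> is
      empty and \<alpha>_2 is the last entry.\<close>
    have v: "u = last \<alpha>s # rev (butlast (tl \<alpha>s)) @ [r]"
      unfolding r(2) as by (cases as rule: rev_cases) auto
    from \<xi>_inv_at_row[OF 10(6)[unfolded v]] obtain q where q: "\<xi>_inv [last \<alpha>s] = [p, q]"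
      "c = q # rev (butlast (tl \<alpha>s)) @ [r]" by blast
    have "\<exists>p' q r. \<xi>_inv [last \<alpha>s] = [p', q] \<and> \<xi> [hd \<alpha>s, b2] =
      [r] \<and>
        (p, c) = (p', row (r # butlast (tl \<alpha>s) @ [q]))"
      using q r(1) as by - (rule exI[of _ p], rule exI[of _ q], rule exI[of _ r], simp add: row_def)
    then show ?case using 10(1-3) D12 \<open>D1\<close> excl(4) by simp
  next
    case (11 u)
    obtain a a' as where as: "\<alpha>s = a # a' # as" using a2[OF 11(2)] by blast
    have "[a, b2] \<in> Bgen_set [el_1, el_0]" using 11(3) as by (simp add: A0_def)
    from \<xi>_at_row[OF as this] 11(4) have "take 2 (drop (j - 2) u) = [a'] @ \<xi> [a, b2]"
      unfolding w_def j_def by blast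
    then have "D2" using 11(5) as by (simp add: D2_def One_nat_def)
    have "\<exists>p' qs. Option.bind (\<xi>_at j w) (\<eta>_chain (j - 2)) = Some (p' # row qs)
      \<and> (p, c) = (p', row qs)"
    proof -
      have "Option.bind (\<xi>_at j w) (\<eta>_chain (j - 2)) = Some (p # c)" using 11(4,6) by simp
      then show ?thesis using rev_c by metis
    qed
    then show ?case using 11(1-3) D12 \<open>D2\<close> excl(4) by simp
  next
    case 12
    have "Ab" using 12(3,4) by (simp add: Ab_def)
    from single[OF 12(2,5)] show ?case using 12(1,2) excl(5)[OF \<open>Ab\<close>] by simp
  next
    case 13
    have "Ab" using 13(3,4) by (simp add: Ab_def)
    obtain a a' as where as: "\<alpha>s = a # a' # as" using a2[OF 13(2)] by blast
    have "p = last \<alpha>s" "c = row (butlast (tl \<alpha>s))"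
      using 13(5) unfolding w_def as by (cases as rule: rev_cases; simp add: row_def)+
    then show ?case using 13(1,2) \<open>Ab\<close> excl(5)[OF \<open>Ab\<close>] by simp
  qed
qed

end
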